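(* Consider the symmetric long-range exclusion process in dimension $d\ge1$ with exponent $\alpha>0$, at density $\rho\in(0,1)$. Let $f$ be a local function. (i) $d=1$: $f$ is admissible if $\deg(f)\ge 3$; or if $\deg(f)=2$ and $\alpha<2$; or if $\deg(f)=1$ and $\alpha<1$. (ii) $d=2$: $f$ is admissible if $\deg(f)\ge2$; or if $\deg(f)=1$ and $\alpha<2$. (iii) $d\ge3$: $f$ is admissible if $\deg(f)\ge1$.
   Context: Symmetric long-range kernel: $s(0)=0$, $s(y)=\frac{c}{|y|^{d+\alpha}}\sum_{i=1}^d\frac{b_i^++b_i^-}{2}\mathbf{1}_{y_i\neq0}$ for $y\in\mathbb{Z}^d\setminus\{0\}$, where $b_i^\pm>0$ are constants and $c$ normalizes $s$ to a probability. The exclusion process with jump probability $s$ is the Markov process $\eta_t$ on $\Omega=\{0,1\}^{\mathbb{Z}^d}$ with generator acting on local functions (depending on finitely many coordinates) by $\mathcal{L}f(\eta)=\sum_{x,y}s(y)\eta(x)(1-\eta(x+y))[f(\eta^{x,x+y})-f(\eta)]$, where $\eta^{x,x+y}$ is $\eta$ with the values at $x,x+y$ exchanged. It is started from the invariant Bernoulli product measure $\nu_\rho$ of density $\rho$; $\mathbb{E}_\rho$ is the corresponding expectation. Set $\Gamma_f(t)=\int_0^tf(\eta_s)ds$ and $\sigma_t^2(f)=\mathbb{E}_\rho[\Gamma_f(t)^2]$. A local $f$ is admissible if $\limsup_{t\to\infty}t^{-1}\sigma_t^2(f)<\infty$. Degree: with $\mu_f(z)=\int f\,d\nu_z$, $\deg(f)$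 is the integer $i\ge0$ with $\mu_f^{(i)}(\rho)\ne0$ and $\mu_f^{(j)}(\rho)=0$ for all $j<i$; $\deg(f)=\infty$ if all derivatives (including order $0$) vanish at $\rho$. *)

theory Defs
  imports "HOL-Probability.Probability"
begin

text \<open>
  The lattice of dimension d is \<open>int ^ 'd\<close> with d = \<open>CARD('d)\<close>. A configuration is a
  predicate on sites, \<open>True\<close> meaning occupied (value 1). \<open>bool\<close> carries the discrete topology, so
  the topology on configurations is the compact product topology, and every continuous real
  function on them is an element of \<open>'d config \<Rightarrow>\<^sub>C real\<close>.
\<close>

type_synonym 'd site = "int ^ 'd"
type_synonym 'd config = "'d site \<Rightarrow> bool"

definition config_space :: "'d::finite config measure" where
  "config_space = PiM UNIV (\<lambda>_. count_space UNIV)"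

definition bernoulli_product :: "real \<Rightarrow> 'd::finite config measure" where
  "bernoulli_product \<rho> = PiM UNIV (\<lambda>_. measure_pmf (bernoulli_pmf \<rho>))"

definition local_function :: "('d::finite config \<Rightarrow> real) \<Rightarrow> bool" where
  "local_function f \<longleftrightarrow>
     (\<exists>A. finite A \<and> (\<forall>\<eta> \<xi>. (\<forall>x\<in>A. \<eta> x = \<xi> x) \<longrightarrow> f \<eta> = f \<xi>))"

definition euclidean_length :: "'d::finite site \<Rightarrow> real" where
  "euclidean_length y = norm (\<chi> i. real_of_int (y $ i))"

definition kernel_weight ::
  "('d::finite \<Rightarrow> real) \<Rightarrow> ('d \<Rightarrow> real) \<Rightarrow> real \<Rightarrow> 'd site \<Rightarrow> real" where
  "kernel_weight bp bm \<alpha> y =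
     (if y = 0 then 0
      else (\<Sum>i\<in>UNIV. (bp i + bm i) / 2 * of_bool (y $ i \<noteq> 0))
             / euclidean_length y powr (real CARD('d) + \<alpha>))"

text \<open>For \<open>\<alpha> > 0\<close> the weights are summable, and the constant c is the inverse of their sum.\<close>

definition jump_kernel ::
  "('d::finite \<Rightarrow> real) \<Rightarrow> ('d \<Rightarrow> real) \<Rightarrow> real \<Rightarrow> 'd site \<Rightarrow> real" where
  "jump_kernel bp bm \<alpha> y =
     kernel_weight bp bm \<alpha> y / (\<Sum>\<^sub>\<infinity>z\<in>UNIV. kernel_weight bp bm \<alpha> z)"

definition exchange :: "'d::finite site \<Rightarrow> 'd site \<Rightarrow> 'd config \<Rightarrow> 'd config" where
  "exchange x y \<eta> = \<eta>(x := \<eta> y, y := \<eta> x)"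

text \<open>For local f the sum over pairs converges absolutely.\<close>

definition exclusion_operator ::
  "('d::finite site \<Rightarrow> real) \<Rightarrow> ('d config \<Rightarrow> real) \<Rightarrow> 'd config \<Rightarrow> real" where
  "exclusion_operator s f \<eta> =
     (\<Sum>\<^sub>\<infinity>(x, y)\<in>UNIV. s y * of_bool (\<eta> x) * (1 - of_bool (\<eta> (x + y)))
                          * (f (exchange x (x + y) \<eta>) - f \<eta>))"

text \<open>Markov semigroups on C(\<open>\<Omega>\<close>) in the sense of Liggett, indexed by times \<open>t \<ge> 0\<close>.\<close>

definition markov_semigroup ::
  "(real \<Rightarrow> ('d::finite config \<Rightarrow>\<^sub>C real) \<Rightarrow> ('d config \<Rightarrow>\<^sub>C real)) \<Rightarrow> bool" where
  "markov_semigroup S \<longleftrightarrow>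
     (\<forall>t\<ge>0. linear (S t)) \<and>
     (\<forall>g. S 0 g = g) \<and>
     (\<forall>t\<ge>0. \<forall>u\<ge>0. \<forall>g. S (t + u) g = S t (S u g)) \<and>
     (\<forall>t\<ge>0. S t (const_bcontfun 1) = const_bcontfun 1) \<and>
     (\<forall>t\<ge>0. \<forall>g. (\<forall>\<eta>. 0 \<le> apply_bcontfun g \<eta>) \<longrightarrow> (\<forall>\<eta>. 0 \<le> apply_bcontfun (S t g) \<eta>)) \<and>
     (\<forall>g. \<forall>t\<ge>0. continuous (at_right t) (\<lambda>u. S u g))"

text \<open>
  \<open>h\<close> is the value of the generator of \<open>S\<close> at \<open>g\<close>; the limit is in the supremum norm.
\<close>

definition generator_value ::
  "(real \<Rightarrow> ('d::finite config \<Rightarrow>\<^sub>C real) \<Rightarrow> ('d config \<Rightarrow>\<^sub>C real))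
     \<Rightarrow> ('d config \<Rightarrow>\<^sub>C real) \<Rightarrow> ('d config \<Rightarrow>\<^sub>C real) \<Rightarrow> bool" where
  "generator_value S g h \<longleftrightarrow> ((\<lambda>t. (S t g - g) /\<^sub>R t) \<longlongrightarrow> h) (at_right 0)"

text \<open>
  Local functions form a core of the closure of the exclusion operator, so this condition
  determines \<open>S\<close>.
\<close>

definition exclusion_semigroup ::
  "('d::finite site \<Rightarrow> real) \<Rightarrow> (real \<Rightarrow> ('d config \<Rightarrow>\<^sub>C real) \<Rightarrow> ('d config \<Rightarrow>\<^sub>C real)) \<Rightarrow> bool" where
  "exclusion_semigroup s S \<longleftrightarrow>
     markov_semigroup S \<and>
     (\<forall>g. local_function (apply_bcontfun g) \<longrightarrow>
        (\<exists>h. generator_value S g h \<and>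
             apply_bcontfun h = exclusion_operator s (apply_bcontfun g)))"

definition past :: "'w measure \<Rightarrow> (real \<Rightarrow> 'w \<Rightarrow> 'd::finite config) \<Rightarrow> real \<Rightarrow> 'w measure" where
  "past M X t =
     sigma (space M) {X u -` A \<inter> space M | u A. 0 \<le> u \<and> u \<le> t \<and> A \<in> sets config_space}"

definition cadlag_path :: "(real \<Rightarrow> 'd::finite config) \<Rightarrow> bool" where
  "cadlag_path x \<longleftrightarrow>
     (\<forall>t\<ge>0. continuous (at_right t) x) \<and> (\<forall>t>0. \<exists>l. (x \<longlongrightarrow> l) (at_left t))"

definition markov_with ::
  "'w measure \<Rightarrow> (real \<Rightarrow> 'w \<Rightarrow> 'd::finite config)
     \<Rightarrow> (real \<Rightarrow> ('d config \<Rightarrow>\<^sub>C real) \<Rightarrow> ('d config \<Rightarrow>\<^sub>C real)) \<Rightarrow> bool" where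
  "markov_with M X S \<longleftrightarrow>
     (\<forall>t\<ge>0. X t \<in> measurable M config_space) \<and>
     (\<forall>\<omega>\<in>space M. cadlag_path (\<lambda>t. X t \<omega>)) \<and>
     (\<forall>t\<ge>0. \<forall>u\<ge>0. \<forall>g. AE \<omega> in M.
        real_cond_exp M (past M X t) (\<lambda>\<omega>. apply_bcontfun g (X (t + u) \<omega>)) \<omega>
          = apply_bcontfun (S u g) (X t \<omega>))"

definition exclusion_process ::
  "('d::finite site \<Rightarrow> real) \<Rightarrow> real \<Rightarrow> 'w measure \<Rightarrow> (real \<Rightarrow> 'w \<Rightarrow> 'd config) \<Rightarrow> bool" where
  "exclusion_process s \<rho> M X \<longleftrightarrow>
     prob_space M \<and>
     (\<exists>S. exclusion_semigroup s S \<and> markov_with M X S) \<and>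
     distr M config_space (X 0) = bernoulli_product \<rho>"

definition additive_functional ::
  "(real \<Rightarrow> 'w \<Rightarrow> 'd::finite config) \<Rightarrow> ('d config \<Rightarrow> real) \<Rightarrow> real \<Rightarrow> 'w \<Rightarrow> real" where
  "additive_functional X f t \<omega> = (LINT u:{0..t}|lborel. f (X u \<omega>))"

definition functional_variance ::
  "'w measure \<Rightarrow> (real \<Rightarrow> 'w \<Rightarrow> 'd::finite config) \<Rightarrow> ('d config \<Rightarrow> real) \<Rightarrow> real \<Rightarrow> real" where
  "functional_variance M X f t = (LINT \<omega>|M. (additive_functional X f t \<omega>)\<^sup>2)"

definition admissible ::
  "'w measure \<Rightarrow> (real \<Rightarrow> 'w \<Rightarrow> 'd::finite config) \<Rightarrow> ('d config \<Rightarrow> real) \<Rightarrow> bool" where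
  "admissible M X f \<longleftrightarrow> Limsup at_top (\<lambda>t. ereal (functional_variance M X f t / t)) < \<infinity>"

definition bernoulli_mean :: "('d::finite config \<Rightarrow> real) \<Rightarrow> real \<Rightarrow> real" where
  "bernoulli_mean f z = (LINT \<eta>|bernoulli_product z. f \<eta>)"

text \<open>
  \<open>bernoulli_pmf z\<close> is meaningful only for \<open>0 \<le> z \<le> 1\<close>; derivatives are taken at an interior point.
\<close>

definition function_degree :: "real \<Rightarrow> ('d::finite config \<Rightarrow> real) \<Rightarrow> enat" where
  "function_degree \<rho> f =
     (if \<forall>i. (deriv ^^ i) (bernoulli_mean f) \<rho> = 0 then \<infinity>
      else enat (LEAST i. (deriv ^^ i) (bernoulli_mean f) \<rho> \<noteq> 0))"

end

theory Submission
  imports Defs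
begin

text \<open>
  The products \<open>basis \<rho> A\<close> of normalized occupation variables over finite sets \<open>A\<close> are
  orthonormal in \<open>L\<^sup>2\<close> of the Bernoulli measure, and the generator maps them to absolutely
  convergent combinations of products over sets of the same cardinality. The functions
  \<open>u\<^sub>t A = \<langle>S\<^sub>t (basis \<rho> A), f\<rangle>\<close> therefore solve the linear equation of the finite exclusion
  process, whose rates are bounded. For \<open>f = 1\<close> this gives invariance of the Bernoulli
  measure, hence \<open>L\<^sup>2\<close> contractivity and square summability of \<open>u\<^sub>t\<close> and of its time integral
  \<open>W\<^sub>t\<close>. Let \<open>b = u\<^sub>0\<close> be the coefficients of \<open>f\<close> and \<open>D\<close> the Dirichlet form. From
  \<open>u\<^sub>t - b = L W\<^sub>t\<close> and \<open>\<langle>b, w\<rangle>\<^sup>2 \<le> C D(w)\<close> for all \<open>w\<close> one obtains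
  \<open>\<langle>b, W\<^sub>t\<rangle> \<le> C' - \<langle>W\<^sub>t, u\<^sub>t\<rangle>\<close>; the last term integrates to half of the squared norm of
  \<open>W\<^sub>t\<close>, so the variance, which is twice the time integral of \<open>\<langle>b, W\<^sub>t\<rangle>\<close>, grows at most linearly.

  The bound \<open>\<langle>b, w\<rangle>\<^sup>2 \<le> C D(w)\<close> is proved separately on each cardinality \<open>n\<close>. The degree
  of \<open>f\<close> is the first \<open>n\<close> on which the coefficients do not sum to 0. If they do sum to 0, the
  functional is a combination of differences along single jumps. Otherwise evaluation at a single set is
  bounded, which is transience of \<open>n\<close> particles: this holds if \<open>n d > 2\<close>, by nearest neighbour jumps, and
  through long jumps if \<open>n = 1\<close> and \<open>\<alpha> < d\<close>, or \<open>d = 1\<close> and \<open>\<alpha> < n\<close>.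
\<close>

section \<open>The jump kernel\<close>

text \<open>The generator is known only on local functions, and \<open>S t f\<close> need not be
  local. The flow itself is therefore never expanded: only its values under bounded functionals are
  followed, with the generator applied to fixed basis functions. The time integral W_t takes the
  role that a resolvent often has. The thresholds come from counting powers of the side L of a box.
  Positions of n particles have n d coordinates. Averages over boxes of doubling side converge
  geometrically if the squared differences over all pairs of points on lines parallel to one axis
  sum to at most a constant times L^(1 + \<beta>) times the energy, with \<beta> < n d. Unit steps
  give \<beta> = 2, direct jumps along an axis give \<beta> = \<gamma> - 1 with \<gamma> = d +
  \<alpha>. For n = 1 and d = 2 the latter reaches only \<alpha> < 1; this is why a single particle
  is also treated through jumps in all directions, which give \<alpha> < d. Exclusion obstructs the
  independent variation of coordinates; confining the particles to disjoint lanes restores it, at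
  the price of constants only.\<close>

lemma euclidean_length_minus [simp]: "euclidean_length (- y) = euclidean_length y"
  by (simp add: euclidean_length_def norm_vec_def L2_set_def)

lemma abs_component_le_euclidean_length: "\<bar>real_of_int (y $ i)\<bar> \<le> euclidean_length y"
  using component_le_norm_cart[of "\<chi> i. real_of_int (y $ i)" i] by (simp add: euclidean_length_def)

lemma euclidean_length_ge_1:
  assumes "y \<noteq> 0"
  shows "1 \<le> euclidean_length y"
proof -
  obtain i where "y $ i \<noteq> 0"
    using assms by (metis vec_eq_iff zero_index)
  then have "1 \<le> \<bar>real_of_int (y $ i)\<bar>"
    by linarith
  then show ?thesis
    using abs_component_le_euclidean_length[of y i] by linarith
qed

lemma euclidean_length_le_sum: "euclidean_length y \<le> (\<Sum>i\<in>UNIV. \<bar>real_of_int (y $ i)\<bar>)"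
  using norm_le_l1_cart[of "\<chi> i. real_of_int (y $ i)"] by (simp add: euclidean_length_def)

section \<open>Summability of power weights on the lattice\<close>

lemma bounded_sum_max_one_powr:
  fixes s :: real
  assumes "s > 1"
  obtains B where "0 \<le> B" "\<And>N::nat. (\<Sum>k\<in>{- int N..int N}. max 1 \<bar>real_of_int k\<bar> powr - s) \<le> B"
proof -
  have sm: "summable (\<lambda>n. real n powr - s)"
    using assms by (simp add: summable_real_powr_iff)
  define S where "S = (\<Sum>n. real n powr - s)"
  have part: "(\<Sum>n<N. real n powr - s) \<le> S" for N
    unfolding S_def by (rule sum_le_suminf[OF sm]) auto
  have "(\<Sum>k\<in>{- int N..int N}. max 1 \<bar>real_of_int k\<bar> powr - s) \<le> 1 + 2 * S" for N
  proof -
    have eq: "{- int N..int N} = {0} \<union> (int ` {1..N} \<union> (\<lambda>n. - int n) ` {1..N})"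
    proof (intro equalityI subsetI)
      fix k assume k: "k \<in> {- int N..int N}"
      consider "k = 0" | "0 < k" | "k < 0" by linarith
      then show "k \<in> {0} \<union> (int ` {1..N} \<union> (\<lambda>n. - int n) ` {1..N})"
      proof cases
        case 2
        then have "k = int (nat k)" "nat k \<in> {1..N}" using k by auto
        then show ?thesis by blast
      next
        case 3
        then have "k = - int (nat (- k))" "nat (- k) \<in> {1..N}" using k by auto
        then show ?thesis by blast
      qed simp
    qed auto
    have a: "(\<Sum>k\<in>int ` {1..N}. max 1 \<bar>real_of_int k\<bar> powr - s) \<le> S"
    proof -
      have "(\<Sum>k\<in>int ` {1..N}. max 1 \<bar>real_of_int k\<bar> powr - s) = (\<Sum>n\<in>{1..N}. real n powr - s)"
        by (subst sum.reindex) (auto intro!: sum.cong simp: max_def)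
      also have "\<dots> \<le> (\<Sum>n<Suc N. real n powr - s)"
        by (rule sum_mono2) auto
      finally show ?thesis using part[of "Suc N"] by linarith
    qed
    have b: "(\<Sum>k\<in>(\<lambda>n. - int n) ` {1..N}. max 1 \<bar>real_of_int k\<bar> powr - s) \<le> S"
    proof -
      have "(\<Sum>k\<in>(\<lambda>n. - int n) ` {1..N}. max 1 \<bar>real_of_int k\<bar> powr - s)
          = (\<Sum>n\<in>{1..N}. real n powr - s)"
        by (subst sum.reindex) (auto intro!: sum.cong simp: max_def inj_on_def)
      also have "\<dots> \<le> (\<Sum>n<Suc N. real n powr - s)"
        by (rule sum_mono2) auto
      finally show ?thesis using part[of "Suc N"] by linarith
    qed
    have "(\<Sum>k\<in>{- int N..int N}. max 1 \<bar>real_of_int k\<bar> powr - s)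
      = 1 + (\<Sum>k\<in>int ` {1..N} \<union> (\<lambda>n. - int n) ` {1..N}. max 1 \<bar>real_of_int k\<bar> powr - s)"
      unfolding eq by (subst sum.union_disjoint) auto
    also have "(\<Sum>k\<in>int ` {1..N} \<union> (\<lambda>n. - int n) ` {1..N}. max 1 \<bar>real_of_int k\<bar> powr - s)
      = (\<Sum>k\<in>int ` {1..N}. max 1 \<bar>real_of_int k\<bar> powr - s)
       + (\<Sum>k\<in>(\<lambda>n. - int n) ` {1..N}. max 1 \<bar>real_of_int k\<bar> powr - s)"
      by (subst sum.union_disjoint) auto
    finally show ?thesis using a b by linarith
  qed
  moreover have "0 \<le> S" using part[of 0] by simp
  ultimately show thesis by (intro that[of "1 + 2 * S"]) auto
qed

text \<open>
  The Euclidean length dominates every coordinate, so the weight is bounded by a product of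
  one-dimensional summable weights.
\<close>
lemma summable_euclidean_length_powr:
  fixes \<alpha> :: real
  assumes "0 < \<alpha>"
  shows "(\<lambda>y::'d::finite site. of_bool (y \<noteq> 0) * euclidean_length y powr - (real CARD('d) + \<alpha>))
    summable_on UNIV"
proof -
  \<comment> \<open>The exponent d + \<alpha> is shared equally among the d coordinates; each share
    exceeds 1, so every one-dimensional factor is summable.\<close>
  define s where "s = 1 + \<alpha> / real CARD('d)"
  have s: "s > 1" and ds: "real CARD('d) * s = real CARD('d) + \<alpha>"
    using assms by (auto simp: s_def field_simps)
  obtain B where B: "0 \<le> B"
      "\<And>N::nat. (\<Sum>k\<in>{- int N..int N}. max 1 \<bar>real_of_int k\<bar> powr - s) \<le> B"
    using bounded_sum_max_one_powr[OF s] by blast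
  let ?g = "\<lambda>y::'d site. of_bool (y \<noteq> 0) * euclidean_length y powr - (real CARD('d) + \<alpha>)"
  let ?h = "\<lambda>y::'d site. \<Prod>i\<in>UNIV. max 1 \<bar>real_of_int (y $ i)\<bar> powr - s"
  have le: "?g y \<le> ?h y" for y
  proof (cases "y = 0")
    case True
    then show ?thesis by (simp add: prod_nonneg)
  next
    case False
    then have ge1: "1 \<le> euclidean_length y" by (rule euclidean_length_ge_1)
    have "(\<Prod>i\<in>(UNIV::'d set). euclidean_length y powr - s) \<le> ?h y"
    proof (rule prod_mono, intro conjI)
      fix i :: 'd
      have "max 1 \<bar>real_of_int (y $ i)\<bar> \<le> euclidean_length y"
        using ge1 abs_component_le_euclidean_length[of y i] by simp
      then show "euclidean_length y powr - s \<le> max 1 \<bar>real_of_int (y $ i)\<bar> powr - s"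
        using s by (intro powr_mono2') auto
    qed auto
    moreover have "(\<Prod>i\<in>(UNIV::'d set). euclidean_length y powr - s)
        = euclidean_length y powr - (real CARD('d) + \<alpha>)"
      using ge1 by (simp add: powr_realpow[symmetric] powr_powr flip: ds) (simp add: mult.commute)
    ultimately show ?thesis using False by simp
  qed
  show ?thesis
  proof (rule nonneg_bdd_above_summable_on)
    show "bdd_above (sum ?g ` {F. F \<subseteq> UNIV \<and> finite F})"
    proof (rule bdd_aboveI2)
      fix F :: "'d site set" assume "F \<in> {F. F \<subseteq> UNIV \<and> finite F}"
      then have F: "finite F" by simp
      \<comment> \<open>The finite set \<open>F\<close> lies in the cube of points with coordinates
        between -\<open>N\<close> and \<open>N\<close>, over which a sum of products factorizes. The
        inserted 0 keeps \<open>Max\<close> meaningful for empty \<open>F\<close>.\<close>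
      define N where "N = Max (insert 0 ((\<lambda>(y, i). nat \<bar>y $ i\<bar>) ` (F \<times> UNIV)))"
      have N: "\<bar>y $ i\<bar> \<le> int N" if "y \<in> F" for y i
      proof -
        have "nat \<bar>y $ i\<bar> \<le> N"
          unfolding N_def by (rule Max_ge) (use F that in \<open>auto intro!: image_eqI[of _ _ "(y, i)"]\<close>)
        then show ?thesis by linarith
      qed
      let ?P = "PiE UNIV (\<lambda>_::'d. {- int N..int N})"
      have sub: "F \<subseteq> vec_lambda ` ?P"
      proof
        fix y assume "y \<in> F"
        then have "vec_nth y \<in> ?P"
          using N by (auto simp: abs_le_iff) (metis minus_le_iff)
        then show "y \<in> vec_lambda ` ?P"
          by (metis image_eqI vec_lambda_eta)
      qed
      have fin: "finite ?P" by (intro finite_PiE) auto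
      have "sum ?g F \<le> sum ?h F" by (rule sum_mono[OF le])
      also have "\<dots> \<le> sum ?h (vec_lambda ` ?P)"
        by (rule sum_mono2) (use fin sub in \<open>auto intro!: prod_nonneg\<close>)
      also have "\<dots> = (\<Sum>f\<in>?P. \<Prod>i\<in>UNIV. max 1 \<bar>real_of_int (f i)\<bar> powr - s)"
        by (subst sum.reindex) (auto simp: inj_on_def vec_lambda_inject)
      also have "\<dots> = (\<Prod>i\<in>(UNIV::'d set). \<Sum>k\<in>{- int N..int N}. max 1 \<bar>real_of_int k\<bar> powr - s)"
        by (subst prod_sum_PiE) auto
      also have "\<dots> \<le> (\<Prod>i\<in>(UNIV::'d set). B)"
        by (intro prod_mono conjI sum_nonneg B) auto
      finally show "sum ?g F \<le> B ^ CARD('d)" by simp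
    qed
  qed auto
qed

text \<open>In the application \<gamma> = d + \<alpha>. The total mass 1 bounds the rate at which a
  set of sites is left; the lower bound gives jumps of length at most R a weight of order
  R^(-\<gamma>) in the energy.\<close>

locale long_range_kernel =
  fixes s :: "'d::finite site \<Rightarrow> real" and \<gamma> c :: real
  assumes kernel_nonneg: "0 \<le> s y"
    and kernel_minus: "s (- y) = s y"
    and kernel_summable: "s summable_on UNIV"
    and kernel_infsum: "infsum s UNIV = 1"
    and c_pos: "0 < c"
    and exponent_pos: "0 < \<gamma>"
    and kernel_ge: "y \<noteq> 0 \<Longrightarrow> c * euclidean_length y powr - \<gamma> \<le> s y"

lemma long_range_kernel_jump_kernel:
  fixes bp bm :: "'d::finite \<Rightarrow> real"
  assumes bp: "\<And>i. 0 < bp i" and bm: "\<And>i. 0 < bm i" and "0 < \<alpha>"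
  obtains c where "long_range_kernel (jump_kernel bp bm \<alpha>) (real CARD('d) + \<alpha>) c"
proof -
  let ?w = "kernel_weight bp bm \<alpha>"
  let ?g = "\<lambda>y::'d site. of_bool (y \<noteq> 0) * euclidean_length y powr - (real CARD('d) + \<alpha>)"
  define b where "b = (\<lambda>i. (bp i + bm i) / 2)"
  have b: "0 < b i" for i
    using bp[of i] bm[of i] by (simp add: b_def)
  have w_eq: "?w y = (\<Sum>i\<in>UNIV. b i * of_bool (y $ i \<noteq> 0)) * ?g y" for y
    unfolding kernel_weight_def b_def powr_minus_divide by simp
  \<comment> \<open>A nonzero \<open>y\<close> has at least one nonzero coordinate, so the sum over
    directions lies between the smallest coefficient \<open>k\<close> and the total
    \<open>K\<close>.\<close>
  define K where "K = (\<Sum>i\<in>UNIV. b i)"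
  define k where "k = Min (range b)"
  have k: "k \<le> b i" for i
    unfolding k_def by (rule Min_le) auto
  have "0 < k"
    using b by (auto simp: k_def)
  have w_nonneg: "0 \<le> ?w y" for y
    unfolding w_eq using b by (intro mult_nonneg_nonneg sum_nonneg) (simp_all add: less_imp_le)
  have w_le: "?w y \<le> K * ?g y" for y
    unfolding w_eq K_def using b by (intro mult_right_mono sum_mono) (simp_all add: less_imp_le)
  have w_ge: "k * euclidean_length y powr - (real CARD('d) + \<alpha>) \<le> ?w y" if y: "y \<noteq> 0" for y
  proof -
    obtain i where i: "y $ i \<noteq> 0"
      using y by (metis vec_eq_iff zero_index)
    have "k \<le> b i * of_bool (y $ i \<noteq> 0)" using k[of i] i by simp
    also have "\<dots> \<le> (\<Sum>i\<in>UNIV. b i * of_bool (y $ i \<noteq> 0))"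
      using b by (intro member_le_sum) (simp_all add: less_imp_le)
    finally have "k * euclidean_length y powr - (real CARD('d) + \<alpha>)
        \<le> (\<Sum>i\<in>UNIV. b i * of_bool (y $ i \<noteq> 0)) * euclidean_length y powr - (real CARD('d) + \<alpha>)"
      by (rule mult_right_mono) simp
    then show ?thesis using y by (simp add: w_eq)
  qed
  have sm: "?w summable_on UNIV"
  proof (rule summable_on_comparison_test)
    show "(\<lambda>y. K * ?g y) summable_on UNIV"
      by (intro summable_on_cmult_right summable_euclidean_length_powr assms)
  qed (use w_nonneg w_le in auto)
  define Z where "Z = infsum ?w UNIV"
  obtain y0 :: "'d site" where y0: "y0 \<noteq> 0" by (metis one_index one_neq_zero zero_index)
  have "0 < k * euclidean_length y0 powr - (real CARD('d) + \<alpha>)"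
    using euclidean_length_ge_1[OF y0] \<open>0 < k\<close> by simp
  also have "\<dots> \<le> ?w y0" by (rule w_ge[OF y0])
  also have "\<dots> \<le> Z"
    using finite_sum_le_infsum[OF sm, of "{y0}"] w_nonneg by (simp add: Z_def)
  finally have Z: "0 < Z" .
  have jk: "jump_kernel bp bm \<alpha> = (\<lambda>y. ?w y * inverse Z)"
    unfolding jump_kernel_def Z_def divide_inverse ..
  have "long_range_kernel (jump_kernel bp bm \<alpha>) (real CARD('d) + \<alpha>) (k * inverse Z)"
  proof
    show "jump_kernel bp bm \<alpha> (- y) = jump_kernel bp bm \<alpha> y" for y
      by (simp add: jk kernel_weight_def)
    show "infsum (jump_kernel bp bm \<alpha>) UNIV = 1"
      unfolding jk using Z by (simp add: infsum_cmult_left' Z_def)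
    show "jump_kernel bp bm \<alpha> summable_on UNIV"
      unfolding jk by (intro summable_on_cmult_left sm)
    show "0 < k * inverse Z"
      using Z \<open>0 < k\<close> by simp
    show "0 \<le> jump_kernel bp bm \<alpha> y" for y
      using w_nonneg[of y] Z by (simp add: jk)
    show "0 < real CARD('d) + \<alpha>"
      using \<open>0 < \<alpha>\<close> by simp
    show "k * inverse Z * euclidean_length y powr - (real CARD('d) + \<alpha>) \<le> jump_kernel bp bm \<alpha> y"
      if "y \<noteq> 0" for y
      using mult_right_mono[OF w_ge[OF that], of "inverse Z"] Z by (simp add: jk ac_simps)
  qed
  then show thesis by (rule that)
qed

section \<open>Poincare inequalities on grids\<close>

lemma power2_sum_le_card_mult: "(sum f A)\<^sup>2 \<le> real (card A) * (\<Sum>x\<in>A. (f x :: real)\<^sup>2)"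
  using Cauchy_Schwarz_ineq_sum[of "\<lambda>_. 1" f A] by simp

lemma power2_diff_le_double: "(a - b)\<^sup>2 \<le> 2 * (a - c)\<^sup>2 + 2 * (c - b)\<^sup>2" for a b c :: real
  using sum_squares_ge_zero[of "a + b - 2 * c" 0]
  by (simp add: power2_eq_square algebra_simps)

text \<open>
  The averages of \<open>h\<close> over the nested boxes \<open>B k\<close> interpolate between \<open>h p\<close> and 0, and the
  Poincare inequality in the boxes makes their increments decay geometrically.
\<close>
lemma multiscale_point_bound:
  fixes B :: "nat \<Rightarrow> 'j set" and h :: "'j \<Rightarrow> real" and V :: nat
  assumes fin: "\<And>k. finite (B k)"
    and card: "\<And>k. card (B k) = V ^ k" and V: "2 \<le> V"
    and B0: "B 0 = {p}"
    and sub: "\<And>k. B k \<subseteq> B (Suc k)"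
    and M: "\<And>k. (\<Sum>x\<in>B k. (h x)\<^sup>2) \<le> M"
    and poin: "\<And>k. (\<Sum>x\<in>B k. \<Sum>y\<in>B k. (h x - h y)\<^sup>2) \<le> K * \<theta> ^ k * (real V ^ k)\<^sup>2 * D"
    and \<theta>: "0 \<le> \<theta>" "\<theta> < 1" and KD: "0 \<le> K" "0 \<le> D"
  shows "(h p)\<^sup>2 \<le> K * V / (1 - sqrt \<theta>)\<^sup>2 * D"
proof -
  define m where "m k = (\<Sum>x\<in>B k. h x) / real V ^ k" for k
  define G where "G = sqrt (K * V * D)"
  define r where "r = sqrt \<theta>"
  have Vpos: "0 < real V ^ k" for k using V by simp
  have r: "0 \<le> r" "r < 1" using \<theta> by (simp_all add: r_def)
  have G: "0 \<le> G" using KD by (simp add: G_def)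
  have step: "\<bar>m k - m (Suc k)\<bar> \<le> G * r ^ Suc k" for k
  proof -
    \<comment> \<open>The increment is the mean of \<open>h x - h y\<close> over
      \<open>B k \<times> B (Suc k)\<close>. Enlarging this product to the square of
      \<open>B (Suc k)\<close> costs the factor \<open>V\<close> that appears in the final
      bound.\<close>
    let ?P = "B k \<times> B (Suc k)"
    have eq: "m k - m (Suc k) = (\<Sum>(x, y)\<in>?P. h x - h y) / (real V ^ k * real V ^ Suc k)"
      using Vpos[of k] Vpos[of "Suc k"] V
      by (simp add: sum.cartesian_product[symmetric] sum_subtractf sum_distrib_left[symmetric]
          sum_distrib_right[symmetric] card m_def field_simps)
    have "(\<Sum>(x, y)\<in>?P. h x - h y)\<^sup>2 \<le> real (card ?P) * (\<Sum>(x, y)\<in>?P. (h x - h y)\<^sup>2)"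
      using power2_sum_le_card_mult[of "\<lambda>(x, y). h x - h y" ?P] by (simp add: split_def)
    also have "(\<Sum>(x, y)\<in>?P. (h x - h y)\<^sup>2) \<le> (\<Sum>(x, y)\<in>B (Suc k) \<times> B (Suc k). (h x - h y)\<^sup>2)"
      by (rule sum_mono2) (use sub[of k] fin in auto)
    also have "\<dots> \<le> K * \<theta> ^ Suc k * (real V ^ Suc k)\<^sup>2 * D"
      using poin[of "Suc k"] by (simp add: sum.cartesian_product)
    finally have "(\<Sum>(x, y)\<in>?P. h x - h y)\<^sup>2
        \<le> (real V ^ k * real V ^ Suc k) * (K * \<theta> ^ Suc k * (real V ^ Suc k)\<^sup>2 * D)"
      by (simp add: card card_cartesian_product mult_left_mono)
    then have "(m k - m (Suc k))\<^sup>2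
        \<le> (real V ^ k * real V ^ Suc k) * (K * \<theta> ^ Suc k * (real V ^ Suc k)\<^sup>2 * D)
           / (real V ^ k * real V ^ Suc k)\<^sup>2"
      unfolding eq power_divide by (rule divide_right_mono) simp
    also have "\<dots> = K * V * D * \<theta> ^ Suc k"
      using Vpos[of k] V by (simp add: power2_eq_square field_simps)
    also have "\<dots> = (G * r ^ Suc k)\<^sup>2"
    proof -
      have "G\<^sup>2 = K * V * D" "r\<^sup>2 = \<theta>"
        using KD \<theta> by (simp_all add: G_def r_def)
      moreover have "(G * r ^ Suc k)\<^sup>2 = G\<^sup>2 * (r\<^sup>2) ^ Suc k"
        by (metis power_mult power_mult_distrib mult.commute)
      ultimately show ?thesis by simp
    qed
    finally show ?thesis
      using G r by (metis abs_le_square_iff abs_of_nonneg mult_nonneg_nonneg zero_le_power)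
  qed
  have geo: "G * (\<Sum>k<n. r ^ Suc k) \<le> G / (1 - r)" for n
  proof -
    have "(\<Sum>k<n. r ^ Suc k) \<le> (\<Sum>k<n. r ^ k)"
      using r by (intro sum_mono) (simp add: mult_left_le_one_le)
    also have "\<dots> = (1 - r ^ n) / (1 - r)"
      using r by (simp add: sum_gp_strict)
    also have "\<dots> \<le> 1 / (1 - r)"
      using r by (intro divide_right_mono) auto
    finally show ?thesis using G by (metis mult_left_mono times_divide_eq_right mult.right_neutral)
  qed
  have tel: "\<bar>m 0 - m n\<bar> \<le> G / (1 - r)" for n
  proof -
    have "\<bar>m 0 - m n\<bar> \<le> (\<Sum>k<n. \<bar>m k - m (Suc k)\<bar>)"
      by (induction n) auto
    also have "\<dots> \<le> (\<Sum>k<n. G * r ^ Suc k)"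
      by (intro sum_mono step)
    finally show ?thesis using geo[of n] by (simp add: sum_distrib_left)
  qed
  \<comment> \<open>Square summability enters here: the sums of squares stay below \<open>M\<close>
    while the boxes grow, which forces the averages to 0. The value of \<open>M\<close> then
    disappears from the bound.\<close>
  have m_sq: "(m n)\<^sup>2 \<le> M * (1 / real V) ^ n" for n
  proof -
    have "(\<Sum>x\<in>B n. h x)\<^sup>2 \<le> real V ^ n * M"
      using power2_sum_le_card_mult[of h "B n"] mult_left_mono[OF M[of n], of "real V ^ n"]
      by (simp add: card)
    then have "(m n)\<^sup>2 \<le> real V ^ n * M / (real V ^ n)\<^sup>2"
      unfolding m_def power_divide by (rule divide_right_mono) simp
    also have "\<dots> = M * (1 / real V) ^ n"
      using Vpos[of n] by (simp add: power2_eq_square field_simps)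
    finally show ?thesis .
  qed
  have "(\<lambda>n. M * (1 / real V) ^ n) \<longlonglongrightarrow> M * 0"
    using V by (intro tendsto_intros LIMSEQ_realpow_zero) auto
  then have "(\<lambda>n. (m n)\<^sup>2) \<longlonglongrightarrow> 0"
    by (intro tendsto_sandwich[of "\<lambda>_. 0" "\<lambda>n. (m n)\<^sup>2" _ "\<lambda>n. M * (1 / real V) ^ n"])
       (simp_all add: m_sq)
  then have "m \<longlonglongrightarrow> 0"
    using tendsto_real_sqrt[of "\<lambda>n. (m n)\<^sup>2" 0] by (simp add: tendsto_rabs_zero_iff)
  then have "(\<lambda>n. \<bar>m 0 - m n\<bar>) \<longlonglongrightarrow> \<bar>m 0 - 0\<bar>"
    by (intro tendsto_intros)
  then have "\<bar>m 0\<bar> \<le> G / (1 - r)"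
    using tel by (intro LIMSEQ_le_const2) auto
  then have "(h p)\<^sup>2 \<le> (G / (1 - r))\<^sup>2"
    using r G by (auto simp: m_def B0 abs_le_square_iff[symmetric])
  also have "\<dots> = K * V / (1 - sqrt \<theta>)\<^sup>2 * D"
    using KD by (simp add: G_def r_def power_divide)
  finally show ?thesis .
qed

text \<open>Points of the box are total functions that vanish off \<open>E\<close>. Equality of
  points is thus equality of functions, updates at \<open>e \<in> E\<close> by values below
  \<open>L\<close> stay in the box, and the box of side 1 is the single zero function.\<close>

definition grid :: "'e set \<Rightarrow> nat \<Rightarrow> ('e \<Rightarrow> nat) set" where
  "grid E L = PiE_dflt E 0 (\<lambda>_. {..<L})"

lemma finite_grid [simp]: "finite E \<Longrightarrow> finite (grid E L)"
  by (auto simp: grid_def)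

lemma card_grid: "finite E \<Longrightarrow> card (grid E L) = L ^ card E"
  by (simp add: grid_def card_PiE_dflt)

lemma grid_mono: "L \<le> L' \<Longrightarrow> grid E L \<subseteq> grid E L'"
  by (auto simp: grid_def PiE_dflt_def)

lemma grid_1: "grid E (Suc 0) = {\<lambda>_. 0}"
  by (auto simp: grid_def PiE_dflt_def)

lemma sum_grid_insert:
  assumes "finite E" "e \<notin> E"
  shows "(\<Sum>x\<in>grid (insert e E) L. G x) = (\<Sum>x\<in>grid E L. \<Sum>a<L. (G (x(e := a)) :: real))"
proof -
  have "(\<Sum>x\<in>grid E L. \<Sum>a<L. G (x(e := a))) = (\<Sum>(x, a)\<in>grid E L \<times> {..<L}. G (x(e := a)))"
    by (simp add: sum.cartesian_product)
  also have "\<dots> = (\<Sum>x\<in>grid (insert e E) L. G x)"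
    by (rule sum.reindex_bij_witness[of _ "\<lambda>x. (x(e := 0), x e)" "\<lambda>(x, a). x(e := a)"])
       (use assms in \<open>auto simp: grid_def PiE_dflt_def fun_eq_iff\<close>)
  finally show ?thesis by simp
qed

text \<open>Induction on the coordinates: to get from \<open>x\<close> to \<open>y\<close>, change
  one coordinate and then the remaining ones. Each such split doubles the squared differences,
  whence \<open>2 ^ card E\<close>. Summation over coordinates that a term does not involve gives
  the powers of \<open>L\<close>, and the factor \<open>L\<close> on the left replaces a division by
  the length of a line.\<close>

lemma grid_poincare:
  fixes h :: "('e \<Rightarrow> nat) \<Rightarrow> real"
  assumes "finite E"
  shows "real L * (\<Sum>x\<in>grid E L. \<Sum>y\<in>grid E L. (h x - h y)\<^sup>2)
    \<le> 2 ^ card E * real L ^ card E * (\<Sum>e\<in>E. \<Sum>x\<in>grid E L. \<Sum>b<L. (h x - h (x(e := b)))\<^sup>2)"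
  using assms
proof (induction E arbitrary: h rule: finite_induct)
  case empty
  have "grid {} L = {\<lambda>_::'e. 0}" by (auto simp: grid_def PiE_dflt_def)
  then show ?case by simp
next
  case (insert e F)
  let ?F = "grid F L"
  let ?c = "\<lambda>e'. \<Sum>x\<in>grid (insert e F) L. \<Sum>b<L. (h x - h (x(e' := b)))\<^sup>2"
  let ?V = "\<lambda>b. \<Sum>x\<in>?F. \<Sum>y\<in>?F. (h (x(e := b)) - h (y(e := b)))\<^sup>2"
  have "(\<Sum>x\<in>grid (insert e F) L. \<Sum>y\<in>grid (insert e F) L. (h x - h y)\<^sup>2)
      = (\<Sum>x\<in>?F. \<Sum>a<L. \<Sum>y\<in>?F. \<Sum>b<L. (h (x(e := a)) - h (y(e := b)))\<^sup>2)"
    using insert by (simp add: sum_grid_insert)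
  also have "\<dots> \<le> (\<Sum>x\<in>?F. \<Sum>a<L. \<Sum>y\<in>?F. \<Sum>b<L. 2 * (h (x(e := a)) - h (x(e := b)))\<^sup>2
        + 2 * (h (x(e := b)) - h (y(e := b)))\<^sup>2)"
    by (intro sum_mono power2_diff_le_double)
  also have "\<dots> = 2 * (real L ^ card F * ?c e) + 2 * (real L * (\<Sum>b<L. ?V b))"
  proof -
    have "(\<Sum>x\<in>?F. \<Sum>a<L. \<Sum>y\<in>?F. \<Sum>b<L. (h (x(e := a)) - h (x(e := b)))\<^sup>2) = real L ^ card F * ?c e"
      using insert
      by (simp add: sum_grid_insert sum_distrib_left[symmetric] card_grid)
    moreover have "(\<Sum>x\<in>?F. \<Sum>a<L. \<Sum>y\<in>?F. \<Sum>b<L. (h (x(e := b)) - h (y(e := b)))\<^sup>2)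
        = real L * (\<Sum>b<L. ?V b)"
    proof -
      have "(\<Sum>x\<in>?F. \<Sum>a<L. \<Sum>y\<in>?F. \<Sum>b<L. (h (x(e := b)) - h (y(e := b)))\<^sup>2)
        = real L * (\<Sum>x\<in>?F. \<Sum>y\<in>?F. \<Sum>b<L. (h (x(e := b)) - h (y(e := b)))\<^sup>2)"
        by (simp add: sum_distrib_left)
      also have "(\<Sum>x\<in>?F. \<Sum>y\<in>?F. \<Sum>b<L. (h (x(e := b)) - h (y(e := b)))\<^sup>2) = (\<Sum>b<L. ?V b)"
      proof -
        have "(\<Sum>x\<in>?F. \<Sum>y\<in>?F. \<Sum>b<L. (h (x(e := b)) - h (y(e := b)))\<^sup>2)
          = (\<Sum>x\<in>?F. \<Sum>b<L. \<Sum>y\<in>?F. (h (x(e := b)) - h (y(e := b)))\<^sup>2)"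
          by (intro sum.cong refl) (rule sum.swap)
        then show ?thesis by (simp add: sum.swap[of _ "{..<L}"])
      qed
      finally show ?thesis .
    qed
    ultimately show ?thesis
      by (simp only: sum.distrib sum_distrib_left[symmetric])
  qed
  finally have "real L * (\<Sum>x\<in>grid (insert e F) L. \<Sum>y\<in>grid (insert e F) L. (h x - h y)\<^sup>2)
     \<le> real L * (2 * (real L ^ card F * ?c e) + 2 * (real L * (\<Sum>b<L. ?V b)))"
    by (intro mult_left_mono) auto
  also have "\<dots> = 2 * real L ^ Suc (card F) * ?c e + 2 * real L * (\<Sum>b<L. real L * ?V b)"
    by (simp add: sum_distrib_left algebra_simps)
  finally have 1: "real L * (\<Sum>x\<in>grid (insert e F) L. \<Sum>y\<in>grid (insert e F) L. (h x - h y)\<^sup>2)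
     \<le> 2 * real L ^ Suc (card F) * ?c e + 2 * real L * (\<Sum>b<L. real L * ?V b)" .
  have "(\<Sum>b<L. real L * ?V b) \<le> (\<Sum>b<L. 2 ^ card F * real L ^ card F *
       (\<Sum>e'\<in>F. \<Sum>x\<in>?F. \<Sum>a<L. (h (x(e := b)) - h ((x(e' := a))(e := b)))\<^sup>2))"
    by (intro sum_mono insert.IH)
  also have "\<dots> = 2 ^ card F * real L ^ card F * (\<Sum>e'\<in>F. ?c e')"
  proof -
    have "(\<Sum>b<L. \<Sum>e'\<in>F. \<Sum>x\<in>?F. \<Sum>a<L. (h (x(e := b)) - h ((x(e' := a))(e := b)))\<^sup>2)
      = (\<Sum>e'\<in>F. \<Sum>x\<in>?F. \<Sum>b<L. \<Sum>a<L. (h (x(e := b)) - h ((x(e' := a))(e := b)))\<^sup>2)"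
      by (subst sum.swap, intro sum.cong refl, subst sum.swap, rule refl)
    also have "\<dots> = (\<Sum>e'\<in>F. ?c e')"
    proof (rule sum.cong[OF refl])
      fix e' assume "e' \<in> F"
      then have "e' \<noteq> e" using insert by auto
      then show "(\<Sum>x\<in>?F. \<Sum>b<L. \<Sum>a<L. (h (x(e := b)) - h ((x(e' := a))(e := b)))\<^sup>2) = ?c e'"
        using insert by (simp add: sum_grid_insert fun_upd_twist)
    qed
    finally show ?thesis by (simp only: sum_distrib_left[symmetric])
  qed
  finally have 2: "(\<Sum>b<L. real L * ?V b) \<le> 2 ^ card F * real L ^ card F * (\<Sum>e'\<in>F. ?c e')" .
  have *: "real L * (\<Sum>x\<in>grid (insert e F) L. \<Sum>y\<in>grid (insert e F) L. (h x - h y)\<^sup>2)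
     \<le> 2 * real L ^ Suc (card F) * ?c e + 2 * real L * (2 ^ card F * real L ^ card F * (\<Sum>e'\<in>F. ?c e'))"
    using 1 mult_left_mono[OF 2, of "2 * real L"] by linarith
  have 3: "2 * real L ^ Suc (card F) * ?c e \<le> 2 ^ Suc (card F) * real L ^ Suc (card F) * ?c e"
    by (intro mult_right_mono sum_nonneg) (simp_all add: mult_right_mono)
  have arith: "X \<le> 2 ^ Suc n * l ^ Suc n * (p + q)"
    if "X \<le> 2 * l ^ Suc n * p + 2 * l * (2 ^ n * l ^ n * q)"
      "2 * l ^ Suc n * p \<le> 2 ^ Suc n * l ^ Suc n * p" for X l p q :: real and n
    using that by (simp add: algebra_simps)
  have "card (insert e F) = Suc (card F)" "(\<Sum>e'\<in>insert e F. ?c e') = ?c e + (\<Sum>e'\<in>F. ?c e')"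
    using insert by simp_all
  then show ?case
    using arith[OF * 3] by presburger
qed

text \<open>With n = \<open>card E\<close>, the Poincare inequality on a box of side L has a
  right-hand side of order L^(n + \<beta>) = (L^n)^2 L^(\<beta> - n). For L = 2^k this is geometric
  decay with ratio \<open>2 powr (\<beta> - n)\<close>, which is below 1 exactly when \<beta> <
  n.\<close>

lemma grid_point_bound:
  fixes h :: "('e \<Rightarrow> nat) \<Rightarrow> real" and \<beta> :: real
  assumes E: "finite E" "E \<noteq> {}" and \<beta>: "\<beta> < real (card E)"
    and M: "\<And>L. (\<Sum>x\<in>grid E L. (h x)\<^sup>2) \<le> M"
    and K: "\<And>L e. e \<in> E \<Longrightarrow>
      (\<Sum>x\<in>grid E L. \<Sum>b<L. (h x - h (x(e := b)))\<^sup>2) \<le> K * real L powr (1 + \<beta>) * D"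
    and KD: "0 \<le> K" "0 \<le> D"
  shows "(h (\<lambda>_. 0))\<^sup>2
    \<le> 2 ^ card E * real (card E) * K * 2 ^ card E / (1 - sqrt (2 powr (\<beta> - card E)))\<^sup>2 * D"
proof -
  define n where "n = card E"
  have n: "0 < n" using E by (simp add: n_def card_gt_0_iff)
  have "(h (\<lambda>_. 0))\<^sup>2 \<le> (2 ^ n * n * K) * real (2 ^ n) / (1 - sqrt (2 powr (\<beta> - n)))\<^sup>2 * D"
  proof (rule multiscale_point_bound[where B = "\<lambda>k. grid E (2 ^ k)"])
    show "card (grid E (2 ^ k)) = (2 ^ n) ^ k" for k
      using E by (simp add: card_grid n_def power_mult[symmetric] mult.commute)
    show "(2::nat) \<le> 2 ^ n" using n self_le_power[of "2::nat" n] by simp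
    show "grid E (2 ^ 0) = {\<lambda>_. 0}" by (simp add: grid_1)
    show "grid E (2 ^ k) \<subseteq> grid E (2 ^ Suc k)" for k by (intro grid_mono) simp
    show "2 powr (\<beta> - n) < 1" using \<beta> by (simp add: n_def powr_less_one)
    show "(\<Sum>x\<in>grid E (2 ^ k). \<Sum>y\<in>grid E (2 ^ k). (h x - h y)\<^sup>2)
      \<le> 2 ^ n * n * K * (2 powr (\<beta> - n)) ^ k * (real (2 ^ n) ^ k)\<^sup>2 * D" (is "?S \<le> _") for k
    proof -
      let ?L = "(2::nat) ^ k"
      have "real ?L * ?S \<le> 2 ^ n * ?L ^ n
          * (\<Sum>e\<in>E. \<Sum>x\<in>grid E ?L. \<Sum>b<?L. (h x - h (x(e := b)))\<^sup>2)"
        using grid_poincare[OF E(1), of ?L h] by (simp add: n_def)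
      also have "\<dots> \<le> 2 ^ n * ?L ^ n * (\<Sum>e\<in>E. K * real ?L powr (1 + \<beta>) * D)"
        by (intro mult_left_mono sum_mono K) auto
      also have "\<dots> = real ?L * (2 ^ n * n * K * (real ?L ^ n * real ?L powr \<beta>) * D)"
        by (simp add: n_def powr_add)
      finally have "?S \<le> 2 ^ n * n * K * (real ?L ^ n * real ?L powr \<beta>) * D"
        by simp
      also have "real ?L ^ n * real ?L powr \<beta> = (2 powr (\<beta> - n)) ^ k * (real (2 ^ n) ^ k)\<^sup>2"
      proof -
        have "real ?L = 2 powr k" by (simp add: powr_realpow)
        then have "real ?L ^ n * real ?L powr \<beta> = 2 powr (k * n + k * \<beta>)"
          by (simp add: powr_powr powr_add powr_realpow[symmetric] flip: of_nat_mult)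
        moreover have "(2 powr (\<beta> - n)) ^ k = 2 powr ((\<beta> - n) * k)"
          by (simp add: powr_powr flip: powr_realpow)
        moreover have "(real (2 ^ n) ^ k)\<^sup>2 = 2 powr (2 * n * k)"
          by (simp add: powr_realpow[of 2 "2 * n * k", simplified] flip: power_mult)
        ultimately show ?thesis
          by (simp add: algebra_simps flip: powr_add)
      qed
      finally show ?thesis by (simp add: mult_ac)
    qed
  qed (use E M KD in auto)
  then show ?thesis by (simp add: n_def)
qed

text \<open>The difference telescopes along the path from \<open>a\<close> to \<open>b\<close>, and
  Cauchy-Schwarz costs a factor \<open>L\<close>; the L^2 pairs supply the rest of L^3.\<close>

lemma sum_lessThan_double_diff_power2_le:
  fixes u :: "nat \<Rightarrow> real"
  shows "(\<Sum>a<L. \<Sum>b<L. (u a - u b)\<^sup>2) \<le> real L ^ 3 * (\<Sum>j<L - 1. (u j - u (Suc j))\<^sup>2)"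
proof -
  let ?S = "\<Sum>j<L - 1. (u j - u (Suc j))\<^sup>2"
  have *: "(u a - u b)\<^sup>2 \<le> L * ?S" if "a \<le> b" "b < L" for a b
  proof -
    have "u a - u b = (\<Sum>j\<in>{a..<b}. u j - u (Suc j))"
      using \<open>a \<le> b\<close> by (induction b rule: dec_induct) (auto simp: algebra_simps)
    then have "(u a - u b)\<^sup>2 \<le> real (card {a..<b}) * (\<Sum>j\<in>{a..<b}. (u j - u (Suc j))\<^sup>2)"
      using power2_sum_le_card_mult by metis
    also have "\<dots> \<le> L * ?S"
      using that by (intro mult_mono sum_mono2) (auto intro: sum_nonneg)
    finally show ?thesis .
  qed
  have "(\<Sum>a<L. \<Sum>b<L. (u a - u b)\<^sup>2) \<le> (\<Sum>a<L. \<Sum>b<L. L * ?S)"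
  proof (intro sum_mono)
    fix a b assume "a \<in> {..<L}" "b \<in> {..<L}"
    then show "(u a - u b)\<^sup>2 \<le> L * ?S"
      using *[of a b] *[of b a] by (cases "a \<le> b") (auto simp: power2_commute)
  qed
  then show ?thesis by (simp add: power3_eq_cube mult_ac)
qed

text \<open>The one-dimensional estimate on every line parallel to the axis \<open>e\<close>. The
  factor L^3 is L^(1 + \<beta>) with the diffusive exponent \<beta> = 2.\<close>

lemma grid_coordinate_le_nearest_neighbour:
  fixes h :: "('e \<Rightarrow> nat) \<Rightarrow> real"
  assumes "finite E" "e \<in> E"
  shows "(\<Sum>x\<in>grid E L. \<Sum>b<L. (h x - h (x(e := b)))\<^sup>2)
    \<le> real L ^ 3 * (\<Sum>x\<in>{x\<in>grid E L. Suc (x e) < L}. (h x - h (x(e := Suc (x e))))\<^sup>2)"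
proof -
  define F where "F = E - {e}"
  have E: "E = insert e F" "finite F" "e \<notin> F" using assms by (auto simp: F_def)
  have zero: "x e = 0" if "x \<in> grid F L" for x
    using that E(3) by (auto simp: grid_def PiE_dflt_def)
  have "(\<Sum>x\<in>grid E L. \<Sum>b<L. (h x - h (x(e := b)))\<^sup>2)
      = (\<Sum>x\<in>grid F L. \<Sum>a<L. \<Sum>b<L. (h (x(e := a)) - h (x(e := b)))\<^sup>2)"
    using E by (simp add: sum_grid_insert)
  also have "\<dots> \<le> (\<Sum>x\<in>grid F L. real L ^ 3 *
      (\<Sum>a<L - 1. (h (x(e := a)) - h (x(e := Suc a)))\<^sup>2))"
    by (intro sum_mono sum_lessThan_double_diff_power2_le)
  also have "\<dots> = real L ^ 3 * (\<Sum>x\<in>grid F L. \<Sum>a<L.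
      of_bool (Suc a < L) * (h (x(e := a)) - h (x(e := Suc a)))\<^sup>2)"
    unfolding sum_distrib_left[symmetric]
    by (intro arg_cong2[where f = "(*)"] refl sum.cong sum.mono_neutral_cong_left) auto
  also have "(\<Sum>x\<in>grid F L. \<Sum>a<L. of_bool (Suc a < L) * (h (x(e := a)) - h (x(e := Suc a)))\<^sup>2)
     = (\<Sum>x\<in>grid E L. of_bool (Suc (x e) < L) * (h x - h (x(e := Suc (x e))))\<^sup>2)"
    using E by (simp add: sum_grid_insert del: sum_of_bool_mult_eq)
  also have "\<dots> = (\<Sum>x\<in>{x\<in>grid E L. Suc (x e) < L}. (h x - h (x(e := Suc (x e))))\<^sup>2)"
    using assms(1) by (intro sum.mono_neutral_cong_right) auto
  finally show ?thesis .
qed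

section \<open>The Dirichlet form on finite sets of sites\<close>

definition move :: "'a set \<Rightarrow> 'a \<Rightarrow> 'a \<Rightarrow> 'a set" where
  "move A x z = insert z (A - {x})"

text \<open>Jumps preserve cardinality, so the levels do not interact; taking all cardinalities up
  to \<open>N\<close> together lets one Dirichlet form serve every level of a local
  function.\<close>

definition small_sets :: "nat \<Rightarrow> 'a set set" where
  "small_sets N = {A. finite A \<and> card A \<le> N}"

lemma card_move:
  assumes "finite A" "x \<in> A" "z \<notin> A"
  shows "card (move A x z) = card A"
  using assms card_Suc_Diff1[of A x] by (simp add: move_def)

lemma finite_move [simp]: "finite (move A x z) \<longleftrightarrow> finite A"
  by (simp add: move_def)

lemma move_move:
  assumes "x \<in> A" "z \<notin> A"
  shows "move (move A x z) z x = A"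
  using assms by (auto simp: move_def)

definition moves :: "'a set \<Rightarrow> ('a \<times> 'a) set" where
  "moves A = A \<times> (- A)"

text \<open>Edges are oriented, and a jump occurs together with its reversal. This double counting
  is the origin of the factor 1/2 in front of the Dirichlet form below.\<close>

definition edges :: "nat \<Rightarrow> ('a set \<times> 'a \<times> 'a) set" where
  "edges N = Sigma (small_sets N) moves"

context long_range_kernel
begin

text \<open>The generator of the exclusion process with finitely many particles, acting on functions
  of the set of occupied sites. By self-duality of the symmetric process it also governs the Fourier
  coefficients.\<close>

definition exchange_operator :: "('d site set \<Rightarrow> real) \<Rightarrow> 'd site set \<Rightarrow> real" where
  "exchange_operator w A = (\<Sum>\<^sub>\<infinity>(x, z)\<in>moves A. s (z - x) * (w (move A x z) - w A))"

definition edge_energy :: "('d site set \<Rightarrow> real) \<Rightarrow> 'd site set \<times> 'd site \<times> 'd site \<Rightarrow> real" where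
  "edge_energy w = (\<lambda>(A, x, z). s (z - x) * (w (move A x z) - w A)\<^sup>2)"

definition dirichlet :: "nat \<Rightarrow> ('d site set \<Rightarrow> real) \<Rightarrow> real" where
  "dirichlet N w = infsum (edge_energy w) (edges N)"

lemma kernel_shift_has_sum: "((\<lambda>z. s (z - x)) has_sum 1) UNIV"
proof -
  have "(s has_sum 1) UNIV"
    using kernel_summable kernel_infsum by (simp add: has_sum_iff)
  moreover have "bij_betw (\<lambda>z. z - x) UNIV UNIV"
    by (rule bij_betw_byWitness[of _ "\<lambda>z. z + x"]) auto
  ultimately show ?thesis
    by (subst has_sum_reindex_bij_betw[of "\<lambda>z. z - x"])
qed

lemma rate_summable:
  assumes "finite A"
  shows "(\<lambda>(x, z). s (z - x)) summable_on moves A"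
    and "infsum (\<lambda>(x, z). s (z - x)) (moves A) \<le> card A"
proof -
  have inner: "(\<lambda>z. s (z - x)) summable_on - A" for x
    by (rule summable_on_subset_banach[OF has_sum_imp_summable[OF kernel_shift_has_sum[of x]]]) simp
  show sm: "(\<lambda>(x, z). s (z - x)) summable_on moves A"
    unfolding moves_def
  proof (rule summable_on_SigmaI)
    show "((\<lambda>z. case (x, z) of (x, z) \<Rightarrow> s (z - x)) has_sum infsum (\<lambda>z. s (z - x)) (- A)) (- A)" for x
      using inner[of x] by simp
  qed (use assms kernel_nonneg in auto)
  have "infsum (\<lambda>(x, z). s (z - x)) (moves A) = (\<Sum>x\<in>A. infsum (\<lambda>z. s (z - x)) (- A))"
    using infsum_Sigma'_banach[of "\<lambda>x z. s (z - x)" A "\<lambda>_. - A"] sm assms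
    by (simp add: moves_def)
  also have "\<dots> \<le> (\<Sum>x\<in>A. 1)"
  proof (rule sum_mono)
    fix x
    have "infsum (\<lambda>z. s (z - x)) (- A) \<le> infsum (\<lambda>z. s (z - x)) UNIV"
      using inner kernel_shift_has_sum[of x] kernel_nonneg
      by (intro infsum_mono2) (auto simp: has_sum_iff)
    then show "infsum (\<lambda>z. s (z - x)) (- A) \<le> 1"
      using kernel_shift_has_sum[of x] by (simp add: has_sum_iff)
  qed
  finally show "infsum (\<lambda>(x, z). s (z - x)) (moves A) \<le> card A" by simp
qed

text \<open>Reversal is an involution. Together with the symmetry of the kernel it transfers
  summability from the sources of edges to their targets and makes the exchange operator
  symmetric.\<close>

lemma bij_betw_reverse_edge:
  "bij_betw (\<lambda>(A, x, z). (move A x z, z, x)) (edges N) (edges N :: ('d site set \<times> 'd site \<times> 'd site) set)"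
proof -
  let ?rev = "\<lambda>(A, x, z). (move A x z, z, x :: 'd site)"
  have "?rev ` edges N \<subseteq> edges N"
    by (auto simp: edges_def moves_def small_sets_def card_move) (auto simp: move_def)
  moreover have "\<forall>e\<in>edges N. ?rev (?rev e) = e"
    by (auto simp: edges_def moves_def move_move)
  ultimately show ?thesis
    by (intro bij_betw_byWitness[of _ ?rev])
qed

text \<open>Summing over the moves of a fixed set first leaves at most \<open>N\<close> times a sum
  of squares, because a set of at most \<open>N\<close> sites is left at rate at most
  \<open>N\<close>.\<close>

lemma summable_on_edges_source:
  fixes w :: "'d site set \<Rightarrow> real"
  assumes "(\<lambda>A. (w A)\<^sup>2) summable_on small_sets N"
  shows "(\<lambda>(A, x, z). s (z - x) * (w A)\<^sup>2) summable_on edges N"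
  unfolding edges_def
proof (rule summable_on_SigmaI)
  fix A :: "'d site set" assume A: "A \<in> small_sets N"
  have "(\<lambda>(x, z). s (z - x) * (w A)\<^sup>2) summable_on moves A"
    using summable_on_cmult_left[OF rate_summable(1), of A "(w A)\<^sup>2"] A
    by (simp add: small_sets_def split_def)
  moreover have "infsum (\<lambda>(x, z). s (z - x) * (w A)\<^sup>2) (moves A)
     = infsum (\<lambda>(x, z). s (z - x)) (moves A) * (w A)\<^sup>2"
    using infsum_cmult_left'[of "\<lambda>(x, z). s (z - x)" "(w A)\<^sup>2" "moves A"] by (simp add: split_def)
  ultimately show "((\<lambda>xz. case (A, xz) of (A, x, z) \<Rightarrow> s (z - x) * (w A)\<^sup>2) has_sum
      infsum (\<lambda>(x, z). s (z - x)) (moves A) * (w A)\<^sup>2) (moves A)"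
    by (simp add: has_sum_iff)
next
  show "(\<lambda>A. infsum (\<lambda>(x, z). s (z - x)) (moves A) * (w A)\<^sup>2) summable_on small_sets N"
  proof (rule summable_on_comparison_test)
    show "(\<lambda>A. real N * (w A)\<^sup>2) summable_on small_sets N"
      by (intro summable_on_cmult_right assms)
    fix A :: "'d site set" assume A: "A \<in> small_sets N"
    show "infsum (\<lambda>(x, z). s (z - x)) (moves A) * (w A)\<^sup>2 \<le> real N * (w A)\<^sup>2"
      using rate_summable(2)[of A] A by (intro mult_right_mono) (auto simp: small_sets_def)
    show "0 \<le> infsum (\<lambda>(x, z). s (z - x)) (moves A) * (w A)\<^sup>2"
      by (intro mult_nonneg_nonneg infsum_nonneg) (auto simp: kernel_nonneg)
  qed
qed (auto simp: kernel_nonneg)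

lemma summable_on_edges_target:
  fixes w :: "'d site set \<Rightarrow> real"
  assumes "(\<lambda>A. (w A)\<^sup>2) summable_on small_sets N"
  shows "(\<lambda>(A, x, z). s (z - x) * (w (move A x z))\<^sup>2) summable_on edges N"
proof -
  have "(\<lambda>e. (\<lambda>(A, x, z). s (z - x) * (w A)\<^sup>2) ((\<lambda>(A, x, z). (move A x z, z, x)) e)) summable_on edges N"
    using summable_on_reindex_bij_betw[OF bij_betw_reverse_edge,
        of "\<lambda>(A, x, z). s (z - x) * (w A)\<^sup>2" N] summable_on_edges_source[OF assms] by blast
  moreover have "s (x - z) = s (z - x)" for x z
    using kernel_minus[of "z - x"] by simp
  then have "(\<lambda>e. (\<lambda>(A, x, z). s (z - x) * (w A)\<^sup>2) ((\<lambda>(A, x, z). (move A x z, z, x)) e))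
      = (\<lambda>(A, x, z). s (z - x) * (w (move A x z))\<^sup>2)"
    by (auto simp: fun_eq_iff)
  ultimately show ?thesis by simp
qed

lemma edge_energy_summable:
  fixes w :: "'d site set \<Rightarrow> real"
  assumes "(\<lambda>A. (w A)\<^sup>2) summable_on small_sets N"
  shows "edge_energy w summable_on edges N"
proof (rule summable_on_comparison_test)
  show "(\<lambda>e. 2 * (\<lambda>(A, x, z). s (z - x) * (w (move A x z))\<^sup>2) e
      + 2 * (\<lambda>(A, x, z). s (z - x) * (w A)\<^sup>2) e) summable_on edges N"
    by (intro summable_on_add summable_on_cmult_right summable_on_edges_source
        summable_on_edges_target assms)
  fix e :: "'d site set \<times> 'd site \<times> 'd site"
  obtain A x z where e: "e = (A, x, z)" by (cases e)
  have "(w (move A x z) - w A)\<^sup>2 \<le> 2 * (w (move A x z))\<^sup>2 + 2 * (w A)\<^sup>2"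
    using sum_squares_ge_zero[of "w (move A x z) + w A" 0] by (simp add: power2_eq_square algebra_simps)
  from mult_left_mono[OF this kernel_nonneg, of "z - x"]
  show "edge_energy w e \<le> 2 * (\<lambda>(A, x, z). s (z - x) * (w (move A x z))\<^sup>2) e
      + 2 * (\<lambda>(A, x, z). s (z - x) * (w A)\<^sup>2) e"
    by (simp add: edge_energy_def e algebra_simps)
  show "0 \<le> edge_energy w e"
    by (simp add: edge_energy_def e kernel_nonneg)
qed

lemma sum_edge_energy_le_dirichlet:
  fixes w :: "'d site set \<Rightarrow> real"
  assumes "(\<lambda>A. (w A)\<^sup>2) summable_on small_sets N" "finite F" "F \<subseteq> edges N"
  shows "sum (edge_energy w) F \<le> dirichlet N w"
  unfolding dirichlet_def
  by (rule finite_sum_le_infsum[OF edge_energy_summable[OF assms(1)] assms(2,3)])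
     (auto simp: edge_energy_def kernel_nonneg)

lemma dirichlet_nonneg: "0 \<le> dirichlet N w"
  unfolding dirichlet_def
  by (rule infsum_nonneg) (auto simp: edge_energy_def kernel_nonneg)

text \<open>
  Reversing an edge exchanges its endpoints, so the bilinear sum equals the average of itself and
  its reversal.
\<close>
lemma infsum_exchange_operator:
  fixes w :: "'d site set \<Rightarrow> real"
  assumes w: "(\<lambda>A. (w A)\<^sup>2) summable_on small_sets N"
  shows "(\<lambda>A. w A * exchange_operator w A) summable_on small_sets N"
    and "infsum (\<lambda>A. w A * exchange_operator w A) (small_sets N) = - dirichlet N w / 2"
proof -
  define g where "g = (\<lambda>(A, x, z). s (z - x) * (w A * (w (move A x z) - w A)))"
  let ?rev = "\<lambda>(A, x, z). (move A x z, z, x :: 'd site)"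
  have g_abs: "(\<lambda>e. norm (g e)) summable_on edges N"
  proof (rule Infinite_Sum.abs_summable_on_comparison_test)
    show "(\<lambda>e. norm ((\<lambda>(A, x, z). s (z - x) * (w A)\<^sup>2) e + edge_energy w e)) summable_on edges N"
      unfolding summable_on_iff_abs_summable_on_real[symmetric]
      by (intro summable_on_add summable_on_edges_source edge_energy_summable w)
    fix e :: "'d site set \<times> 'd site \<times> 'd site"
    obtain A x z where e: "e = (A, x, z)" by (cases e)
    let ?d = "w (move A x z) - w A"
    have "2 * (\<bar>w A\<bar> * \<bar>?d\<bar>) \<le> \<bar>w A\<bar>\<^sup>2 + \<bar>?d\<bar>\<^sup>2"
      using sum_squares_bound[of "\<bar>w A\<bar>" "\<bar>?d\<bar>"] by simp
    moreover have "0 \<le> \<bar>w A\<bar> * \<bar>?d\<bar>" by simp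
    ultimately have "\<bar>w A * ?d\<bar> \<le> (w A)\<^sup>2 + ?d\<^sup>2"
      unfolding abs_mult power2_abs by linarith
    from mult_left_mono[OF this kernel_nonneg, of "z - x"]
    show "norm (g e) \<le> norm ((\<lambda>(A, x, z). s (z - x) * (w A)\<^sup>2) e + edge_energy w e)"
      by (simp add: g_def e edge_energy_def abs_mult kernel_nonneg distrib_left add_nonneg_nonneg)
  qed
  then have g_sm: "g summable_on edges N"
    by (rule summable_on_iff_abs_summable_on_real[THEN iffD2])
  have op: "infsum (\<lambda>xz. g (A, xz)) (moves A) = w A * exchange_operator w A" for A
  proof -
    have "(\<lambda>xz. g (A, xz)) = (\<lambda>xz. w A * (case xz of (x, z) \<Rightarrow> s (z - x) * (w (move A x z) - w A)))"
      by (simp add: fun_eq_iff g_def)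
    then show ?thesis
      by (simp only: exchange_operator_def infsum_cmult_right')
  qed
  show "(\<lambda>A. w A * exchange_operator w A) summable_on small_sets N"
    using summable_on_Sigma_banach[of "\<lambda>A xz. g (A, xz)" "small_sets N" moves] g_sm op
    by (simp add: edges_def)
  have 1: "infsum (\<lambda>A. w A * exchange_operator w A) (small_sets N) = infsum g (edges N)"
    using infsum_Sigma_banach[of g "small_sets N" moves] g_sm op by (simp add: edges_def)
  have 2: "infsum g (edges N) = infsum (\<lambda>e. g (?rev e)) (edges N)"
    using infsum_reindex_bij_betw[OF bij_betw_reverse_edge, of g N] by (simp only:)
  have sm2: "(\<lambda>e. g (?rev e)) summable_on edges N"
    using summable_on_reindex_bij_betw[OF bij_betw_reverse_edge, of g N] g_sm by (simp only:)
  have "infsum g (edges N) + infsum (\<lambda>e. g (?rev e)) (edges N) = infsum (\<lambda>e. g e + g (?rev e)) (edges N)"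
    by (rule infsum_add[symmetric, OF g_sm sm2])
  also have "\<dots> = infsum (\<lambda>e. - edge_energy w e) (edges N)"
  proof (intro infsum_cong)
    fix e :: "'d site set \<times> 'd site \<times> 'd site" assume e: "e \<in> edges N"
    obtain A x z where e': "e = (A, x, z)" by (cases e)
    have "move (move A x z) z x = A"
      using e by (auto simp: e' edges_def moves_def move_move)
    moreover have "s (x - z) = s (z - x)"
      using kernel_minus[of "z - x"] by simp
    ultimately show "g e + g (?rev e) = - edge_energy w e"
      by (simp add: g_def e' edge_energy_def power2_eq_square algebra_simps)
  qed
  also have "\<dots> = - dirichlet N w"
    by (simp add: infsum_uminus dirichlet_def)
  finally show "infsum (\<lambda>A. w A * exchange_operator w A) (small_sets N) = - dirichlet N w / 2"
    using 1 2 by linarith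
qed

text \<open>Finiteness of the H_(-1) norm in its dual form: boundedness with respect to the energy
  seminorm. The test functions are the square summable ones, a class to which the time integrals W_t
  will be shown to belong.\<close>

definition H_minus_one :: "nat \<Rightarrow> (('d site set \<Rightarrow> real) \<Rightarrow> real) \<Rightarrow> bool" where
  "H_minus_one N p \<longleftrightarrow> (\<exists>C\<ge>0. \<forall>w. (\<lambda>A. (w A)\<^sup>2) summable_on small_sets N \<longrightarrow>
     (p w)\<^sup>2 \<le> C * dirichlet N w)"

lemma H_minus_one_add:
  assumes "H_minus_one N p" "H_minus_one N q"
  shows "H_minus_one N (\<lambda>w. p w + q w)"
proof -
  obtain C where C: "0 \<le> C" "\<And>w. (\<lambda>A. (w A)\<^sup>2) summable_on small_sets N \<Longrightarrow> (p w)\<^sup>2 \<le> C * dirichlet N w"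
    using assms(1) unfolding H_minus_one_def by blast
  obtain C' where C': "0 \<le> C'" "\<And>w. (\<lambda>A. (w A)\<^sup>2) summable_on small_sets N \<Longrightarrow> (q w)\<^sup>2 \<le> C' * dirichlet N w"
    using assms(2) unfolding H_minus_one_def by blast
  show ?thesis
    unfolding H_minus_one_def
  proof (intro exI[of _ "2 * C + 2 * C'"] conjI allI impI)
    fix w :: "'d site set \<Rightarrow> real" assume w: "(\<lambda>A. (w A)\<^sup>2) summable_on small_sets N"
    have "(p w + q w)\<^sup>2 \<le> 2 * (p w)\<^sup>2 + 2 * (q w)\<^sup>2"
      using sum_squares_ge_zero[of "p w - q w" 0] by (simp add: power2_eq_square algebra_simps)
    then show "(p w + q w)\<^sup>2 \<le> (2 * C + 2 * C') * dirichlet N w"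
      using C(2)[OF w] C'(2)[OF w] by (simp add: algebra_simps)
  qed (use C C' in auto)
qed

lemma H_minus_one_cmult:
  assumes "H_minus_one N p"
  shows "H_minus_one N (\<lambda>w. a * p w)"
proof -
  obtain C where C: "0 \<le> C" "\<And>w. (\<lambda>A. (w A)\<^sup>2) summable_on small_sets N \<Longrightarrow> (p w)\<^sup>2 \<le> C * dirichlet N w"
    using assms(1) unfolding H_minus_one_def by blast
  show ?thesis
    unfolding H_minus_one_def
    by (intro exI[of _ "a\<^sup>2 * C"])
       (auto simp: power_mult_distrib mult.assoc C intro!: mult_left_mono)
qed

lemma H_minus_one_zero: "H_minus_one N (\<lambda>_. 0)"
  by (auto simp: H_minus_one_def intro!: exI[of _ 0])

lemma H_minus_one_sum:
  assumes "\<And>i. i \<in> I \<Longrightarrow> H_minus_one N (p i)"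
  shows "H_minus_one N (\<lambda>w. \<Sum>i\<in>I. p i w)"
  using assms
proof (induction I rule: infinite_finite_induct)
  case (insert i I)
  then have "H_minus_one N (\<lambda>w. p i w + (\<Sum>i\<in>I. p i w))"
    by (intro H_minus_one_add) simp_all
  with insert show ?case by simp
qed (simp_all add: H_minus_one_zero)

text \<open>The kernel is positive at every nonzero displacement, so the jump is an edge of positive
  weight and its single term in the energy bounds the square.\<close>

lemma H_minus_one_move:
  assumes "A \<in> small_sets N" "x \<in> A" "z \<notin> A"
  shows "H_minus_one N (\<lambda>w. w (move A x z) - w A)"
proof -
  have pos: "0 < s (z - x)"
  proof -
    have "z - x \<noteq> 0" using assms by auto
    with kernel_ge[OF this] c_pos euclidean_length_ge_1[OF this] show ?thesis
      by (auto elim!: less_le_trans[rotated])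
  qed
  have "(w (move A x z) - w A)\<^sup>2 \<le> inverse (s (z - x)) * dirichlet N w"
    if "(\<lambda>A. (w A)\<^sup>2) summable_on small_sets N" for w :: "'d site set \<Rightarrow> real"
    using sum_edge_energy_le_dirichlet[OF that, of "{(A, x, z)}"] assms pos
    by (auto simp: edges_def moves_def edge_energy_def field_simps)
  then show ?thesis
    unfolding H_minus_one_def using pos by (intro exI[of _ "inverse (s (z - x))"]) auto
qed

text \<open>Induction on the number of sites of \<open>B\<close> missing from \<open>A\<close>:
  moving a particle from \<open>A - B\<close> to \<open>B - A\<close> uses one edge and lowers this
  number by one.\<close>

lemma H_minus_one_diff:
  assumes "A \<in> small_sets N" "B \<in> small_sets N" "card A = card B"
  shows "H_minus_one N (\<lambda>w. w B - w A)"
  using assms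
proof (induction "card (B - A)" arbitrary: A)
  case 0
  then have "finite A" "B \<subseteq> A" by (auto simp: small_sets_def)
  then have "A = B" using 0 by (metis card_subset_eq)
  then show ?case by (simp add: H_minus_one_zero)
next
  case (Suc k)
  have fin: "finite A" "finite B" using Suc by (auto simp: small_sets_def)
  obtain z where z: "z \<in> B" "z \<notin> A" using Suc(2) by (metis Diff_iff card.empty equals0I nat.distinct(1))
  have "A - B \<noteq> {}"
    using z fin Suc.prems(3) by (metis Diff_eq_empty_iff card_subset_eq)
  then obtain x where x: "x \<in> A" "x \<notin> B" by auto
  let ?A = "move A x z"
  have "B - A = insert z (B - ?A)" "z \<notin> B - ?A"
    using z x by (auto simp: move_def)
  then have "k = card (B - ?A)" using Suc(2) fin by simp
  moreover have "?A \<in> small_sets N" "card ?A = card B"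
    using Suc.prems x z fin by (auto simp: small_sets_def card_move)
  ultimately have "H_minus_one N (\<lambda>w. w B - w ?A)"
    using Suc.hyps(1) Suc.prems(2) by blast
  from H_minus_one_add[OF this H_minus_one_move[OF Suc.prems(1) x(1) z(2)]]
  show ?case by simp
qed

end

section \<open>Disjoint lanes for several particles\<close>

text \<open>
  A site for each of \<open>n\<close> particles, with the coordinate \<open>i0\<close> of particle \<open>r\<close> confined to
  the residue class of \<open>r\<close> modulo \<open>n\<close>. The particles therefore never meet, and their
  coordinates \<open>x (r, i)\<close> can be varied independently.
\<close>
definition lane_site :: "nat \<Rightarrow> 'd \<Rightarrow> nat \<Rightarrow> (nat \<times> 'd \<Rightarrow> nat) \<Rightarrow> 'd::finite site" where
  "lane_site n i0 r x = (\<chi> i. if i = i0 then int n * int (x (r, i)) + int r else int (x (r, i)))"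

definition lane_set :: "nat \<Rightarrow> 'd \<Rightarrow> (nat \<times> 'd \<Rightarrow> nat) \<Rightarrow> 'd::finite site set" where
  "lane_set n i0 x = (\<lambda>r. lane_site n i0 r x) ` {..<n}"

text \<open>The coordinate \<open>i0\<close> modulo \<open>n\<close> reveals the label of the
  particle, and the quotient reveals its value, so different lanes have no site in common.\<close>

lemma lane_site_eqD:
  assumes eq: "lane_site n i0 r x = lane_site n i0 q y" and "r < n" "q < n"
  shows "r = q" "x (r, i) = y (r, i)"
proof -
  have nth: "lane_site n i0 r x $ i = lane_site n i0 q y $ i" for i
    using eq by simp
  from nth[of i0] have "int (n * x (r, i0) + r) = int (n * y (q, i0) + q)"
    by (simp add: lane_site_def)
  then have *: "n * x (r, i0) + r = n * y (q, i0) + q"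
    by linarith
  then have "(n * x (r, i0) + r) mod n = (n * y (q, i0) + q) mod n"
    by simp
  then show rq: "r = q"
    using assms by simp
  have "x (r, i0) = y (q, i0)"
    using * rq assms by simp
  then show "x (r, i) = y (r, i)"
    using nth[of i] rq by (cases "i = i0") (auto simp: lane_site_def)
qed

lemma finite_lane_set [simp]: "finite (lane_set n i0 x)"
  by (simp add: lane_set_def)

lemma card_lane_set [simp]: "card (lane_set n i0 x) = n"
  unfolding lane_set_def by (subst card_image) (auto simp: inj_on_def dest: lane_site_eqD)

lemma lane_set_eqD:
  assumes "lane_set n i0 x = lane_set n i0 y" "r < n"
  shows "x (r, i) = y (r, i)"
proof -
  have "lane_site n i0 r x \<in> lane_set n i0 y"
    using assms by (auto simp: lane_set_def)
  then obtain q where q: "q < n" "lane_site n i0 r x = lane_site n i0 q y"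
    by (auto simp: lane_set_def)
  then show ?thesis
    using lane_site_eqD[OF q(2) assms(2) q(1)] by simp
qed

text \<open>The residues recover the labels of the particles from the unordered set. This keeps a
  sum over the grid from charging the same edge of the energy several times.\<close>

lemma inj_on_lane_set: "inj_on (lane_set n i0) (grid ({..<n} \<times> UNIV) L)"
proof (rule inj_onI, rule ext)
  fix x y e
  assume xy: "x \<in> grid ({..<n} \<times> UNIV) L" "y \<in> grid ({..<n} \<times> UNIV) L"
    and eq: "lane_set n i0 x = lane_set n i0 y"
  show "x e = y e"
  proof (cases "fst e < n")
    case True
    then show ?thesis using lane_set_eqD[OF eq True, of "snd e"] by simp
  next
    case False
    then show ?thesis using xy by (cases e) (auto simp: grid_def PiE_dflt_def)
  qed
qed

lemma lane_site_update_other: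
  assumes "q \<noteq> r"
  shows "lane_site n i0 q (x((r, i) := b)) = lane_site n i0 q x"
  using assms by (simp add: lane_site_def vec_eq_iff)

lemma lane_set_split:
  assumes "r < n"
  shows "lane_set n i0 x = insert (lane_site n i0 r x) ((\<lambda>q. lane_site n i0 q x) ` ({..<n} - {r}))"
  using assms by (auto simp: lane_set_def)

text \<open>A changed coordinate keeps the particle in its lane, of which it is the only occupant.
  The target is therefore empty, and the change is a single legal jump.\<close>

lemma lane_set_update:
  assumes "r < n" "b \<noteq> x (r, i)"
  shows "lane_site n i0 r x \<in> lane_set n i0 x"
    and "lane_site n i0 r (x((r, i) := b)) \<notin> lane_set n i0 x"
    and "move (lane_set n i0 x) (lane_site n i0 r x) (lane_site n i0 r (x((r, i) := b)))
      = lane_set n i0 (x((r, i) := b))"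
proof -
  show "lane_site n i0 r x \<in> lane_set n i0 x"
    using assms by (auto simp: lane_set_def)
  show "lane_site n i0 r (x((r, i) := b)) \<notin> lane_set n i0 x"
  proof
    assume "lane_site n i0 r (x((r, i) := b)) \<in> lane_set n i0 x"
    then obtain q where q: "q < n" "lane_site n i0 r (x((r, i) := b)) = lane_site n i0 q x"
      by (auto simp: lane_set_def)
    from lane_site_eqD(2)[OF q(2) assms(1) q(1), of i] assms(2) show False by simp
  qed
  have notin: "lane_site n i0 r x \<notin> (\<lambda>q. lane_site n i0 q x) ` ({..<n} - {r})"
    using assms(1) by (auto dest: lane_site_eqD)
  have "(\<lambda>q. lane_site n i0 q x) ` ({..<n} - {r})
      = (\<lambda>q. lane_site n i0 q (x((r, i) := b))) ` ({..<n} - {r})"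
    by (intro image_cong refl) (simp add: lane_site_update_other)
  with notin show "move (lane_set n i0 x) (lane_site n i0 r x) (lane_site n i0 r (x((r, i) := b)))
      = lane_set n i0 (x((r, i) := b))"
    unfolding lane_set_split[OF assms(1)] by (simp add: move_def)
qed

text \<open>The factor \<open>n\<close> is the spacing of the sites of a lane in direction
  \<open>i0\<close>; the other directions are not stretched.\<close>

lemma lane_displacement:
  assumes "n \<ge> 1"
  shows "euclidean_length (lane_site n i0 r (x((r, i) := b)) - lane_site n i0 r x)
    \<le> real n * \<bar>real b - real (x (r, i))\<bar>"
proof -
  let ?y = "lane_site n i0 r (x((r, i) := b)) - lane_site n i0 r x"
  have "(\<Sum>j\<in>UNIV. \<bar>real_of_int (?y $ j)\<bar>) = (\<Sum>j\<in>{i}. \<bar>real_of_int (?y $ j)\<bar>)"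
    by (rule sum.mono_neutral_right) (auto simp: lane_site_def)
  also have "\<dots> \<le> real n * \<bar>real b - real (x (r, i))\<bar>"
    using assms mult_right_mono[of 1 "real n" "\<bar>real b - real (x (r, i))\<bar>"]
    by (auto simp: lane_site_def abs_mult right_diff_distrib[symmetric])
  finally show ?thesis
    using euclidean_length_le_sum[of ?y] by linarith
qed

section \<open>Evaluation functionals bounded by the energy\<close>

context long_range_kernel
begin

lemma kernel_ge_length:
  assumes "y \<noteq> 0" "euclidean_length y \<le> R"
  shows "c * R powr - \<gamma> \<le> s y"
proof -
  have "R powr - \<gamma> \<le> euclidean_length y powr - \<gamma>"
    using assms euclidean_length_ge_1[OF assms(1)] exponent_pos by (intro powr_mono2') auto
  then show ?thesis
    using kernel_ge[OF assms(1)] c_pos by (smt (verit) mult_left_mono)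
qed

text \<open>Jumps of length at most \<open>R\<close> have rate at least
  \<open>c * R powr - \<gamma>\<close>, and injectivity ensures that no edge is charged
  twice.\<close>

lemma sum_diff_power2_le_dirichlet:
  fixes w :: "'d site set \<Rightarrow> real"
  assumes w: "(\<lambda>A. (w A)\<^sup>2) summable_on small_sets N"
    and P: "finite P" "inj_on (\<lambda>p. (A p, X p, Z p)) P"
      "\<And>p. p \<in> P \<Longrightarrow> A p \<in> small_sets N \<and> X p \<in> A p \<and> Z p \<notin> A p"
    and R: "\<And>p. p \<in> P \<Longrightarrow> euclidean_length (Z p - X p) \<le> R" "0 < R"
  shows "(\<Sum>p\<in>P. (w (A p) - w (move (A p) (X p) (Z p)))\<^sup>2) \<le> R powr \<gamma> / c * dirichlet N w"
proof -
  have pos: "0 < c * R powr - \<gamma>"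
    using c_pos R by simp
  have "c * R powr - \<gamma> * (\<Sum>p\<in>P. (w (A p) - w (move (A p) (X p) (Z p)))\<^sup>2)
      \<le> (\<Sum>p\<in>P. edge_energy w (A p, X p, Z p))"
    unfolding sum_distrib_left
  proof (rule sum_mono)
    fix p assume p: "p \<in> P"
    have "Z p - X p \<noteq> 0" using P(3)[OF p] by auto
    from kernel_ge_length[OF this R(1)[OF p]]
    show "c * R powr - \<gamma> * (w (A p) - w (move (A p) (X p) (Z p)))\<^sup>2 \<le> edge_energy w (A p, X p, Z p)"
      by (simp add: edge_energy_def mult_right_mono power2_commute)
  qed
  also have "\<dots> = sum (edge_energy w) ((\<lambda>p. (A p, X p, Z p)) ` P)"
    by (simp add: sum.reindex P)
  also have "\<dots> \<le> dirichlet N w"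
    by (rule sum_edge_energy_le_dirichlet[OF w])
       (use P in \<open>auto simp: edges_def moves_def\<close>)
  finally have "(\<Sum>p\<in>P. (w (A p) - w (move (A p) (X p) (Z p)))\<^sup>2) \<le> dirichlet N w / (c * R powr - \<gamma>)"
    using pos by (simp add: field_simps)
  also have "\<dots> = R powr \<gamma> / c * dirichlet N w"
    using pos R by (simp add: powr_minus field_simps)
  finally show ?thesis .
qed

lemma sum_power2_le_infsum:
  fixes w :: "'d site set \<Rightarrow> real"
  assumes "(\<lambda>A. (w A)\<^sup>2) summable_on small_sets N" "finite P" "inj_on g P" "g ` P \<subseteq> small_sets N"
  shows "(\<Sum>p\<in>P. (w (g p))\<^sup>2) \<le> infsum (\<lambda>A. (w A)\<^sup>2) (small_sets N)"
proof -
  have "(\<Sum>p\<in>P. (w (g p))\<^sup>2) = (\<Sum>A\<in>g ` P. (w A)\<^sup>2)"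
    using assms by (simp add: sum.reindex)
  also have "\<dots> \<le> infsum (\<lambda>A. (w A)\<^sup>2) (small_sets N)"
    by (rule finite_sum_le_infsum) (use assms in auto)
  finally show ?thesis .
qed

text \<open>One particle can jump directly between any two points of a box, so the pairs need not be
  joined along the axes. In a box of side 2^k all jumps have length at most d 2^k, so the sum over
  pairs is of order 2^(\<gamma> k) times the energy. Relative to the square 2^(2 d k) of the volume
  this decays when \<gamma> < 2 d, that is \<alpha> < d.\<close>

lemma H_minus_one_singleton:
  assumes \<gamma>: "\<gamma> < 2 * real CARD('d)" and N: "1 \<le> N"
  obtains A where "A \<in> small_sets N" "card A = 1" "H_minus_one N (\<lambda>w. w A)"
proof -
  define d where "d = CARD('d)"
  have d: "0 < d" by (simp add: d_def)
  define p :: "('d \<Rightarrow> nat) \<Rightarrow> 'd site" where "p x = (\<chi> i. int (x i))" for x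
  define \<theta> where "\<theta> = (2::real) powr (\<gamma> - 2 * d)"
  define K where "K = real d powr \<gamma> / c"
  have p_inj: "inj p" by (auto simp: inj_def p_def vec_eq_iff)
  have small: "{p x} \<in> small_sets N" for x using N by (simp add: small_sets_def)
  have \<theta>: "0 \<le> \<theta>" "\<theta> < 1" using \<gamma> by (simp_all add: \<theta>_def d_def powr_less_one)
  have K: "0 \<le> K" using c_pos by (simp add: K_def)
  have "(w {p (\<lambda>_. 0)})\<^sup>2 \<le> K * real (2 ^ d) / (1 - sqrt \<theta>)\<^sup>2 * dirichlet N w"
    if w: "(\<lambda>A. (w A)\<^sup>2) summable_on small_sets N" for w :: "'d site set \<Rightarrow> real"
  proof (rule multiscale_point_bound[where B = "\<lambda>k. grid UNIV (2 ^ k)" and h = "\<lambda>x. w {p x}"])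
    show "card (grid (UNIV :: 'd set) (2 ^ k)) = (2 ^ d) ^ k" for k
      by (simp add: card_grid d_def power_mult[symmetric] mult.commute)
    show "(2::nat) \<le> 2 ^ d" using d self_le_power[of "2::nat" d] by simp
    show "grid (UNIV :: 'd set) (2 ^ 0) = {\<lambda>_. 0}" by (simp add: grid_1)
    show "grid (UNIV :: 'd set) (2 ^ k) \<subseteq> grid UNIV (2 ^ Suc k)" for k by (intro grid_mono) simp
    show "(\<Sum>x\<in>grid UNIV (2 ^ k). (w {p x})\<^sup>2) \<le> infsum (\<lambda>A. (w A)\<^sup>2) (small_sets N)" for k
      using sum_power2_le_infsum[OF w, of "grid UNIV (2 ^ k)" "\<lambda>x. {p x}"] small p_inj
      by (auto simp: inj_on_def inj_def)
    show "(\<Sum>x\<in>grid UNIV (2 ^ k). \<Sum>y\<in>grid UNIV (2 ^ k). (w {p x} - w {p y})\<^sup>2)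
      \<le> K * \<theta> ^ k * (real (2 ^ d) ^ k)\<^sup>2 * dirichlet N w" for k
    proof -
      let ?G = "grid (UNIV :: 'd set) (2 ^ k)"
      let ?P = "{(x, y). x \<in> ?G \<and> y \<in> ?G \<and> x \<noteq> y}"
      let ?R = "real d * 2 ^ k"
      have fin: "finite ?P" by (rule finite_subset[of _ "?G \<times> ?G"]) auto
      have "(\<Sum>x\<in>?G. \<Sum>y\<in>?G. (w {p x} - w {p y})\<^sup>2) = (\<Sum>(x, y)\<in>?G \<times> ?G. (w {p x} - w {p y})\<^sup>2)"
        by (simp add: sum.cartesian_product)
      also have "\<dots> = (\<Sum>(x, y)\<in>?P. (w {p x} - w {p y})\<^sup>2)"
        by (rule sum.mono_neutral_right) auto
      also have "\<dots> = (\<Sum>e\<in>?P. (w {p (fst e)} - w (move {p (fst e)} (p (fst e)) (p (snd e))))\<^sup>2)"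
        by (intro sum.cong) (auto simp: move_def)
      also have "\<dots> \<le> ?R powr \<gamma> / c * dirichlet N w"
      proof (rule sum_diff_power2_le_dirichlet[OF w fin])
        show "inj_on (\<lambda>e. ({p (fst e)}, p (fst e), p (snd e))) ?P"
          using p_inj by (auto simp: inj_on_def inj_def)
        show "{p (fst e)} \<in> small_sets N \<and> p (fst e) \<in> {p (fst e)} \<and> p (snd e) \<notin> {p (fst e)}"
          if "e \<in> ?P" for e
          using that small p_inj by (auto simp: inj_def)
        show "euclidean_length (p (snd e) - p (fst e)) \<le> ?R" if e: "e \<in> ?P" for e
        proof -
          obtain x y where xy: "e = (x, y)" "x \<in> ?G" "y \<in> ?G" using e by auto
          have "\<bar>real_of_int ((p y - p x) $ i)\<bar> \<le> 2 ^ k" for i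
          proof -
            have "x i < 2 ^ k" "y i < 2 ^ k"
              using xy by (auto simp: grid_def PiE_dflt_def)
            then have "real (x i) \<le> real (2 ^ k)" "real (y i) \<le> real (2 ^ k)"
              by (simp_all only: of_nat_le_iff less_imp_le)
            then have "\<bar>real (y i) - real (x i)\<bar> \<le> real (2 ^ k)"
              by linarith
            then show ?thesis by (simp add: p_def)
          qed
          then have "(\<Sum>i\<in>UNIV. \<bar>real_of_int ((p y - p x) $ i)\<bar>) \<le> (\<Sum>i\<in>(UNIV::'d set). 2 ^ k)"
            by (intro sum_mono)
          then show ?thesis
            using euclidean_length_le_sum[of "p y - p x"] by (simp add: xy d_def)
        qed
        show "0 < ?R" using d by simp
      qed
      also have "?R powr \<gamma> / c = K * \<theta> ^ k * (real (2 ^ d) ^ k)\<^sup>2"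
      proof -
        have "(2 ^ k :: real) powr \<gamma> = 2 powr (k * \<gamma>)"
          by (simp add: powr_powr flip: powr_realpow)
        moreover have "\<theta> ^ k = 2 powr ((\<gamma> - 2 * d) * k)"
          by (simp add: \<theta>_def powr_powr flip: powr_realpow)
        moreover have "(real (2 ^ d) ^ k)\<^sup>2 = 2 powr (2 * d * k)"
          by (simp add: powr_realpow[of 2 "2 * d * k", simplified] flip: power_mult)
        moreover have "2 powr ((\<gamma> - 2 * d) * k) * 2 powr (2 * d * k) = (2::real) powr (k * \<gamma>)"
          by (simp add: algebra_simps flip: powr_add)
        ultimately show ?thesis by (simp add: K_def powr_mult mult.assoc)
      qed
      finally show ?thesis .
    qed
  qed (use \<theta> K dirichlet_nonneg in auto)
  then have "H_minus_one N (\<lambda>w. w {p (\<lambda>_. 0)})"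
    unfolding H_minus_one_def using K
    by (intro exI[of _ "K * real (2 ^ d) / (1 - sqrt \<theta>)\<^sup>2"]) auto
  then show thesis by (intro that[of "{p (\<lambda>_. 0)}"] small) auto
qed

text \<open>The \<open>n * CARD('d)\<close> lane coordinates take the place of the dimension. Each
  is varied either by unit steps, with \<beta> = 2, or by direct jumps inside the box, with \<beta>
  = \<gamma> - 1.\<close>

lemma H_minus_one_lanes:
  assumes n: "1 \<le> n" "n \<le> N" and \<beta>: "\<beta> = 2 \<or> \<beta> = \<gamma> - 1" "\<beta> < real (n * CARD('d))"
  obtains A where "A \<in> small_sets N" "card A = n" "H_minus_one N (\<lambda>w. w A)"
proof -
  \<comment> \<open>Any fixed direction can carry the residues.\<close>
  define i0 :: 'd where "i0 = undefined"
  define E where "E = {..<n} \<times> (UNIV :: 'd set)"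
  have E: "finite E" "E \<noteq> {}" "card E = n * CARD('d)"
    using n by (auto simp: E_def card_cartesian_product lessThan_empty_iff)
  have small: "lane_set n i0 x \<in> small_sets N" for x
    using n by (simp add: small_sets_def)
  define K where "K = real n powr \<gamma> / c"
  have K: "0 \<le> K" using c_pos by (simp add: K_def)
  have coord: "(\<Sum>x\<in>grid E L. \<Sum>b<L. (w (lane_set n i0 x) - w (lane_set n i0 (x(e := b))))\<^sup>2)
       \<le> K * real L powr (1 + \<beta>) * dirichlet N w"
    if w: "(\<lambda>A. (w A)\<^sup>2) summable_on small_sets N" and e: "e \<in> E"
    for w :: "'d site set \<Rightarrow> real" and L e
  proof (cases "L = 0")
    case True
    then show ?thesis by simp
  next
    case False
    obtain r i where ri: "e = (r, i)" "r < n" using e by (auto simp: E_def)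
    let ?A = "\<lambda>p. lane_set n i0 (fst p)" and ?X = "\<lambda>p. lane_site n i0 r (fst p)"
    let ?Z = "\<lambda>p. lane_site n i0 r ((fst p)(e := snd p))"
    \<comment> \<open>A change of the coordinate \<open>e\<close> by at most \<open>R\<close> is a
      jump of length at most \<open>n * R\<close>. The set \<open>P\<close> of changes is left
      general so that both alternatives can use the estimate.\<close>
    have energy: "(\<Sum>(x, b)\<in>P. (w (lane_set n i0 x) - w (lane_set n i0 (x(e := b))))\<^sup>2)
        \<le> (real n * R) powr \<gamma> / c * dirichlet N w"
      if P: "finite P" "P \<subseteq> {(x, b). x \<in> grid E L \<and> b \<noteq> x e \<and> \<bar>real b - real (x e)\<bar> \<le> R}"
        and R: "0 < R" for P and R :: real
    proof -
      have "(\<Sum>(x, b)\<in>P. (w (lane_set n i0 x) - w (lane_set n i0 (x(e := b))))\<^sup>2)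
        = (\<Sum>p\<in>P. (w (?A p) - w (move (?A p) (?X p) (?Z p)))\<^sup>2)"
        using P(2) ri by (intro sum.cong) (auto simp: lane_set_update)
      also have "\<dots> \<le> (real n * R) powr \<gamma> / c * dirichlet N w"
      proof (rule sum_diff_power2_le_dirichlet[OF w P(1)])
        show "inj_on (\<lambda>p. (?A p, ?X p, ?Z p)) P"
        proof (rule inj_onI)
          fix p q assume pq: "p \<in> P" "q \<in> P" and eq: "(?A p, ?X p, ?Z p) = (?A q, ?X q, ?Z q)"
          have "fst p \<in> grid E L" "fst q \<in> grid E L" using pq P(2) by auto
          then have "fst p = fst q"
            using eq inj_on_lane_set[of n i0 L] by (auto simp: E_def dest: inj_onD)
          moreover have "snd p = snd q"
            using eq lane_site_eqD(2)[of n i0 r "(fst p)(e := snd p)" r "(fst q)(e := snd q)" i] ri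
            by simp
          ultimately show "p = q" by (simp add: prod_eq_iff)
        qed
        show "?A p \<in> small_sets N \<and> ?X p \<in> ?A p \<and> ?Z p \<notin> ?A p" if "p \<in> P" for p
        proof -
          have "snd p \<noteq> fst p (r, i)" using that P(2) ri by auto
          then show ?thesis
            using lane_set_update(1,2)[of r n "snd p" "fst p" i i0] small ri by simp
        qed
        show "euclidean_length (?Z p - ?X p) \<le> n * R" if "p \<in> P" for p
        proof -
          have "\<bar>real (snd p) - real (fst p (r, i))\<bar> \<le> R" using that P(2) ri by auto
          then have "real n * \<bar>real (snd p) - real (fst p (r, i))\<bar> \<le> n * R"
            by (intro mult_left_mono) auto
          then show ?thesis
            using order_trans[OF lane_displacement[OF n(1), of i0 r "fst p" i "snd p"]] ri by simp
        qed
        show "0 < n * R" using n R by simp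
      qed
      finally show ?thesis .
    qed
    from \<beta>(1) show ?thesis
    proof
      assume \<beta>2: "\<beta> = 2"
      let ?Q = "{x \<in> grid E L. Suc (x e) < L}"
      have "(\<Sum>x\<in>grid E L. \<Sum>b<L. (w (lane_set n i0 x) - w (lane_set n i0 (x(e := b))))\<^sup>2)
        \<le> real L ^ 3 * (\<Sum>x\<in>?Q. (w (lane_set n i0 x) - w (lane_set n i0 (x(e := Suc (x e)))))\<^sup>2)"
        by (rule grid_coordinate_le_nearest_neighbour[OF E(1) e])
      also have "(\<Sum>x\<in>?Q. (w (lane_set n i0 x) - w (lane_set n i0 (x(e := Suc (x e)))))\<^sup>2)
        = (\<Sum>(x, b)\<in>(\<lambda>x. (x, Suc (x e))) ` ?Q. (w (lane_set n i0 x) - w (lane_set n i0 (x(e := b))))\<^sup>2)"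
        by (subst sum.reindex) (auto simp: inj_on_def)
      also have "\<dots> \<le> (real n * 1) powr \<gamma> / c * dirichlet N w"
        by (rule energy) (use E(1) in auto)
      finally have "(\<Sum>x\<in>grid E L. \<Sum>b<L. (w (lane_set n i0 x) - w (lane_set n i0 (x(e := b))))\<^sup>2)
        \<le> real L ^ 3 * ((real n * 1) powr \<gamma> / c * dirichlet N w)"
        by (simp only: mult_left_mono of_nat_0_le_iff zero_le_power)
      also have "\<dots> = K * real L powr (1 + \<beta>) * dirichlet N w"
        using False \<beta>2 by (simp add: K_def powr_numeral)
      finally show ?thesis .
    next
      assume \<beta>\<gamma>: "\<beta> = \<gamma> - 1"
      \<comment> \<open>Any two values of the coordinate are joined by one jump of length at most n
        L, and (n L)^\<gamma> = n^\<gamma> L^(1 + \<beta>).\<close>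
      let ?P = "{(x, b). x \<in> grid E L \<and> b < L \<and> b \<noteq> x e}"
      have fin: "finite ?P"
        by (rule finite_subset[of _ "grid E L \<times> {..<L}"]) (use E(1) in auto)
      have "(\<Sum>x\<in>grid E L. \<Sum>b<L. (w (lane_set n i0 x) - w (lane_set n i0 (x(e := b))))\<^sup>2)
        = (\<Sum>(x, b)\<in>grid E L \<times> {..<L}. (w (lane_set n i0 x) - w (lane_set n i0 (x(e := b))))\<^sup>2)"
        by (simp add: sum.cartesian_product)
      also have "\<dots> = (\<Sum>(x, b)\<in>?P. (w (lane_set n i0 x) - w (lane_set n i0 (x(e := b))))\<^sup>2)"
        by (rule sum.mono_neutral_right) (use E(1) in auto)
      also have "\<dots> \<le> (real n * real L) powr \<gamma> / c * dirichlet N w"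
      proof (rule energy[OF fin])
        have "\<bar>real b - real (x e)\<bar> \<le> real L" if "x \<in> grid E L" "b < L" for x b
        proof -
          have "x e < L" using that e by (cases e) (auto simp: grid_def PiE_dflt_def)
          then show ?thesis using that by (simp add: abs_le_iff)
        qed
        then show "?P \<subseteq> {(x, b). x \<in> grid E L \<and> b \<noteq> x e \<and> \<bar>real b - real (x e)\<bar> \<le> real L}"
          by auto
      qed (use False in auto)
      also have "(real n * real L) powr \<gamma> / c = K * real L powr (1 + \<beta>)"
        by (simp add: K_def powr_mult \<beta>\<gamma>)
      finally show ?thesis .
    qed
  qed
  let ?C = "2 ^ card E * real (card E) * K * 2 ^ card E / (1 - sqrt (2 powr (\<beta> - real (card E))))\<^sup>2"
  have "(w (lane_set n i0 (\<lambda>_. 0)))\<^sup>2 \<le> ?C * dirichlet N w"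
    if w: "(\<lambda>A. (w A)\<^sup>2) summable_on small_sets N" for w :: "'d site set \<Rightarrow> real"
  proof (rule grid_point_bound[OF E(1,2), where h = "\<lambda>x. w (lane_set n i0 x)"])
    show "\<beta> < real (card E)" using \<beta>(2) E(3) by simp
    show "(\<Sum>x\<in>grid E L. (w (lane_set n i0 x))\<^sup>2) \<le> infsum (\<lambda>A. (w A)\<^sup>2) (small_sets N)" for L
      by (rule sum_power2_le_infsum[OF w]) (use E(1) inj_on_lane_set small in \<open>auto simp: E_def\<close>)
  qed (use coord[OF w] K dirichlet_nonneg in auto)
  then have "H_minus_one N (\<lambda>w. w (lane_set n i0 (\<lambda>_. 0)))"
    unfolding H_minus_one_def using K by (intro exI[of _ ?C]) auto
  then show thesis by (intro that[of "lane_set n i0 (\<lambda>_. 0)"] small) auto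
qed

text \<open>Evaluations at two sets of equal cardinality differ by a bounded functional, so one
  conveniently placed set per cardinality decides. The three alternatives are unit steps, long jumps
  along an axis, and jumps of one particle in all directions.\<close>

lemma H_minus_one_point:
  assumes A: "A \<in> small_sets N" "A \<noteq> {}"
    and cond: "2 < card A * CARD('d) \<or> \<gamma> - 1 < real (card A * CARD('d)) \<or>
      card A = 1 \<and> \<gamma> < 2 * real CARD('d)"
  shows "H_minus_one N (\<lambda>w. w A)"
proof -
  have A1: "1 \<le> card A" "card A \<le> N"
    using A by (auto simp: small_sets_def Suc_le_eq card_gt_0_iff)
  obtain B where B: "B \<in> small_sets N" "card B = card A" "H_minus_one N (\<lambda>w. w B)"
  proof -
    consider "(2::real) < real (card A * CARD('d))" | "\<gamma> - 1 < real (card A * CARD('d))"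
      | "card A = 1" "\<gamma> < 2 * real CARD('d)"
      using cond by linarith
    then show thesis
    proof cases
      case 1
      then show thesis using H_minus_one_lanes[OF A1, of 2] that by blast
    next
      case 2
      then show thesis using H_minus_one_lanes[OF A1, of "\<gamma> - 1"] that by blast
    next
      case 3
      then show thesis using H_minus_one_singleton[of N] A1 that by auto
    qed
  qed
  have "H_minus_one N (\<lambda>w. w B + (w A - w B))"
    by (intro H_minus_one_add B(3) H_minus_one_diff B(1) A B(2))
  then show ?thesis by simp
qed

text \<open>With total weight 0, the value at a fixed set \<open>B\<close> may be subtracted in
  every term, which leaves differences between sets of equal cardinality.\<close>

lemma H_minus_one_zero_sum:
  assumes I: "finite I" "I \<subseteq> small_sets N" "\<And>A. A \<in> I \<Longrightarrow> card A = n" and a: "sum a I = 0"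
  shows "H_minus_one N (\<lambda>w. \<Sum>A\<in>I. a A * w A)"
proof (cases "I = {}")
  case True
  then show ?thesis by (simp add: H_minus_one_zero)
next
  case False
  then obtain B where B: "B \<in> I" by auto
  have "H_minus_one N (\<lambda>w. \<Sum>A\<in>I. a A * (w A - w B))"
    by (intro H_minus_one_sum H_minus_one_cmult H_minus_one_diff) (use I B in auto)
  moreover have "(\<Sum>A\<in>I. a A * (w A - w B)) = (\<Sum>A\<in>I. a A * w A)" for w :: "'d site set \<Rightarrow> real"
    using a by (simp add: right_diff_distrib sum_subtractf flip: sum_distrib_right)
  ultimately show ?thesis by simp
qed

end

section \<open>Fourier expansion of local functions\<close>

text \<open>Second countability of the factors makes the product sigma-algebra on configurations the
  Borel one, so that continuous functions are measurable.\<close>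

instance bool :: second_countable_topology
proof
  have "open = generate_topology (UNIV :: bool set set)"
  proof
    fix S :: "bool set"
    show "open S = generate_topology UNIV S"
      using Topological_Spaces.open_discrete[of S] generate_topology.Basis[of S UNIV] by simp
  qed
  moreover have "countable (UNIV :: bool set set)" by simp
  ultimately show "\<exists>B :: bool set set. countable B \<and> open = generate_topology B" by blast
qed

lemma space_config_space [simp]: "space (config_space :: 'd::finite config measure) = UNIV"
  by (simp add: config_space_def space_PiM)

lemma sets_config_space_eq_borel: "sets (config_space :: 'd::finite config measure) = sets borel"
proof -
  have "sets (config_space :: 'd config measure) = sets (PiM UNIV (\<lambda>_::'d site. borel :: bool measure))"
    unfolding config_space_def by (intro sets_PiM_cong) (simp_all add: sets_borel_eq_count_space)
  then show ?thesis
    by (simp add: sets_PiM_equal_borel)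
qed

lemma sets_bernoulli_product [measurable_cong]:
  "sets (bernoulli_product z :: 'd::finite config measure) = sets config_space"
  unfolding config_space_def bernoulli_product_def by (intro sets_PiM_cong) simp_all

lemma space_bernoulli_product [simp]: "space (bernoulli_product z :: 'd::finite config measure) = UNIV"
  by (simp add: bernoulli_product_def space_PiM)

lemma prob_space_bernoulli_product: "prob_space (bernoulli_product z)"
  unfolding bernoulli_product_def by (intro prob_space_PiM measure_pmf.prob_space_axioms)

lemma bcontfun_measurable_config [measurable]:
  "apply_bcontfun (g :: 'd::finite config \<Rightarrow>\<^sub>C real) \<in> borel_measurable config_space"
  using borel_measurable_continuous_onI[of "apply_bcontfun g"]
  by (simp add: measurable_cong_sets[OF sets_config_space_eq_borel refl])

lemma integrable_bounded_measurable:
  fixes g :: "'a \<Rightarrow> real"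
  assumes "prob_space M" "g \<in> borel_measurable M" "\<And>x. x \<in> space M \<Longrightarrow> \<bar>g x\<bar> \<le> B"
  shows "integrable M g"
proof -
  interpret prob_space M by fact
  show ?thesis
    by (rule integrable_const_bound[of _ B]) (use assms in \<open>auto intro: AE_I2\<close>)
qed

lemma abs_bcontfun_le_norm: "\<bar>apply_bcontfun g \<eta>\<bar> \<le> norm (g :: 'a::topological_space \<Rightarrow>\<^sub>C real)"
  using norm_bounded[of g \<eta>] by simp

lemma bcontfun_integrable:
  assumes "prob_space M" "sets M = sets config_space"
  shows "integrable M (apply_bcontfun (g :: 'd::finite config \<Rightarrow>\<^sub>C real))"
  using assms
  by (intro integrable_bounded_measurable[of _ _ "norm g"] abs_bcontfun_le_norm)
     (auto simp: measurable_cong_sets[OF assms(2) refl])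

lemma bcontfun_mult_integrable:
  assumes "prob_space M" "sets M = sets config_space"
  shows "integrable M (\<lambda>\<eta>. apply_bcontfun (g :: 'd::finite config \<Rightarrow>\<^sub>C real) \<eta> * apply_bcontfun h \<eta>)"
proof (rule integrable_bounded_measurable[OF assms(1)])
  show "(\<lambda>\<eta>. g \<eta> * h \<eta>) \<in> borel_measurable M"
    by (simp add: measurable_cong_sets[OF assms(2) refl])
  show "\<bar>g \<eta> * h \<eta>\<bar> \<le> norm g * norm h" for \<eta>
    unfolding abs_mult by (intro mult_mono abs_bcontfun_le_norm) auto
qed

lemma product_prob_space_bernoulli:
  "product_prob_space (\<lambda>_ :: 'd::finite site. measure_pmf (bernoulli_pmf z))"
  by unfold_locales

lemma integral_bernoulli_product_prod:
  fixes u :: "'d::finite site \<Rightarrow> bool \<Rightarrow> real"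
  assumes "finite A"
  shows "(LINT \<eta>|bernoulli_product z. (\<Prod>x\<in>A. u x (\<eta> x)))
    = (\<Prod>x\<in>A. (LINT b|measure_pmf (bernoulli_pmf z). u x b))"
proof -
  let ?M = "\<lambda>_ :: 'd site. measure_pmf (bernoulli_pmf z)"
  interpret product_prob_space ?M UNIV by (rule product_prob_space_bernoulli)
  have "(LINT \<eta>|bernoulli_product z. (\<Prod>x\<in>A. u x (\<eta> x)))
      = (LINT \<eta>|bernoulli_product z. (\<Prod>x\<in>A. u x (restrict \<eta> A x)))"
    by (intro Bochner_Integration.integral_cong prod.cong refl) simp
  also have "\<dots> = (LINT \<eta>|distr (PiM UNIV ?M) (PiM A ?M) (\<lambda>\<eta>. restrict \<eta> A). (\<Prod>x\<in>A. u x (\<eta> x)))"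
    unfolding bernoulli_product_def
    by (subst integral_distr) (auto intro!: measurable_restrict borel_measurable_prod)
  also have "\<dots> = (LINT \<eta>|PiM A ?M. (\<Prod>x\<in>A. u x (\<eta> x)))"
    using assms by (subst distr_PiM_restrict_finite) auto
  also have "\<dots> = (\<Prod>x\<in>A. (LINT b|measure_pmf (bernoulli_pmf z). u x b))"
    using assms by (intro product_integral_prod integrable_measure_pmf_finite) auto
  finally show ?thesis .
qed

section \<open>Products of normalized occupation variables\<close>

definition normalized_occupation :: "real \<Rightarrow> bool \<Rightarrow> real" where
  "normalized_occupation \<rho> b = (of_bool b - \<rho>) / sqrt (\<rho> * (1 - \<rho>))"

definition basis :: "real \<Rightarrow> 'd::finite site set \<Rightarrow> 'd config \<Rightarrow>\<^sub>C real" where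
  "basis \<rho> A = Bcontfun (\<lambda>\<eta>. \<Prod>x\<in>A. normalized_occupation \<rho> (\<eta> x))"

definition basis_bound :: "real \<Rightarrow> real" where
  "basis_bound \<rho> = max 1 (max \<bar>normalized_occupation \<rho> True\<bar> \<bar>normalized_occupation \<rho> False\<bar>)"

lemma abs_normalized_occupation_le: "\<bar>normalized_occupation \<rho> b\<bar> \<le> basis_bound \<rho>"
  by (cases b) (simp_all add: basis_bound_def)

lemma basis_bound_ge_1: "1 \<le> basis_bound \<rho>"
  by (simp add: basis_bound_def)

lemma basis_bcontfun: "(\<lambda>\<eta>. \<Prod>x\<in>A. normalized_occupation \<rho> (\<eta> x)) \<in> bcontfun"
proof (rule bcontfun_normI)
  have "continuous_on UNIV (\<lambda>\<eta> :: 'a \<Rightarrow> bool. normalized_occupation \<rho> (\<eta> x))" for x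
    by (rule continuous_on_compose2[OF Topological_Spaces.continuous_on_discrete[of UNIV "normalized_occupation \<rho>"]
        continuous_on_product_coordinates]) auto
  then show "continuous_on UNIV (\<lambda>\<eta> :: 'a \<Rightarrow> bool. \<Prod>x\<in>A. normalized_occupation \<rho> (\<eta> x))"
    by (rule continuous_on_prod)
  fix \<eta> :: "'a \<Rightarrow> bool"
  show "norm (\<Prod>x\<in>A. normalized_occupation \<rho> (\<eta> x)) \<le> basis_bound \<rho> ^ card A"
    using prod_mono[of A "\<lambda>x. \<bar>normalized_occupation \<rho> (\<eta> x)\<bar>" "\<lambda>_. basis_bound \<rho>"]
    by (simp add: abs_prod abs_normalized_occupation_le)
qed

lemma apply_basis: "basis \<rho> A \<eta> = (\<Prod>x\<in>A. normalized_occupation \<rho> (\<eta> x))"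
  unfolding basis_def by (subst Bcontfun_inverse) (auto intro: basis_bcontfun)

lemma norm_basis_le: "norm (basis \<rho> A) \<le> basis_bound \<rho> ^ card A"
proof (rule norm_bound)
  fix \<eta>
  show "norm (basis \<rho> A \<eta>) \<le> basis_bound \<rho> ^ card A"
    using prod_mono[of A "\<lambda>x. \<bar>normalized_occupation \<rho> (\<eta> x)\<bar>" "\<lambda>_. basis_bound \<rho>"]
    by (simp add: apply_basis abs_prod abs_normalized_occupation_le)
qed

lemma local_function_basis: "finite A \<Longrightarrow> local_function (apply_bcontfun (basis \<rho> A))"
  unfolding local_function_def apply_basis by (intro exI[of _ A]) (auto intro: prod.cong)

lemma bcontfun_sum_apply:
  "apply_bcontfun (\<Sum>i\<in>I. g i) \<eta> = (\<Sum>i\<in>I. apply_bcontfun (g i) \<eta> :: real)"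
  by (induction I rule: infinite_finite_induct) auto

lemma local_function_expansion:
  fixes f :: "'d::finite config \<Rightarrow> real"
  assumes \<rho>: "0 < \<rho>" "\<rho> < 1" and "local_function f"
  obtains \<Lambda> b where "finite \<Lambda>"
    "f = apply_bcontfun (\<Sum>A\<in>Pow \<Lambda>. b A *\<^sub>R basis \<rho> A)"
proof -
  have *: "\<exists>b. \<forall>\<eta>. f \<eta> = (\<Sum>A\<in>Pow \<Lambda>. b A * basis \<rho> A \<eta>)"
    if "finite \<Lambda>" "\<And>\<eta> \<xi>. (\<forall>x\<in>\<Lambda>. \<eta> x = \<xi> x) \<Longrightarrow> f \<eta> = f \<xi>" for \<Lambda> and f :: "'d config \<Rightarrow> real"
    using that
  proof (induction \<Lambda> arbitrary: f rule: finite_induct)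
    case empty
    show ?case
      using empty(1)[of _ "\<lambda>_. False"] by (intro exI[of _ "\<lambda>_. f (\<lambda>_. False)"]) (simp add: apply_basis)
  next
    case (insert x \<Lambda>)
    \<comment> \<open>The site \<open>x\<close> is split off: \<open>f\<close> is its mean over the
      occupation of \<open>x\<close>, plus the normalized occupation of \<open>x\<close> times
      \<open>q * (f1 - f0)\<close>. Both the mean and the factor depend on \<Lambda> alone, so the
      induction hypothesis covers them.\<close>
    define q where "q = sqrt (\<rho> * (1 - \<rho>))"
    define f1 where "f1 \<eta> = f (\<eta>(x := True))" for \<eta>
    define f0 where "f0 \<eta> = f (\<eta>(x := False))" for \<eta>
    have "\<exists>b. \<forall>\<eta>. \<rho> * f1 \<eta> + (1 - \<rho>) * f0 \<eta> = (\<Sum>A\<in>Pow \<Lambda>. b A * basis \<rho> A \<eta>)"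
      by (rule insert.IH) (auto simp: f1_def f0_def intro!: arg_cong2[where f = "(+)"]
          arg_cong2[where f = "(*)"] insert.prems)
    then obtain b0 where b0: "\<And>\<eta>. \<rho> * f1 \<eta> + (1 - \<rho>) * f0 \<eta> = (\<Sum>A\<in>Pow \<Lambda>. b0 A * basis \<rho> A \<eta>)"
      by blast
    have "\<exists>b. \<forall>\<eta>. q * (f1 \<eta> - f0 \<eta>) = (\<Sum>A\<in>Pow \<Lambda>. b A * basis \<rho> A \<eta>)"
      by (rule insert.IH) (auto simp: f1_def f0_def intro!: arg_cong2[where f = "(-)"] insert.prems)
    then obtain b1 where b1: "\<And>\<eta>. q * (f1 \<eta> - f0 \<eta>) = (\<Sum>A\<in>Pow \<Lambda>. b1 A * basis \<rho> A \<eta>)"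
      by blast
    define b where "b A = (if x \<in> A then b1 (A - {x}) else b0 A)" for A
    have "f \<eta> = (\<Sum>A\<in>Pow (insert x \<Lambda>). b A * basis \<rho> A \<eta>)" for \<eta>
    proof -
      let ?n = "normalized_occupation \<rho> (\<eta> x)"
      have "q \<noteq> 0" using \<rho> by (simp add: q_def)
      then have "of_bool (\<eta> x) = \<rho> + q * ?n"
        by (simp add: normalized_occupation_def q_def)
      moreover have "f \<eta> = of_bool (\<eta> x) * f1 \<eta> + (1 - of_bool (\<eta> x)) * f0 \<eta>"
        by (cases "\<eta> x") (simp_all add: f1_def f0_def fun_upd_idem)
      ultimately have "f \<eta> = (\<rho> * f1 \<eta> + (1 - \<rho>) * f0 \<eta>) + ?n * (q * (f1 \<eta> - f0 \<eta>))"
        by (simp add: algebra_simps)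
      also have "\<dots> = (\<Sum>A\<in>Pow \<Lambda>. b A * basis \<rho> A \<eta>)
          + (\<Sum>A\<in>insert x ` Pow \<Lambda>. b A * basis \<rho> A \<eta>)"
      proof -
        have inj: "inj_on (insert x) (Pow \<Lambda>)"
          using insert.hyps by (auto simp: inj_on_def)
        have "(\<Sum>A\<in>insert x ` Pow \<Lambda>. b A * basis \<rho> A \<eta>)
          = (\<Sum>A\<in>Pow \<Lambda>. ?n * (b1 A * basis \<rho> A \<eta>))"
          unfolding sum.reindex[OF inj] o_def
        proof (rule sum.cong[OF refl])
          fix A assume "A \<in> Pow \<Lambda>"
          then have "x \<notin> A" "finite A"
            using insert.hyps by (auto intro: finite_subset)
          then show "b (insert x A) * basis \<rho> (insert x A) \<eta>
              = ?n * (b1 A * basis \<rho> A \<eta>)"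
            by (simp add: b_def apply_basis)
        qed
        moreover have "(\<Sum>A\<in>Pow \<Lambda>. b A * basis \<rho> A \<eta>)
            = (\<Sum>A\<in>Pow \<Lambda>. b0 A * basis \<rho> A \<eta>)"
          using insert.hyps by (intro sum.cong) (auto simp: b_def)
        ultimately show ?thesis
          by (simp add: b0 b1 sum_distrib_left)
      qed
      also have "\<dots> = (\<Sum>A\<in>Pow (insert x \<Lambda>). b A * basis \<rho> A \<eta>)"
        unfolding Pow_insert
        by (rule sum.union_disjoint[symmetric]) (use insert.hyps in auto)
      finally show ?thesis .
    qed
    then show ?case by blast
  qed
  obtain \<Lambda> where \<Lambda>: "finite \<Lambda>" "\<And>\<eta> \<xi>. (\<forall>x\<in>\<Lambda>. \<eta> x = \<xi> x) \<Longrightarrow> f \<eta> = f \<xi>"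
    using assms(3) unfolding local_function_def by blast
  from *[of \<Lambda> f, OF \<Lambda>]
  obtain b where "\<forall>\<eta>. f \<eta> = (\<Sum>A\<in>Pow \<Lambda>. b A * basis \<rho> A \<eta>)" ..
  then show thesis
    by (intro that[OF \<Lambda>(1), of b]) (simp add: fun_eq_iff bcontfun_sum_apply)
qed

lemma expectation_normalized_occupation:
  assumes "0 \<le> z" "z \<le> 1"
  shows "(LINT b|measure_pmf (bernoulli_pmf z). normalized_occupation \<rho> b) = (z - \<rho>) / sqrt (\<rho> * (1 - \<rho>))"
  using assms by (simp add: normalized_occupation_def field_simps)

lemma expectation_normalized_occupation_power2:
  assumes "0 < \<rho>" "\<rho> < 1"
  shows "(LINT b|measure_pmf (bernoulli_pmf \<rho>). (normalized_occupation \<rho> b)\<^sup>2) = 1"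
proof -
  have "(LINT b|measure_pmf (bernoulli_pmf \<rho>). (normalized_occupation \<rho> b)\<^sup>2)
      = (\<rho> * (1 - \<rho>)\<^sup>2 + (1 - \<rho>) * \<rho>\<^sup>2) / (\<rho> * (1 - \<rho>))"
    using assms by (simp add: normalized_occupation_def power_divide add_divide_distrib)
  also have "\<dots> = 1"
    using assms by (simp add: power2_eq_square field_simps)
  finally show ?thesis .
qed

lemma integral_basis:
  assumes "finite A" "0 \<le> z" "z \<le> 1"
  shows "(LINT \<eta>|bernoulli_product z. basis \<rho> A \<eta>) = ((z - \<rho>) / sqrt (\<rho> * (1 - \<rho>))) ^ card A"
  unfolding apply_basis using assms
  by (subst integral_bernoulli_product_prod)
     (simp_all only: expectation_normalized_occupation[OF assms(2,3)] prod_constant)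

lemma integral_basis_mult:
  assumes \<rho>: "0 < \<rho>" "\<rho> < 1" and "finite A" "finite B"
  shows "(LINT \<eta>|bernoulli_product \<rho>. basis \<rho> A \<eta> * basis \<rho> B \<eta>) = of_bool (A = B)"
proof -
  let ?u = "\<lambda>x b. (if x \<in> A then normalized_occupation \<rho> b else 1) *
      (if x \<in> B then normalized_occupation \<rho> b else 1)"
  have "basis \<rho> A \<eta> * basis \<rho> B \<eta> = (\<Prod>x\<in>A \<union> B. ?u x (\<eta> x))" for \<eta>
    unfolding apply_basis prod.distrib using assms
    by (intro arg_cong2[where f = "(*)"] prod.mono_neutral_cong_left) auto
  then have "(LINT \<eta>|bernoulli_product \<rho>. basis \<rho> A \<eta> * basis \<rho> B \<eta>)
      = (\<Prod>x\<in>A \<union> B. (LINT b|measure_pmf (bernoulli_pmf \<rho>). ?u x b))"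
    using assms by (subst integral_bernoulli_product_prod[symmetric]) simp_all
  also have "\<dots> = (\<Prod>x\<in>A \<union> B. of_bool (x \<in> A \<and> x \<in> B))"
  proof (rule prod.cong[OF refl])
    fix x assume "x \<in> A \<union> B"
    then consider "x \<in> A" "x \<in> B" | "x \<in> A" "x \<notin> B" | "x \<notin> A" "x \<in> B" by blast
    then show "(LINT b|measure_pmf (bernoulli_pmf \<rho>). ?u x b) = of_bool (x \<in> A \<and> x \<in> B)"
    proof cases
      case 1
      then show ?thesis
        using expectation_normalized_occupation_power2[OF \<rho>] by (simp add: power2_eq_square)
    next
      case 2
      then show ?thesis
        using expectation_normalized_occupation[of \<rho> \<rho>] \<rho> by simp
    next
      case 3
      then show ?thesis
        using expectation_normalized_occupation[of \<rho> \<rho>] \<rho> by simp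
    qed
  qed
  also have "\<dots> = of_bool (A = B)"
  proof (cases "A = B")
    case False
    then have "\<exists>x\<in>A \<union> B. \<not> (x \<in> A \<and> x \<in> B)" by blast
    with False assms show ?thesis by (auto simp: prod_zero_iff)
  qed simp
  finally show ?thesis .
qed

text \<open>Under density z the product over \<open>A\<close> has mean ((z - \<rho>) / q)^(card A).
  The mean of \<open>f\<close> is therefore a polynomial in z - \<rho> whose coefficient of degree n
  is the sum of the coefficients on cardinality n, divided by q^n.\<close>

lemma function_degree_coefficients:
  fixes b :: "'d::finite site set \<Rightarrow> real"
  assumes \<rho>: "0 < \<rho>" "\<rho> < 1" and \<Lambda>: "finite \<Lambda>"
    and f: "f = apply_bcontfun (\<Sum>A\<in>Pow \<Lambda>. b A *\<^sub>R basis \<rho> A)"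
    and j: "enat j < function_degree \<rho> f"
  shows "(\<Sum>A\<in>{A\<in>Pow \<Lambda>. card A = j}. b A) = 0"
proof -
  define q where "q = sqrt (\<rho> * (1 - \<rho>))"
  have q: "q > 0" using \<rho> by (simp add: q_def)
  define \<beta> where "\<beta> n = (\<Sum>A\<in>{A\<in>Pow \<Lambda>. card A = n}. b A) / q ^ n" for n
  define N where "N = card \<Lambda>"
  have mean: "bernoulli_mean f z = (\<Sum>n\<le>N. \<beta> n * (z - \<rho>) ^ n)" if z: "z \<in> {0<..<1}" for z
  proof -
    have "bernoulli_mean f z = (LINT \<eta>|bernoulli_product z. (\<Sum>A\<in>Pow \<Lambda>. b A * basis \<rho> A \<eta>))"
      unfolding bernoulli_mean_def f
      by (rule Bochner_Integration.integral_cong) (simp_all add: bcontfun_sum_apply)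
    also have "\<dots> = (\<Sum>A\<in>Pow \<Lambda>. b A * (LINT \<eta>|bernoulli_product z. basis \<rho> A \<eta>))"
      by (subst Bochner_Integration.integral_sum)
         (auto intro!: integrable_mult_right bcontfun_integrable prob_space_bernoulli_product sets_bernoulli_product)
    also have "\<dots> = (\<Sum>A\<in>Pow \<Lambda>. b A * ((z - \<rho>) / q) ^ card A)"
      using z \<Lambda> by (intro sum.cong refl) (auto simp: integral_basis q_def dest: finite_subset)
    also have "\<dots> = (\<Sum>n\<le>N. \<Sum>A\<in>{A\<in>Pow \<Lambda>. card A = n}. b A * ((z - \<rho>) / q) ^ card A)"
      using \<Lambda> by (intro sum.group[symmetric]) (auto simp: N_def card_mono)
    also have "\<dots> = (\<Sum>n\<le>N. \<beta> n * (z - \<rho>) ^ n)"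
      by (intro sum.cong refl) (simp add: \<beta>_def power_divide sum_distrib_right sum_divide_distrib)
    finally show ?thesis .
  qed
  \<comment> \<open>The Pochhammer symbol is the falling factorial of n with i factors; it vanishes
    for n < i, which compensates for the truncated exponent \<open>n - i\<close>. The formula is
    carried on the whole open interval because the next derivative needs a neighbourhood.\<close>
  have deriv: "(deriv ^^ i) (bernoulli_mean f) z = (\<Sum>n\<le>N. \<beta> n * (pochhammer (real n - real i + 1) i * (z - \<rho>) ^ (n - i)))"
    if "z \<in> {0<..<1}" for i z
    using that
  proof (induction i arbitrary: z)
    case 0
    then show ?case using mean by simp
  next
    case (Suc i)
    have ev: "\<forall>\<^sub>F y in nhds z. (deriv ^^ i) (bernoulli_mean f) y
      = (\<Sum>n\<le>N. \<beta> n * (pochhammer (real n - real i + 1) i * (y - \<rho>) ^ (n - i)))"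
      using eventually_nhds_in_open[of "{0<..<1}" z] Suc.prems
      by (auto elim!: eventually_mono simp: Suc.IH)
    have "(deriv ^^ Suc i) (bernoulli_mean f) z
      = deriv (\<lambda>y. \<Sum>n\<le>N. \<beta> n * (pochhammer (real n - real i + 1) i * (y - \<rho>) ^ (n - i))) z"
      using deriv_cong_ev[OF ev refl] by simp
    also have "\<dots> = (\<Sum>n\<le>N. \<beta> n * (pochhammer (real n - real i + 1) i * (real (n - i) * (z - \<rho>) ^ (n - i - 1))))"
      by (rule DERIV_imp_deriv) (auto intro!: derivative_eq_intros sum.cong)
    also have "\<dots> = (\<Sum>n\<le>N. \<beta> n * (pochhammer (real n - real (Suc i) + 1) (Suc i) * (z - \<rho>) ^ (n - Suc i)))"
    proof (rule sum.cong[OF refl])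
      fix n
      have "pochhammer (real n - real i + 1) i * (real (n - i) * (z - \<rho>) ^ (n - i - 1))
        = pochhammer (real n - real (Suc i) + 1) (Suc i) * (z - \<rho>) ^ (n - Suc i)"
      proof (cases "i \<le> n")
        case True
        then show ?thesis by (simp add: pochhammer_rec of_nat_diff)
      next
        case False
        then have "pochhammer (real n - real (Suc i) + 1) (Suc i) = 0"
          by (auto simp: pochhammer_eq_0_iff intro!: exI[of _ "i - n"])
        with False show ?thesis by simp
      qed
      then show "\<beta> n * (pochhammer (real n - real i + 1) i * (real (n - i) * (z - \<rho>) ^ (n - i - 1)))
        = \<beta> n * (pochhammer (real n - real (Suc i) + 1) (Suc i) * (z - \<rho>) ^ (n - Suc i))"
        by (simp only:)
    qed
    finally show ?case .
  qed
  have zero: "(deriv ^^ j) (bernoulli_mean f) \<rho> = 0"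
  proof (cases "\<forall>i. (deriv ^^ i) (bernoulli_mean f) \<rho> = 0")
    case False
    then have "enat j < enat (LEAST i. (deriv ^^ i) (bernoulli_mean f) \<rho> \<noteq> 0)"
      using j by (simp only: function_degree_def if_False)
    then show ?thesis using not_less_Least by auto
  qed simp
  show ?thesis
  proof (cases "j \<le> N")
    case True
    have "(deriv ^^ j) (bernoulli_mean f) \<rho>
      = (\<Sum>n\<le>N. \<beta> n * (pochhammer (real n - real j + 1) j * 0 ^ (n - j)))"
      using deriv[of \<rho> j] \<rho> by simp
    also have "\<dots> = (\<Sum>n\<in>{j}. \<beta> n * (pochhammer (real n - real j + 1) j * 0 ^ (n - j)))"
    proof (rule sum.mono_neutral_right)
      show "\<forall>n\<in>{..N} - {j}. \<beta> n * (pochhammer (real n - real j + 1) j * 0 ^ (n - j)) = 0"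
      proof
        fix n assume n: "n \<in> {..N} - {j}"
        show "\<beta> n * (pochhammer (real n - real j + 1) j * 0 ^ (n - j)) = 0"
        proof (cases "j \<le> n")
          case False
          then have "pochhammer (real n - real j + 1) j = 0"
            by (auto simp: pochhammer_eq_0_iff intro!: exI[of _ "j - n - 1"])
          then show ?thesis by simp
        qed (use n in auto)
      qed
    qed (use True in auto)
    also have "\<dots> = \<beta> j * fact j"
      by (simp add: pochhammer_fact)
    finally show ?thesis
      using zero q by (simp add: \<beta>_def)
  next
    case False
    have "{A\<in>Pow \<Lambda>. card A = j} = {}"
      using False card_mono[OF \<Lambda>] by (auto simp: N_def)
    then show ?thesis by (simp only: sum.empty)
  qed
qed

section \<open>The semigroup on the Fourier basis\<close>

lemma basis_exchange:
  assumes "x \<in> A" "z \<notin> A"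
  shows "basis \<rho> A (exchange x z \<eta>) = basis \<rho> (move A x z) \<eta>"
    and "basis \<rho> A (exchange z x \<eta>) = basis \<rho> (move A x z) \<eta>"
proof -
  have "x \<noteq> z" using assms by auto
  then have sym: "exchange z x \<eta> = exchange x z \<eta>"
    by (auto simp: exchange_def fun_eq_iff)
  have inj: "bij_betw (\<lambda>y. if y = x then z else y) A (move A x z)"
    by (rule bij_betw_byWitness[of _ "\<lambda>y. if y = z then x else y"])
       (use assms in \<open>auto simp: move_def\<close>)
  have "(\<Prod>y\<in>move A x z. normalized_occupation \<rho> (\<eta> y))
      = (\<Prod>y\<in>A. normalized_occupation \<rho> (\<eta> (if y = x then z else y)))"
    by (rule prod.reindex_bij_betw[OF inj, symmetric])
  also have "\<dots> = (\<Prod>y\<in>A. normalized_occupation \<rho> (exchange x z \<eta> y))"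
    using assms by (intro prod.cong refl) (auto simp: exchange_def)
  finally show "basis \<rho> A (exchange x z \<eta>) = basis \<rho> (move A x z) \<eta>"
    by (simp add: apply_basis)
  with sym show "basis \<rho> A (exchange z x \<eta>) = basis \<rho> (move A x z) \<eta>"
    by simp
qed

text \<open>Either two factors of the product are permuted or no factor is touched.\<close>

lemma basis_exchange_same:
  assumes "x \<in> A \<longleftrightarrow> z \<in> A"
  shows "basis \<rho> A (exchange x z \<eta>) = basis \<rho> A \<eta>"
proof (cases "x \<in> A")
  case True
  then have "z \<in> A" using assms by simp
  have "bij_betw (\<lambda>y. if y = x then z else if y = z then x else y) A A"
    by (rule bij_betw_byWitness[of _ "\<lambda>y. if y = x then z else if y = z then x else y"])
       (use True \<open>z \<in> A\<close> in auto)
  from prod.reindex_bij_betw[OF this, of "\<lambda>y. normalized_occupation \<rho> (\<eta> y)"]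
  have "(\<Prod>y\<in>A. normalized_occupation \<rho> (\<eta> (if y = x then z else if y = z then x else y)))
      = basis \<rho> A \<eta>"
    by (simp only: apply_basis)
  moreover have "exchange x z \<eta> y = \<eta> (if y = x then z else if y = z then x else y)" for y
    by (simp add: exchange_def)
  ultimately show ?thesis by (simp only: apply_basis)
next
  case False
  then have "\<forall>y\<in>A. exchange x z \<eta> y = \<eta> y"
    using assms by (auto simp: exchange_def)
  then show ?thesis by (simp add: apply_basis)
qed

lemma exchange_eq: "\<eta> x = \<eta> z \<Longrightarrow> exchange x z \<eta> = \<eta>"
  by (auto simp: exchange_def fun_eq_iff)

context long_range_kernel
begin

lemma abs_basis_diff_le:
  assumes "finite A" "x \<in> A" "z \<notin> A"
  shows "\<bar>basis \<rho> (move A x z) \<eta> - basis \<rho> A \<eta>\<bar>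
    \<le> 2 * basis_bound \<rho> ^ card A"
proof -
  have "\<bar>basis \<rho> (move A x z) \<eta>\<bar> \<le> basis_bound \<rho> ^ card A"
    using order_trans[OF abs_bcontfun_le_norm norm_basis_le, of \<rho> "move A x z" \<eta>] card_move[OF assms]
    by simp
  moreover have "\<bar>basis \<rho> A \<eta>\<bar> \<le> basis_bound \<rho> ^ card A"
    by (rule order_trans[OF abs_bcontfun_le_norm norm_basis_le])
  ultimately show ?thesis by linarith
qed

lemma rate_mult_summable:
  assumes "finite A" "\<And>x z. (x, z) \<in> moves A \<Longrightarrow> \<bar>u x z\<bar> \<le> B"
  shows "(\<lambda>(x, z). s (z - x) * u x z :: real) summable_on moves A"
proof -
  have "(\<lambda>e. norm ((\<lambda>(x, z). s (z - x) * u x z) e)) summable_on moves A"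
  proof (rule summable_on_comparison_test)
    show "(\<lambda>e. (\<lambda>(x, z). s (z - x)) e * B) summable_on moves A"
      by (intro summable_on_cmult_left rate_summable assms)
    fix e assume "e \<in> moves A"
    then show "norm ((\<lambda>(x, z). s (z - x) * u x z) e) \<le> (\<lambda>(x, z). s (z - x)) e * B"
      using assms(2) by (cases e) (auto simp: abs_mult kernel_nonneg mult_left_mono)
  qed simp
  then show ?thesis by (rule summable_on_iff_abs_summable_on_real[THEN iffD2])
qed

text \<open>
  Only pairs with exactly one site in \<open>A\<close> contribute. The two orderings of such a pair add up to
  the full rate, because an exchange has no effect when both occupations agree.
\<close>
lemma exclusion_operator_basis:
  assumes A: "finite A"
  shows "exclusion_operator s (apply_bcontfun (basis \<rho> A)) \<eta>
    = (\<Sum>\<^sub>\<infinity>(x, z)\<in>moves A. s (z - x) *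
        (basis \<rho> (move A x z) \<eta> - basis \<rho> A \<eta>))"
proof -
  let ?F = "apply_bcontfun (basis \<rho> A)"
  define occ where "occ x z = (of_bool (\<eta> x) * (1 - of_bool (\<eta> z)) :: real)" for x z
  define g where "g = (\<lambda>(x, z). s (z - x) * (occ x z * (?F (exchange x z \<eta>) - ?F \<eta>)))"
  let ?D = "\<lambda>x z. basis \<rho> (move A x z) \<eta> - ?F \<eta>"
  have sflip: "s (x - z) = s (z - x)" for x z
    using kernel_minus[of "z - x"] by simp
  have bij: "bij_betw (\<lambda>(x, y). (x, x + y)) UNIV (UNIV :: ('d site \<times> 'd site) set)"
    by (rule bij_betw_byWitness[of _ "\<lambda>(x, z). (x, z - x)"]) auto
  have o1: "\<bar>occ x z * w\<bar> \<le> \<bar>w\<bar>" for x z w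
    by (simp add: occ_def)
  have b: "\<bar>occ x z * ?D x z\<bar> \<le> 2 * basis_bound \<rho> ^ card A"
    "\<bar>occ z x * ?D x z\<bar> \<le> 2 * basis_bound \<rho> ^ card A"
    if "(x, z) \<in> moves A" for x z
    using order_trans[OF o1 abs_basis_diff_le[OF A]] that by (auto simp: moves_def)
  have g1: "g (x, z) = s (z - x) * (occ x z * ?D x z)" "g (z, x) = s (z - x) * (occ z x * ?D x z)"
    if "(x, z) \<in> moves A" for x z
    using that by (auto simp: g_def moves_def basis_exchange sflip[of x z])
  have sm1: "g summable_on moves A"
    using rate_mult_summable[OF A b(1)]
    by (rule summable_on_cong[THEN iffD1, rotated]) (auto simp: g1)
  have sm2: "(\<lambda>e. g (prod.swap e)) summable_on moves A"
    using rate_mult_summable[OF A b(2)]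
    by (rule summable_on_cong[THEN iffD1, rotated]) (auto simp: g1)
  have sm3: "g summable_on prod.swap ` moves A"
    using sm2 by (subst summable_on_reindex) (auto simp: comp_def)
  have "exclusion_operator s ?F \<eta> = (\<Sum>\<^sub>\<infinity>e\<in>UNIV. g ((\<lambda>(x, y). (x, x + y)) e))"
    unfolding exclusion_operator_def by (rule infsum_cong) (auto simp: g_def occ_def mult.assoc)
  also have "\<dots> = infsum g UNIV"
    by (rule infsum_reindex_bij_betw[OF bij])
  also have "\<dots> = infsum g (moves A \<union> prod.swap ` moves A)"
  proof (rule infsum_cong_neutral)
    fix e :: "'d site \<times> 'd site" assume e: "e \<in> UNIV - (moves A \<union> prod.swap ` moves A)"
    obtain x z where xz: "e = (x, z)" by (cases e)
    have "(z, x) \<notin> moves A" using e xz by force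
    then have "x \<in> A \<longleftrightarrow> z \<in> A" using e xz by (auto simp: moves_def)
    then show "g e = 0" by (simp add: g_def xz basis_exchange_same)
  qed auto
  also have "\<dots> = infsum g (moves A) + infsum g (prod.swap ` moves A)"
    by (rule infsum_Un_disjoint[OF sm1 sm3]) (auto simp: moves_def)
  also have "infsum g (prod.swap ` moves A) = infsum (\<lambda>e. g (prod.swap e)) (moves A)"
    by (subst infsum_reindex) (auto simp: comp_def)
  also have "infsum g (moves A) + \<dots> = infsum (\<lambda>e. g e + g (prod.swap e)) (moves A)"
    by (rule infsum_add[symmetric, OF sm1 sm2])
  also have "\<dots> = (\<Sum>\<^sub>\<infinity>(x, z)\<in>moves A. s (z - x) * ?D x z)"
  proof (rule infsum_cong)
    fix e assume e: "e \<in> moves A"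
    obtain x z where xz: "e = (x, z)" by (cases e)
    have D: "?D x z = 0" if "\<eta> x = \<eta> z"
      using that e xz basis_exchange(1)[of x A z \<rho> \<eta>] exchange_eq[of \<eta> x z] by (simp add: moves_def)
    have "occ x z * ?D x z + occ z x * ?D x z = ?D x z"
      by (cases "\<eta> x"; cases "\<eta> z") (use D in \<open>auto simp: occ_def\<close>)
    then have "s (z - x) * (occ x z * ?D x z) + s (z - x) * (occ z x * ?D x z) = s (z - x) * ?D x z"
      by (simp only: distrib_left[symmetric])
    then show "g e + g (prod.swap e) = (case e of (x, z) \<Rightarrow> s (z - x) * ?D x z)"
      using e xz by (simp add: g1)
  qed
  finally show ?thesis .
qed

text \<open>Increments of the basis are bounded uniformly in the configuration, so the remainder is
  at most a constant times the remainder of the summable rates. The convergence is thus in the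
  supremum norm, which lets bounded functionals act term by term.\<close>

lemma generator_basis_has_sum:
  assumes A: "finite A" and h: "apply_bcontfun h = exclusion_operator s (apply_bcontfun (basis \<rho> A))"
  shows "((\<lambda>(x, z). s (z - x) *\<^sub>R (basis \<rho> (move A x z) - basis \<rho> A)) has_sum h) (moves A)"
proof -
  let ?g = "\<lambda>(x, z). s (z - x) *\<^sub>R (basis \<rho> (move A x z) - basis \<rho> A)"
  let ?r = "\<lambda>(x, z). s (z - x)"
  define K where "K = 2 * basis_bound \<rho> ^ card A"
  have K: "0 \<le> K" using basis_bound_ge_1[of \<rho>] by (simp add: K_def)
  have bound: "norm (sum ?g F - h) \<le> K * (infsum ?r (moves A) - sum ?r F)"
    if F: "finite F" "F \<subseteq> moves A" for F
  proof (rule norm_bound)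
    fix \<eta>
    let ?u = "\<lambda>x z. basis \<rho> (move A x z) \<eta> - basis \<rho> A \<eta>"
    let ?v = "\<lambda>(x, z). s (z - x) * ?u x z"
    have u: "\<bar>?u x z\<bar> \<le> K" if "(x, z) \<in> moves A" for x z
      using abs_basis_diff_le[OF A, of x z \<rho> \<eta>] that by (auto simp: moves_def K_def)
    have sm: "?v summable_on moves A"
      by (rule rate_mult_summable[OF A u])
    have Fs: "apply_bcontfun (sum ?g F) \<eta> = sum ?v F"
      by (simp add: bcontfun_sum_apply split_def)
    have sub: "moves A - F \<subseteq> moves A" by auto
    have smF: "?v summable_on (moves A - F)" "?r summable_on (moves A - F)"
      by (rule summable_on_subset_banach[OF _ sub], rule sm)
         (rule summable_on_subset_banach[OF _ sub], rule rate_summable[OF A])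
    have sp: "infsum w (moves A) = sum w F + infsum w (moves A - F)"
      if "w summable_on (moves A - F)" for w :: "_ \<Rightarrow> real"
    proof -
      have "infsum w (F \<union> (moves A - F)) = infsum w F + infsum w (moves A - F)"
        by (rule infsum_Un_disjoint) (use F that in auto)
      moreover have "F \<union> (moves A - F) = moves A" using F by auto
      ultimately show ?thesis using F by simp
    qed
    have "apply_bcontfun (sum ?g F - h) \<eta> = - infsum ?v (moves A - F)"
      using exclusion_operator_basis[OF A, of \<rho> \<eta>] sp[OF smF(1)] by (simp add: Fs h)
    moreover have "\<bar>infsum ?v (moves A - F)\<bar> \<le> infsum (\<lambda>e. K * ?r e) (moves A - F)"
    proof (rule norm_infsum_le[of ?v, unfolded real_norm_def])
      show "(?v has_sum infsum ?v (moves A - F)) (moves A - F)"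
        using smF(1) by simp
      show "((\<lambda>e. K * ?r e) has_sum infsum (\<lambda>e. K * ?r e) (moves A - F)) (moves A - F)"
        by (intro has_sum_infsum summable_on_cmult_right smF(2))
      fix e assume "e \<in> moves A - F"
      then show "\<bar>?v e\<bar> \<le> K * ?r e"
        using u by (cases e) (auto simp: abs_mult kernel_nonneg mult.commute[of K] intro!: mult_left_mono)
    qed
    moreover have "infsum (\<lambda>e. K * ?r e) (moves A - F) = K * (infsum ?r (moves A) - sum ?r F)"
      using sp[OF smF(2)] by (simp add: infsum_cmult_right')
    ultimately show "norm (apply_bcontfun (sum ?g F - h) \<eta>) \<le> K * (infsum ?r (moves A) - sum ?r F)"
      by simp
  qed
  have "(sum ?r \<longlongrightarrow> infsum ?r (moves A)) (finite_subsets_at_top (moves A))"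
    using has_sum_infsum[OF rate_summable(1)[OF A]] by (simp add: has_sum_def)
  then have "((\<lambda>F. K * (infsum ?r (moves A) - sum ?r F)) \<longlongrightarrow> K * (infsum ?r (moves A) - infsum ?r (moves A)))
      (finite_subsets_at_top (moves A))"
    by (intro tendsto_intros)
  then have "((\<lambda>F. sum ?g F - h) \<longlongrightarrow> 0) (finite_subsets_at_top (moves A))"
    by (intro Lim_null_comparison[OF eventually_finite_subsets_at_top_weakI[OF bound]]) auto
  then show ?thesis
    unfolding has_sum_def by (simp add: LIM_zero_iff)
qed

end

section \<open>Calculus of the Markov semigroup\<close>

lemma derivative_le_imp_le:
  fixes u v :: "real \<Rightarrow> real"
  assumes t: "0 \<le> t" and 0: "u 0 \<le> v 0"
    and u: "\<And>r. 0 \<le> r \<Longrightarrow> (u has_real_derivative u' r) (at r within {0..})"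
    and v: "\<And>r. 0 \<le> r \<Longrightarrow> (v has_real_derivative v' r) (at r within {0..})"
    and le: "\<And>r. 0 \<le> r \<Longrightarrow> u' r \<le> v' r"
  shows "u t \<le> v t"
proof -
  have d: "((\<lambda>r. v r - u r) has_real_derivative v' r - u' r) (at r within {0..})" if "0 \<le> r" for r
    using u[OF that] v[OF that] by (intro derivative_intros)
  have "v 0 - u 0 \<le> v t - u t"
  proof (rule DERIV_nonneg_imp_increasing_open[OF t])
    fix r assume r: "0 < r" "r < t"
    have "at r within {0..} = at r"
      using r by (intro at_within_interior) (simp add: interior_real_atLeast)
    then show "\<exists>y. ((\<lambda>r. v r - u r) has_real_derivative y) (at r) \<and> 0 \<le> y"
      using d[of r] r le[of r] by (intro exI[of _ "v' r - u' r"]) auto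
  next
    show "continuous_on {0..t} (\<lambda>r. v r - u r)"
      by (rule continuous_on_subset[of "{0..}"])
         (auto intro!: DERIV_continuous_on d)
  qed
  then show ?thesis using 0 by simp
qed

locale exclusion_markov_semigroup = long_range_kernel s \<gamma> c
  for s :: "'d::finite site \<Rightarrow> real" and \<gamma> c :: real +
  fixes S :: "real \<Rightarrow> ('d config \<Rightarrow>\<^sub>C real) \<Rightarrow> ('d config \<Rightarrow>\<^sub>C real)" and \<rho> :: real
  assumes semigroup: "exclusion_semigroup s S"
    and \<rho>: "0 < \<rho>" "\<rho> < 1"
begin

lemma markov: "markov_semigroup S"
  using semigroup by (simp add: exclusion_semigroup_def)

lemma S_linear: "0 \<le> t \<Longrightarrow> linear (S t)"
  and S_0: "S 0 g = g"
  and S_add: "0 \<le> t \<Longrightarrow> 0 \<le> u \<Longrightarrow> S (t + u) g = S t (S u g)"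
  and S_const_1: "0 \<le> t \<Longrightarrow> S t (const_bcontfun 1) = const_bcontfun 1"
  and S_nonneg: "0 \<le> t \<Longrightarrow> (\<And>\<eta>. 0 \<le> apply_bcontfun g \<eta>) \<Longrightarrow> 0 \<le> apply_bcontfun (S t g) \<eta>"
  and S_right_continuous: "0 \<le> t \<Longrightarrow> continuous (at_right t) (\<lambda>u. S u g)"
  using markov by (auto simp: markov_semigroup_def)

text \<open>Positivity and preservation of constants, applied to the constant \<open>norm g\<close>
  plus and minus \<open>g\<close>.\<close>

lemma S_norm_le:
  assumes t: "0 \<le> t"
  shows "norm (S t g) \<le> norm g"
proof (rule norm_bound)
  fix \<eta>
  interpret linear "S t" by (rule S_linear[OF t])
  have "0 \<le> apply_bcontfun (S t (norm g *\<^sub>R const_bcontfun 1 - g)) \<eta>"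
    by (rule S_nonneg[OF t]) (use abs_bcontfun_le_norm[of g] in \<open>simp add: abs_le_iff\<close>)
  moreover have "0 \<le> apply_bcontfun (S t (norm g *\<^sub>R const_bcontfun 1 + g)) \<eta>"
    by (rule S_nonneg[OF t]) (use abs_bcontfun_le_norm[of g] in \<open>simp add: abs_le_iff\<close>, smt (verit))
  ultimately show "norm (apply_bcontfun (S t g) \<eta>) \<le> norm g"
    by (simp add: diff add scaleR S_const_1[OF t] abs_le_iff)
qed

lemma S_bounded_linear: "0 \<le> t \<Longrightarrow> bounded_linear (S t)"
  using S_linear[of t] S_norm_le[of t]
  by (intro bounded_linear.intro bounded_linear_axioms.intro exI[of _ 1]) auto

lemma S_tendsto_identity: "((\<lambda>e. S e g) \<longlongrightarrow> g) (at_right 0)"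
  using S_right_continuous[of 0 g] by (simp add: continuous_within S_0)

lemma eventually_at_right_0_less: "0 < t \<Longrightarrow> \<forall>\<^sub>F e in at_right (0::real). e < t"
  by (rule eventually_at_rightI[of 0 t]) auto

text \<open>Markov semigroups are given with continuity from the right. Continuity from the left
  follows by contractivity, because \<open>S t g\<close> equals \<open>S (t - e) (S e g)\<close> and
  \<open>S e g\<close> is close to \<open>g\<close>.\<close>

lemma S_left_difference:
  assumes t: "0 < t"
  shows "((\<lambda>e. S (t - e) g) \<longlongrightarrow> S t g) (at_right 0)"
proof -
  have "((\<lambda>e. norm (S e g - g)) \<longlongrightarrow> 0) (at_right 0)"
    using S_tendsto_identity[of g] by (simp add: LIM_zero_iff tendsto_norm_zero_iff)
  moreover have "\<forall>\<^sub>F e in at_right 0. norm (S (t - e) g - S t g) \<le> norm (S e g - g)"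
    using eventually_at_right_less[of "0::real"] eventually_at_right_0_less[OF t]
  proof eventually_elim
    case (elim e)
    interpret linear "S (t - e)" by (rule S_linear) (use elim in auto)
    have "S t g = S (t - e) (S e g)" using S_add[of "t - e" e g] elim by simp
    then have "S (t - e) g - S t g = S (t - e) (g - S e g)" by (simp add: diff)
    then show ?case
      using S_norm_le[of "t - e" "g - S e g"] elim by (simp add: norm_minus_commute)
  qed
  ultimately have "((\<lambda>e. S (t - e) g - S t g) \<longlongrightarrow> 0) (at_right 0)"
    by (rule Lim_null_comparison[rotated])
  then show ?thesis by (simp add: LIM_zero_iff)
qed

lemma S_functional_continuous:
  fixes \<phi> :: "_ \<Rightarrow> real"
  assumes \<phi>: "bounded_linear \<phi>"
  shows "continuous_on {0..} (\<lambda>t. \<phi> (S t g))"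
proof -
  interpret bounded_linear \<phi> by fact
  have "continuous (at t within {0..}) (\<lambda>t. S t g)" if t: "0 \<le> t" for t
  proof (cases "t = 0")
    case True
    then show ?thesis
      using S_right_continuous[of 0 g] by (simp add: at_within_Ici_at_right)
  next
    case False
    then have "at t within {0..} = at t"
      using t by (intro at_within_interior) (simp add: interior_real_atLeast)
    moreover have "continuous (at_left t) (\<lambda>t. S t g)"
      unfolding continuous_within
    proof (subst filterlim_at_left_to_right, subst filterlim_at_right_to_0)
      show "((\<lambda>x. S (- (x + - t)) g) \<longlongrightarrow> S t g) (at_right 0)"
        using S_left_difference[of t g] t False by simp
    qed
    ultimately show ?thesis
      using S_right_continuous[OF t, of g] by (simp add: continuous_at_split)
  qed
  then have "continuous_on {0..} (\<lambda>t. S t g)"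
    by (simp add: continuous_on_eq_continuous_within)
  then show ?thesis by (rule continuous_on)
qed

text \<open>The generator acts on the initial function before the flow does, so only
  \<open>g\<close> has to lie in its domain. From the right the difference quotient is
  \<open>S t\<close> of the quotient at 0; from the left it is \<open>S (t - e)\<close> of that
  quotient, and contractivity controls the varying time.\<close>

lemma S_functional_derivative:
  fixes \<phi> :: "_ \<Rightarrow> real"
  assumes \<phi>: "bounded_linear \<phi>" and gen: "generator_value S g h" and t: "0 \<le> t"
  shows "((\<lambda>u. \<phi> (S u g)) has_real_derivative \<phi> (S t h)) (at t within {0..})"
proof -
  interpret bounded_linear \<phi> by fact
  have g0: "((\<lambda>e. (S e g - g) /\<^sub>R e) \<longlongrightarrow> h) (at_right 0)"
    using gen by (simp add: generator_value_def)
  have right: "((\<lambda>y. (\<phi> (S y g) - \<phi> (S t g)) / (y - t)) \<longlongrightarrow> \<phi> (S t h)) (at_right t)"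
  proof (subst filterlim_at_right_to_0)
    interpret St: bounded_linear "S t" by (rule S_bounded_linear[OF t])
    have "((\<lambda>e. \<phi> (S t ((S e g - g) /\<^sub>R e))) \<longlongrightarrow> \<phi> (S t h)) (at_right 0)"
      by (intro tendsto St.tendsto g0)
    then show "((\<lambda>e. (\<phi> (S (e + t) g) - \<phi> (S t g)) / (e + t - t)) \<longlongrightarrow> \<phi> (S t h)) (at_right 0)"
    proof (rule Lim_transform_eventually)
      show "\<forall>\<^sub>F e in at_right 0. \<phi> (S t ((S e g - g) /\<^sub>R e)) = (\<phi> (S (e + t) g) - \<phi> (S t g)) / (e + t - t)"
        using eventually_at_right_less[of "0::real"]
      proof eventually_elim
        case (elim e)
        then show ?case
          using S_add[OF t, of e g]
          by (simp add: St.scaleR St.diff scaleR diff add.commute divide_inverse mult.commute)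
      qed
    qed
  qed
  show ?thesis
  proof (cases "t = 0")
    case True
    with right show ?thesis
      by (simp add: has_field_derivative_iff at_within_Ici_at_right)
  next
    case False
    then have t0: "0 < t" using t by simp
    then have at: "at t within {0..} = at t"
      by (intro at_within_interior) (simp add: interior_real_atLeast)
    have left: "((\<lambda>y. (\<phi> (S y g) - \<phi> (S t g)) / (y - t)) \<longlongrightarrow> \<phi> (S t h)) (at_left t)"
    proof (subst filterlim_at_left_to_right, subst filterlim_at_right_to_0)
      have "((\<lambda>e. S (t - e) ((S e g - g) /\<^sub>R e)) \<longlongrightarrow> S t h) (at_right 0)"
      proof -
        have "((\<lambda>e. (S e g - g) /\<^sub>R e - h) \<longlongrightarrow> 0) (at_right 0)"
          using g0 by (simp add: LIM_zero_iff)
        then have lim: "((\<lambda>e. norm ((S e g - g) /\<^sub>R e - h)) \<longlongrightarrow> 0) (at_right 0)"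
          by (simp add: tendsto_norm_zero_iff)
        have "\<forall>\<^sub>F e in at_right 0. norm (S (t - e) ((S e g - g) /\<^sub>R e) - S (t - e) h) \<le> norm ((S e g - g) /\<^sub>R e - h)"
          using eventually_at_right_0_less[OF t0]
        proof eventually_elim
          case (elim e)
          interpret linear "S (t - e)" by (rule S_linear) (use elim in auto)
          show ?case
            using S_norm_le[of "t - e" "(S e g - g) /\<^sub>R e - h"] elim by (simp add: diff)
        qed
        then have "((\<lambda>e. S (t - e) ((S e g - g) /\<^sub>R e) - S (t - e) h) \<longlongrightarrow> 0) (at_right 0)"
          by (rule Lim_null_comparison[OF _ lim])
        from tendsto_add[OF this S_left_difference[OF t0, of h]] show ?thesis by simp
      qed
      then have "((\<lambda>e. \<phi> (S (t - e) ((S e g - g) /\<^sub>R e))) \<longlongrightarrow> \<phi> (S t h)) (at_right 0)"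
        by (rule tendsto)
      then show "((\<lambda>x. (\<phi> (S (- (x + - t)) g) - \<phi> (S t g)) / (- (x + - t) - t)) \<longlongrightarrow> \<phi> (S t h)) (at_right 0)"
      proof (rule Lim_transform_eventually)
        show "\<forall>\<^sub>F e in at_right 0. \<phi> (S (t - e) ((S e g - g) /\<^sub>R e))
            = (\<phi> (S (- (e + - t)) g) - \<phi> (S t g)) / (- (e + - t) - t)"
          using eventually_at_right_less[of "0::real"] eventually_at_right_0_less[OF t0]
        proof eventually_elim
          case (elim e)
          interpret Se: linear "S (t - e)" by (rule S_linear) (use elim in auto)
          have "S t g = S (t - e) (S e g)" using S_add[of "t - e" e g] elim by simp
          then show ?case
            using elim by (simp add: Se.scaleR Se.diff scaleR diff field_simps)
        qed
      qed
    qed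
    from left right show ?thesis
      unfolding at has_field_derivative_iff by (simp add: filterlim_at_split)
  qed
qed

end

context long_range_kernel
begin

text \<open>The bound on \<open>w\<close> concerns only sets with as many sites as \<open>A\<close>,
  so the estimate can be iterated within one cardinality.\<close>

lemma abs_exchange_operator_le:
  fixes M :: real
  assumes A: "finite A" and M: "0 \<le> M" "\<And>B. finite B \<Longrightarrow> card B = card A \<Longrightarrow> \<bar>w B\<bar> \<le> M"
  shows "\<bar>exchange_operator w A\<bar> \<le> 2 * card A * M"
proof -
  let ?g = "\<lambda>(x, z). s (z - x) * (w (move A x z) - w A)" and ?r = "\<lambda>(x, z). s (z - x)"
  have u: "\<bar>w (move A x z) - w A\<bar> \<le> 2 * M" if "(x, z) \<in> moves A" for x z
    using M(2)[of A] M(2)[of "move A x z"] A that by (auto simp: moves_def card_move)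
  have "\<bar>exchange_operator w A\<bar> \<le> infsum (\<lambda>e. 2 * M * ?r e) (moves A)"
    unfolding exchange_operator_def
  proof (rule norm_infsum_le[of ?g, unfolded real_norm_def])
    show "(?g has_sum infsum ?g (moves A)) (moves A)"
      by (intro has_sum_infsum rate_mult_summable[OF A u])
    show "((\<lambda>e. 2 * M * ?r e) has_sum infsum (\<lambda>e. 2 * M * ?r e) (moves A)) (moves A)"
      by (intro has_sum_infsum summable_on_cmult_right rate_summable A)
    fix e assume "e \<in> moves A"
    then show "\<bar>?g e\<bar> \<le> 2 * M * ?r e"
      using u by (cases e) (auto simp: abs_mult kernel_nonneg mult.commute[of "2 * M"] intro!: mult_left_mono)
  qed
  also have "\<dots> = 2 * M * infsum ?r (moves A)"
    by (rule infsum_cmult_right')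
  also have "\<dots> \<le> 2 * M * card A"
    using rate_summable(2)[OF A] M(1) by (intro mult_left_mono) auto
  finally show ?thesis by (simp add: mult_ac)
qed

end

section \<open>The pairing in L^2, invariance and contractivity\<close>

lemma linear_functional_bounded:
  fixes \<phi> :: "('a::topological_space \<Rightarrow>\<^sub>C real) \<Rightarrow> real"
  assumes "\<And>g h. \<phi> (g + h) = \<phi> g + \<phi> h" "\<And>a g. \<phi> (a *\<^sub>R g) = a * \<phi> g" "\<And>g. \<bar>\<phi> g\<bar> \<le> K * norm g"
  shows "bounded_linear \<phi>"
  using assms by (intro bounded_linear_intro[of \<phi> K]) (auto simp: mult.commute)

definition pairing :: "real \<Rightarrow> ('d::finite config \<Rightarrow>\<^sub>C real) \<Rightarrow> ('d config \<Rightarrow>\<^sub>C real) \<Rightarrow> real" where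
  "pairing \<rho> f g = (LINT \<eta>|bernoulli_product \<rho>. apply_bcontfun g \<eta> * apply_bcontfun f \<eta>)"

lemma bernoulli_mult_integrable:
  fixes f g :: "'d::finite config \<Rightarrow>\<^sub>C real"
  shows "integrable (bernoulli_product \<rho>) (\<lambda>\<eta>. apply_bcontfun g \<eta> * apply_bcontfun f \<eta>)"
  by (rule bcontfun_mult_integrable[OF prob_space_bernoulli_product sets_bernoulli_product])

lemma abs_pairing_le:
  fixes f g :: "'d::finite config \<Rightarrow>\<^sub>C real"
  shows "\<bar>pairing \<rho> f g\<bar> \<le> norm f * norm g"
proof -
  interpret prob_space "bernoulli_product \<rho> :: 'd config measure" by (rule prob_space_bernoulli_product)
  have "\<bar>pairing \<rho> f g\<bar> \<le> (LINT \<eta>|bernoulli_product \<rho>. \<bar>apply_bcontfun g \<eta> * apply_bcontfun f \<eta>\<bar>)"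
    unfolding pairing_def by (rule integral_abs_bound)
  also have "\<dots> \<le> (LINT \<eta>|(bernoulli_product \<rho> :: 'd config measure). norm g * norm f)"
  proof (rule Bochner_Integration.integral_mono)
    show "\<bar>apply_bcontfun g \<eta> * apply_bcontfun f \<eta>\<bar> \<le> norm g * norm f" for \<eta>
      unfolding abs_mult by (intro mult_mono abs_bcontfun_le_norm) auto
  qed (auto intro: bernoulli_mult_integrable)
  finally show ?thesis using prob_space by (simp add: mult.commute)
qed

lemma bounded_linear_pairing: "bounded_linear (pairing \<rho> f)"
proof (rule linear_functional_bounded)
  show "pairing \<rho> f (g + h) = pairing \<rho> f g + pairing \<rho> f h" for g h
    unfolding pairing_def plus_bcontfun.rep_eq distrib_right
    by (intro Bochner_Integration.integral_add bernoulli_mult_integrable)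
  show "pairing \<rho> f (a *\<^sub>R g) = a * pairing \<rho> f g" for a g
    unfolding pairing_def by (simp add: mult.assoc)
qed (rule abs_pairing_le)

lemma pairing_sum_left:
  "pairing \<rho> (\<Sum>A\<in>I. b A *\<^sub>R u A) g = (\<Sum>A\<in>I. b A * pairing \<rho> (u A) g)"
proof -
  have sym: "pairing \<rho> f g = pairing \<rho> g f" for f
    by (simp add: pairing_def mult.commute)
  interpret bounded_linear "pairing \<rho> g" by (rule bounded_linear_pairing)
  show ?thesis unfolding sym by (simp add: sum scaleR)
qed

lemma pairing_basis:
  assumes "0 < \<rho>" "\<rho> < 1" "finite A" "finite B"
  shows "pairing \<rho> (basis \<rho> A) (basis \<rho> B) = of_bool (A = B)"
  using integral_basis_mult[OF assms(1,2,4,3)] by (auto simp: pairing_def)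

lemma pairing_const_1: "pairing \<rho> (const_bcontfun 1) g = (LINT \<eta>|bernoulli_product \<rho>. apply_bcontfun g \<eta>)"
  by (simp add: pairing_def)

lemma local_function_compose2:
  assumes "local_function f" "local_function g"
  shows "local_function (\<lambda>\<eta>. u (f \<eta>) (g \<eta>))"
proof -
  obtain A B where "finite A" "\<And>\<eta> \<xi>. (\<forall>x\<in>A. \<eta> x = \<xi> x) \<Longrightarrow> f \<eta> = f \<xi>"
    "finite B" "\<And>\<eta> \<xi>. (\<forall>x\<in>B. \<eta> x = \<xi> x) \<Longrightarrow> g \<eta> = g \<xi>"
    using assms unfolding local_function_def by blast
  then show ?thesis
    unfolding local_function_def by (intro exI[of _ "A \<union> B"]) (metis UnCI finite_UnI)
qed

lemma local_function_basis_sum: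
  fixes I :: "'d::finite site set set"
  assumes "\<And>A. A \<in> I \<Longrightarrow> finite A"
  shows "local_function (apply_bcontfun (\<Sum>A\<in>I. b A *\<^sub>R basis \<rho> A))"
  using assms
proof (induction I rule: infinite_finite_induct)
  case (insert A I)
  have "local_function (\<lambda>\<eta>. b A * basis \<rho> A \<eta> + apply_bcontfun (\<Sum>A\<in>I. b A *\<^sub>R basis \<rho> A) \<eta>)"
    by (rule local_function_compose2[of "apply_bcontfun (basis \<rho> A)" _ "\<lambda>a a'. b A * a + a'"])
       (use insert in \<open>auto intro: local_function_basis\<close>)
  with insert show ?case by simp
qed (auto simp: local_function_def)

lemma countable_small_sets: "countable (small_sets N :: 'a::countable set set)"
  by (rule countable_subset[OF _ countable_Collect_finite]) (auto simp: small_sets_def)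

context exclusion_markov_semigroup
begin

lemma basis_generator:
  assumes "finite A"
  obtains h where "generator_value S (basis \<rho> A) h"
    "((\<lambda>(x, z). s (z - x) *\<^sub>R (basis \<rho> (move A x z) - basis \<rho> A)) has_sum h) (moves A)"
proof -
  obtain h where h: "generator_value S (basis \<rho> A) h"
    "apply_bcontfun h = exclusion_operator s (apply_bcontfun (basis \<rho> A))"
    using semigroup local_function_basis[OF assms, of \<rho>] unfolding exclusion_semigroup_def by blast
  then show thesis
    using generator_basis_has_sum[OF assms h(2)] that by blast
qed

lemma functional_has_sum:
  fixes \<phi> :: "_ \<Rightarrow> real"
  assumes "bounded_linear \<phi>"
    and "((\<lambda>(x, z). s (z - x) *\<^sub>R (basis \<rho> (move A x z) - basis \<rho> A)) has_sum h) (moves A)"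
  shows "\<phi> h = exchange_operator (\<lambda>B. \<phi> (basis \<rho> B)) A"
proof -
  interpret bounded_linear \<phi> by fact
  have "((\<lambda>e. \<phi> ((\<lambda>(x, z). s (z - x) *\<^sub>R (basis \<rho> (move A x z) - basis \<rho> A)) e)) has_sum \<phi> h) (moves A)"
    using has_sum_bounded_linear[OF assms] by (simp add: comp_def)
  then show ?thesis
    unfolding exchange_operator_def
    by (auto simp: scaleR diff split_def dest!: infsumI)
qed

text \<open>Self-duality in differential form: composing \<phi> with \<open>S t\<close> gives
  another bounded functional, which passes through the series for the generator at
  \<open>basis \<rho> A\<close>. The result is a closed equation on sets of cardinality
  \<open>card A\<close>.\<close>

lemma functional_basis_derivative:
  fixes \<phi> :: "_ \<Rightarrow> real"
  assumes \<phi>: "bounded_linear \<phi>" and A: "finite A" and t: "0 \<le> t"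
  shows "((\<lambda>u. \<phi> (S u (basis \<rho> A))) has_real_derivative
    exchange_operator (\<lambda>B. \<phi> (S t (basis \<rho> B))) A) (at t within {0..})"
proof -
  obtain h where h: "generator_value S (basis \<rho> A) h"
    "((\<lambda>(x, z). s (z - x) *\<^sub>R (basis \<rho> (move A x z) - basis \<rho> A)) has_sum h) (moves A)"
    by (rule basis_generator[OF A])
  have "bounded_linear (\<lambda>g. \<phi> (S t g))"
    by (rule bounded_linear_compose[OF \<phi> S_bounded_linear[OF t]])
  from functional_has_sum[OF this h(2)] S_functional_derivative[OF \<phi> h(1) t]
  show ?thesis by simp
qed

lemma bounded_linear_mean:
  "bounded_linear (\<lambda>g :: 'd config \<Rightarrow>\<^sub>C real. LINT \<eta>|bernoulli_product \<rho>. apply_bcontfun g \<eta>)"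
  using bounded_linear_pairing[of \<rho> "const_bcontfun 1"] unfolding pairing_const_1 .

text \<open>
  On the sets of cardinality \<open>n\<close> the means solve a linear differential equation with bounded
  coefficients and initial value 0. Iterating the integral equation \<open>k\<close> times bounds them by
  the general term of an exponential series.
\<close>
lemma mean_S_basis:
  assumes A: "finite A" "A \<noteq> {}" and t: "0 \<le> t"
  shows "(LINT \<eta>|bernoulli_product \<rho>. apply_bcontfun (S t (basis \<rho> A)) \<eta>) = 0"
proof -
  define m where "m = (\<lambda>t A. LINT \<eta>|bernoulli_product \<rho>. apply_bcontfun (S t (basis \<rho> A)) \<eta>)"
  define n where "n = card A"
  define K where "K = basis_bound \<rho> ^ n"
  have n: "0 < n" using A by (simp add: n_def card_gt_0_iff)
  have K: "0 \<le> K" using basis_bound_ge_1[of \<rho>] by (simp add: K_def)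
  have deriv: "((\<lambda>u. m u B) has_real_derivative exchange_operator (m t) B) (at t within {0..})"
    if "finite B" "0 \<le> t" for B t
    using functional_basis_derivative[OF bounded_linear_mean that] by (simp add: m_def)
  have m0: "m 0 B = 0" if "finite B" "card B = n" for B
    using integral_basis[of B \<rho> \<rho>] that n \<rho> by (simp add: m_def S_0)
  have bound: "\<bar>m t B\<bar> \<le> K * ((2 * real n * t) ^ k / fact k)" if "0 \<le> t" "finite B" "card B = n" for k and t :: real and B
    using that
  proof (induction k arbitrary: t B)
    case 0
    have "\<bar>m t B\<bar> \<le> norm (S t (basis \<rho> B))"
      using abs_pairing_le[of \<rho> "const_bcontfun 1" "S t (basis \<rho> B)"]
        norm_bound[of "const_bcontfun (1::real) :: 'd config \<Rightarrow>\<^sub>C real" 1]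
        mult_right_mono[of "norm (const_bcontfun (1::real) :: 'd config \<Rightarrow>\<^sub>C real)" 1 "norm (S t (basis \<rho> B))"]
      by (simp add: pairing_const_1 m_def)
    also have "norm (S t (basis \<rho> B)) \<le> norm (basis \<rho> B)"
      by (rule S_norm_le) (use 0 in simp)
    also have "norm (basis \<rho> B) \<le> K"
      using norm_basis_le[of \<rho> B] 0 by (simp add: K_def)
    finally show ?case by simp
  next
    case (Suc k)
    \<comment> \<open>\<open>?v'\<close> is the derivative of the next term of the series and also
      the bound for the exchange operator when \<open>m r\<close> obeys the k-th estimate; its
      factor 2 n comes from the total rate.\<close>
    let ?v = "\<lambda>r. K * ((2 * real n * r) ^ Suc k / fact (Suc k))"
    let ?v' = "\<lambda>r. 2 * real n * (K * ((2 * real n * r) ^ k / fact k))"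
    have v: "(?v has_real_derivative ?v' r) (at r within {0..})" for r
      by (rule derivative_eq_intros refl | simp)+
    have m': "\<bar>exchange_operator (m r) B\<bar> \<le> ?v' r" if "0 \<le> r" for r
      using abs_exchange_operator_le[of B "K * ((2 * real n * r) ^ k / fact k)" "m r"] Suc.prems(2,3) Suc.IH[OF that] K that
      by (auto simp: mult.assoc intro!: mult_nonneg_nonneg divide_nonneg_nonneg)
    have "m t B \<le> ?v t"
      by (rule derivative_le_imp_le[OF Suc.prems(1) _ deriv v])
         (use m0 Suc.prems m' in \<open>auto simp: abs_le_iff\<close>)
    moreover have "- m t B \<le> ?v t"
      by (rule derivative_le_imp_le[OF Suc.prems(1) _ DERIV_minus[OF deriv] v])
         (use m0 Suc.prems m' in \<open>auto simp: abs_le_iff\<close>)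
    ultimately show ?case by (simp add: abs_le_iff)
  qed
  have "(\<lambda>k. (2 * real n * t) ^ k / fact k) \<longlonglongrightarrow> 0"
    using summable_LIMSEQ_zero[OF summable_exp[of "2 * real n * t"]] by (simp add: field_simps)
  then have "(\<lambda>k. K * ((2 * real n * t) ^ k / fact k)) \<longlonglongrightarrow> K * 0"
    by (rule tendsto_mult_left)
  then have "\<bar>m t A\<bar> \<le> K * 0"
    by (rule LIMSEQ_le_const) (use bound[OF t A(1)] in \<open>auto simp: n_def\<close>)
  then show ?thesis by (simp add: m_def)
qed

text \<open>In the basis expansion only the constant function, over the empty set, has nonzero mean
  at density \<rho>, and the semigroup fixes constants.\<close>

lemma mean_S_local:
  assumes g: "local_function (apply_bcontfun g)" and t: "0 \<le> t"
  shows "(LINT \<eta>|bernoulli_product \<rho>. apply_bcontfun (S t g) \<eta>) = (LINT \<eta>|bernoulli_product \<rho>. apply_bcontfun g \<eta>)"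
proof -
  obtain \<Lambda> b where \<Lambda>: "finite \<Lambda>" and "apply_bcontfun g = apply_bcontfun (\<Sum>A\<in>Pow \<Lambda>. b A *\<^sub>R basis \<rho> A)"
    by (rule local_function_expansion[OF \<rho> g])
  then have g_eq: "g = (\<Sum>A\<in>Pow \<Lambda>. b A *\<^sub>R basis \<rho> A)" by (simp add: apply_bcontfun_inject)
  interpret mean: bounded_linear "\<lambda>g. LINT \<eta>|bernoulli_product \<rho>. apply_bcontfun (g :: 'd config \<Rightarrow>\<^sub>C real) \<eta>"
    by (rule bounded_linear_mean)
  interpret St: bounded_linear "S t" by (rule S_bounded_linear[OF t])
  have "(LINT \<eta>|bernoulli_product \<rho>. apply_bcontfun (S t (basis \<rho> A)) \<eta>)
      = (LINT \<eta>|bernoulli_product \<rho>. basis \<rho> A \<eta>)" if A: "finite A" for A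
  proof (cases "A = {}")
    case True
    have "basis \<rho> {} = (const_bcontfun 1 :: 'd config \<Rightarrow>\<^sub>C real)"
      by (rule bcontfun_eqI) (simp add: apply_basis)
    then show ?thesis using True S_const_1[OF t] by simp
  next
    case False
    then have "card A \<noteq> 0" using A by simp
    then show ?thesis
      using mean_S_basis[OF A False t] integral_basis[OF A, of \<rho> \<rho>] \<rho> by simp
  qed
  then show ?thesis
    unfolding g_eq St.sum St.scaleR mean.sum mean.scaleR
    using \<Lambda> by (intro sum.cong refl) (auto dest: finite_subset)
qed

text \<open>Jensen's inequality: positivity is applied to (g - l)^2, with the constant
  \<open>l\<close> frozen at the value of \<open>S t g\<close> at the given configuration, and shows
  that the square of \<open>S t g\<close> is at most \<open>S t\<close> of the square. The square of
  a local function is local, so invariance of the mean finishes the estimate.\<close>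

lemma pairing_S_power2_le:
  assumes g: "local_function (apply_bcontfun g)" and t: "0 \<le> t"
  shows "pairing \<rho> (S t g) (S t g) \<le> pairing \<rho> g g"
proof -
  have sq: "(\<lambda>\<eta>. apply_bcontfun g \<eta> * apply_bcontfun g \<eta>) \<in> bcontfun"
  proof (rule bcontfun_normI[of _ "norm g * norm g"])
    show "norm (apply_bcontfun g \<eta> * apply_bcontfun g \<eta>) \<le> norm g * norm g" for \<eta>
      unfolding norm_mult by (intro mult_mono norm_bounded) auto
  qed (intro continuous_on_mult continuous_on_apply_bcontfun)
  define q where "q = Bcontfun (\<lambda>\<eta>. apply_bcontfun g \<eta> * apply_bcontfun g \<eta>)"
  have q: "apply_bcontfun q = (\<lambda>\<eta>. apply_bcontfun g \<eta> * apply_bcontfun g \<eta>)"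
    unfolding q_def by (rule Bcontfun_inverse[OF sq])
  have q_local: "local_function (apply_bcontfun q)"
    unfolding q using local_function_compose2[OF g g] .
  interpret St: bounded_linear "S t" by (rule S_bounded_linear[OF t])
  have jensen: "apply_bcontfun (S t g) \<eta> * apply_bcontfun (S t g) \<eta> \<le> apply_bcontfun (S t q) \<eta>" for \<eta>
  proof -
    define l where "l = apply_bcontfun (S t g) \<eta>"
    have "0 \<le> apply_bcontfun (S t (q - (2 * l) *\<^sub>R g + (l * l) *\<^sub>R const_bcontfun 1)) \<eta>"
    proof (rule S_nonneg[OF t])
      fix \<xi>
      have "0 \<le> (apply_bcontfun g \<xi> - l)\<^sup>2" by simp
      then show "0 \<le> apply_bcontfun (q - (2 * l) *\<^sub>R g + (l * l) *\<^sub>R const_bcontfun 1) \<xi>"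
        by (simp add: q power2_eq_square algebra_simps)
    qed
    then show ?thesis
      by (simp add: St.add St.diff St.scaleR S_const_1[OF t] flip: l_def)
  qed
  have "pairing \<rho> (S t g) (S t g) \<le> (LINT \<eta>|bernoulli_product \<rho>. apply_bcontfun (S t q) \<eta>)"
    unfolding pairing_def
    by (intro Bochner_Integration.integral_mono bernoulli_mult_integrable jensen
        bcontfun_integrable[OF prob_space_bernoulli_product sets_bernoulli_product])
  also have "\<dots> = pairing \<rho> g g"
    by (simp add: mean_S_local[OF q_local t]) (simp add: q pairing_def)
  finally show ?thesis .
qed

text \<open>Young's inequality combined with contractivity. The weight \<open>e\<close> is kept
  free: 1 suits a fixed time, 1 / t suits integrals over a time interval of length t.\<close>

lemma pairing_S_le:
  assumes g: "local_function (apply_bcontfun g)" and t: "0 \<le> t" and e: "0 < e"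
  shows "2 * pairing \<rho> f (S t g) \<le> e * pairing \<rho> g g + pairing \<rho> f f / e"
proof -
  have "2 * pairing \<rho> f (S t g) = (LINT \<eta>|bernoulli_product \<rho>. 2 * (apply_bcontfun (S t g) \<eta> * apply_bcontfun f \<eta>))"
    by (simp add: pairing_def)
  also have "\<dots> \<le> (LINT \<eta>|bernoulli_product \<rho>. e * (apply_bcontfun (S t g) \<eta> * apply_bcontfun (S t g) \<eta>)
      + (apply_bcontfun f \<eta> * apply_bcontfun f \<eta>) / e)"
  proof (intro Bochner_Integration.integral_mono Bochner_Integration.integrable_add integrable_mult_right
      integrable_divide bernoulli_mult_integrable)
    fix \<eta>
    have "0 \<le> (e * apply_bcontfun (S t g) \<eta> - apply_bcontfun f \<eta>)\<^sup>2 / e"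
      using e by simp
    then show "2 * (apply_bcontfun (S t g) \<eta> * apply_bcontfun f \<eta>)
        \<le> e * (apply_bcontfun (S t g) \<eta> * apply_bcontfun (S t g) \<eta>)
          + (apply_bcontfun f \<eta> * apply_bcontfun f \<eta>) / e"
      using e by (simp add: power2_eq_square field_simps)
  qed
  also have "\<dots> = e * pairing \<rho> (S t g) (S t g) + pairing \<rho> f f / e"
    unfolding pairing_def
    by (subst Bochner_Integration.integral_add)
       (auto intro!: integrable_mult_right integrable_divide bernoulli_mult_integrable)
  also have "\<dots> \<le> e * pairing \<rho> g g + pairing \<rho> f f / e"
    using pairing_S_power2_le[OF g t] e by simp
  finally show ?thesis .
qed

lemma pairing_basis_sum:
  assumes "finite I" "\<And>A. A \<in> I \<Longrightarrow> finite A"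
  shows "pairing \<rho> (\<Sum>A\<in>I. b A *\<^sub>R basis \<rho> A) (\<Sum>A\<in>I. b A *\<^sub>R basis \<rho> A) = (\<Sum>A\<in>I. (b A)\<^sup>2)"
proof -
  interpret bounded_linear "pairing \<rho> (basis \<rho> A)" for A by (rule bounded_linear_pairing)
  have "pairing \<rho> (\<Sum>A\<in>I. b A *\<^sub>R basis \<rho> A) (\<Sum>A\<in>I. b A *\<^sub>R basis \<rho> A)
      = (\<Sum>A\<in>I. b A * (\<Sum>B\<in>I. b B * of_bool (A = B)))"
    using assms \<rho> by (simp add: pairing_sum_left sum scaleR pairing_basis cong: sum.cong)
  also have "\<dots> = (\<Sum>A\<in>I. (b A)\<^sup>2)"
    using assms by (simp add: power2_eq_square)
  finally show ?thesis .
qed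

end

section \<open>The energy estimate\<close>

context exclusion_markov_semigroup
begin

definition correlation :: "('d config \<Rightarrow>\<^sub>C real) \<Rightarrow> real \<Rightarrow> real" where
  "correlation f t = pairing \<rho> f (S t f)"

text \<open>On basis functions this is W_t. It is defined on all continuous functions so that it can
  also be evaluated at values of the generator.\<close>

definition integrated_pairing :: "('d config \<Rightarrow>\<^sub>C real) \<Rightarrow> real \<Rightarrow> ('d config \<Rightarrow>\<^sub>C real) \<Rightarrow> real" where
  "integrated_pairing f t g = integral {0..t} (\<lambda>r. pairing \<rho> f (S r g))"

lemma pairing_S_continuous: "continuous_on {0..t} (\<lambda>r. pairing \<rho> f (S r g))"
  by (rule continuous_on_subset[OF S_functional_continuous[OF bounded_linear_pairing]]) auto

lemma pairing_S_integrable: "(\<lambda>r. pairing \<rho> f (S r g)) integrable_on {0..t}"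
  by (rule integrable_continuous_real[OF pairing_S_continuous])

lemma bounded_linear_integrated_pairing:
  assumes t: "0 \<le> t"
  shows "bounded_linear (integrated_pairing f t)"
proof (rule linear_functional_bounded)
  interpret p: bounded_linear "pairing \<rho> f" by (rule bounded_linear_pairing)
  show "integrated_pairing f t (g + h) = integrated_pairing f t g + integrated_pairing f t h" for g h
  proof -
    have "integrated_pairing f t (g + h) = integral {0..t} (\<lambda>r. pairing \<rho> f (S r g) + pairing \<rho> f (S r h))"
      unfolding integrated_pairing_def
      by (intro integral_cong) (simp add: linear_add[OF S_linear] p.add)
    then show ?thesis
      by (simp add: integrated_pairing_def integral_add pairing_S_integrable)
  qed
  show "integrated_pairing f t (a *\<^sub>R g) = a * integrated_pairing f t g" for a g
  proof -
    have "integrated_pairing f t (a *\<^sub>R g) = integral {0..t} (\<lambda>r. a * pairing \<rho> f (S r g))"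
      unfolding integrated_pairing_def
      by (intro integral_cong) (simp add: linear_scale[OF S_linear] p.scaleR)
    then show ?thesis
      by (simp add: integrated_pairing_def)
  qed
  show "\<bar>integrated_pairing f t g\<bar> \<le> (norm f * t) * norm g" for g
  proof -
    have "norm (integral {0..t} (\<lambda>r. pairing \<rho> f (S r g))) \<le> (norm f * norm g) * (t - 0)"
    proof (rule integral_bound[OF t pairing_S_continuous])
      fix r assume "r \<in> {0..t}"
      then show "norm (pairing \<rho> f (S r g)) \<le> norm f * norm g"
        using abs_pairing_le[of \<rho> f "S r g"] S_norm_le[of r g]
          mult_left_mono[of "norm (S r g)" "norm g" "norm f"] by auto
    qed
    then show ?thesis by (simp add: integrated_pairing_def mult_ac)
  qed
qed

lemma integrated_pairing_derivative:
  assumes "t \<in> {0..T}"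
  shows "((\<lambda>t. integrated_pairing f t g) has_real_derivative pairing \<rho> f (S t g)) (at t within {0..T})"
  unfolding integrated_pairing_def
  by (rule integral_has_real_derivative[OF pairing_S_continuous assms])

text \<open>The fundamental theorem of calculus in time, with the generator value replaced by its
  series over moves.\<close>

lemma exchange_operator_integrated_pairing:
  assumes A: "finite A" and t: "0 \<le> t"
  shows "exchange_operator (\<lambda>B. integrated_pairing f t (basis \<rho> B)) A
    = pairing \<rho> f (S t (basis \<rho> A)) - pairing \<rho> f (basis \<rho> A)"
proof -
  obtain h where h: "generator_value S (basis \<rho> A) h"
    "((\<lambda>(x, z). s (z - x) *\<^sub>R (basis \<rho> (move A x z) - basis \<rho> A)) has_sum h) (moves A)"
    by (rule basis_generator[OF A])
  have "((\<lambda>r. pairing \<rho> f (S r h)) has_integral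
      pairing \<rho> f (S t (basis \<rho> A)) - pairing \<rho> f (S 0 (basis \<rho> A))) {0..t}"
  proof (rule fundamental_theorem_of_calculus[OF t])
    fix r assume "r \<in> {0..t}"
    then have "((\<lambda>u. pairing \<rho> f (S u (basis \<rho> A))) has_real_derivative pairing \<rho> f (S r h)) (at r within {0..})"
      by (intro S_functional_derivative[OF bounded_linear_pairing h(1)]) auto
    then show "((\<lambda>u. pairing \<rho> f (S u (basis \<rho> A))) has_vector_derivative pairing \<rho> f (S r h)) (at r within {0..t})"
      unfolding has_real_derivative_iff_has_vector_derivative
      by (rule has_vector_derivative_within_subset) auto
  qed
  then have "integrated_pairing f t h = pairing \<rho> f (S t (basis \<rho> A)) - pairing \<rho> f (basis \<rho> A)"
    by (simp add: integrated_pairing_def S_0 integral_unique)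
  then show ?thesis
    using functional_has_sum[OF bounded_linear_integrated_pairing[OF t] h(2)] by simp
qed

text \<open>The test function \<open>g\<close> has the pairings in question as coefficients. Then
  both the pairing of \<open>f\<close> with \<open>S t g\<close> and the squared norm of
  \<open>g\<close> equal the left-hand side, and Young's inequality with weight 1 absorbs half of
  it.\<close>

lemma sum_power2_pairing_le:
  assumes I: "finite I" "\<And>A. A \<in> I \<Longrightarrow> finite A" and t: "0 \<le> t"
  shows "(\<Sum>A\<in>I. (pairing \<rho> f (S t (basis \<rho> A)))\<^sup>2) \<le> pairing \<rho> f f"
proof -
  define g where "g = (\<Sum>A\<in>I. pairing \<rho> f (S t (basis \<rho> A)) *\<^sub>R basis \<rho> A)"
  interpret p: bounded_linear "pairing \<rho> f" by (rule bounded_linear_pairing)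
  interpret St: bounded_linear "S t" by (rule S_bounded_linear[OF t])
  have "pairing \<rho> f (S t g) = (\<Sum>A\<in>I. (pairing \<rho> f (S t (basis \<rho> A)))\<^sup>2)"
    by (simp add: g_def St.sum St.scaleR p.sum p.scaleR power2_eq_square)
  moreover have "pairing \<rho> g g = (\<Sum>A\<in>I. (pairing \<rho> f (S t (basis \<rho> A)))\<^sup>2)"
    unfolding g_def by (rule pairing_basis_sum[OF I])
  moreover have "2 * pairing \<rho> f (S t g) \<le> 1 * pairing \<rho> g g + pairing \<rho> f f / 1"
    by (rule pairing_S_le[OF _ t]) (auto simp: g_def intro: local_function_basis_sum I)
  ultimately show ?thesis by simp
qed

lemma sum_power2_integrated_pairing_le:
  assumes I: "finite I" "\<And>A. A \<in> I \<Longrightarrow> finite A" and t: "0 \<le> t"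
  shows "(\<Sum>A\<in>I. (integrated_pairing f t (basis \<rho> A))\<^sup>2) \<le> t\<^sup>2 * pairing \<rho> f f"
proof (cases "t = 0")
  case True
  then show ?thesis by (simp add: integrated_pairing_def)
next
  case False
  then have t0: "0 < t" using t by simp
  define g where "g = (\<Sum>A\<in>I. integrated_pairing f t (basis \<rho> A) *\<^sub>R basis \<rho> A)"
  interpret p: bounded_linear "integrated_pairing f t" by (rule bounded_linear_integrated_pairing[OF t])
  have 1: "integrated_pairing f t g = (\<Sum>A\<in>I. (integrated_pairing f t (basis \<rho> A))\<^sup>2)"
    by (simp add: g_def p.sum p.scaleR power2_eq_square)
  have 2: "pairing \<rho> g g = (\<Sum>A\<in>I. (integrated_pairing f t (basis \<rho> A))\<^sup>2)"
    unfolding g_def by (rule pairing_basis_sum[OF I])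
  have loc: "local_function (apply_bcontfun g)"
    unfolding g_def by (rule local_function_basis_sum[OF I(2)])
  \<comment> \<open>Young's inequality with weight 1 / t. Integrated over \<open>{0..t}\<close>, the
    constant gives half the squared norm of \<open>g\<close> plus half of t^2 times that of
    \<open>f\<close>; the first half is absorbed.\<close>
  let ?c = "(1 / t * pairing \<rho> g g + pairing \<rho> f f / (1 / t)) / 2"
  have "integrated_pairing f t g \<le> integral {0..t} (\<lambda>_. ?c)"
    unfolding integrated_pairing_def
  proof (rule integral_le[OF pairing_S_integrable integrable_const_ivl])
    fix r assume r: "r \<in> {0..t}"
    then show "pairing \<rho> f (S r g) \<le> ?c"
      using pairing_S_le[OF loc, of r "1 / t" f] t0 by simp
  qed
  also have "integral {0..t} (\<lambda>_. ?c) = (pairing \<rho> g g + t\<^sup>2 * pairing \<rho> f f) / 2"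
    using t0 by (simp add: power2_eq_square field_simps)
  finally show ?thesis using 1 2 by simp
qed

text \<open>The family is countable, so its unordered sums are limits along a sequence of finite
  sets, as dominated convergence demands.\<close>

lemma exhausting_finite_sets:
  obtains F :: "nat \<Rightarrow> 'd site set set"
  where "\<And>k. finite (F k)" "\<And>k. F k \<subseteq> small_sets N"
    "filterlim F (finite_subsets_at_top (small_sets N)) sequentially"
proof -
  let ?J = "small_sets N :: 'd site set set"
  have ne: "?J \<noteq> {}" by (auto simp: small_sets_def intro: exI[of _ "{}"])
  define F where "F k = from_nat_into ?J ` {..k}" for k
  have "\<forall>\<^sub>F k in sequentially. finite (F k) \<and> X \<subseteq> F k \<and> F k \<subseteq> ?J"
    if X: "finite X" "X \<subseteq> ?J" for X
  proof -
    have "X \<subseteq> from_nat_into ?J ` UNIV"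
      using X range_from_nat_into[OF ne countable_small_sets] by simp
    then obtain K where K: "finite K" "X = from_nat_into ?J ` K"
      using X(1) by (meson finite_subset_image)
    obtain k0 where "\<forall>k\<in>K. k \<le> k0"
      using K(1) finite_nat_set_iff_bounded_le by blast
    then have "finite (F k) \<and> X \<subseteq> F k \<and> F k \<subseteq> ?J" if "k0 \<le> k" for k
      using K(2) that ne by (auto simp: F_def intro: from_nat_into)
    then show ?thesis unfolding eventually_sequentially by blast
  qed
  then have "filterlim F (finite_subsets_at_top ?J) sequentially"
    by (simp add: filterlim_finite_subsets_at_top)
  then show thesis
    using ne by (intro that[of F]) (auto simp: F_def intro: from_nat_into)
qed

lemma integrated_correlation_linear_bound:
  fixes b :: "'d site set \<Rightarrow> real"
  assumes \<Lambda>: "finite \<Lambda>" and f: "f = (\<Sum>A\<in>Pow \<Lambda>. b A *\<^sub>R basis \<rho> A)"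
    and N: "card \<Lambda> \<le> N" and H: "H_minus_one N (\<lambda>w. \<Sum>A\<in>Pow \<Lambda>. b A * w A)"
  obtains C where "\<And>t. 0 \<le> t \<Longrightarrow> integral {0..t} (\<lambda>v. integral {0..v} (correlation f)) \<le> C * t"
proof -
  let ?J = "small_sets N :: 'd site set set"
  define u where "u t A = pairing \<rho> f (S t (basis \<rho> A))" for t A
  define W where "W t A = integrated_pairing f t (basis \<rho> A)" for t A
  define \<Phi> where "\<Phi> t = (\<Sum>A\<in>Pow \<Lambda>. b A * W t A)" for t
  define h where "h t = infsum (\<lambda>A. W t A * u t A) ?J" for t
  define Q where "Q = pairing \<rho> f f"
  have sub: "Pow \<Lambda> \<subseteq> ?J"
    using \<Lambda> N by (auto simp: small_sets_def dest: finite_subset intro: order_trans[OF card_mono])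
  have finJ: "finite A" if "A \<in> ?J" for A using that by (simp add: small_sets_def)
  have u0: "pairing \<rho> f (basis \<rho> A) = (if A \<in> Pow \<Lambda> then b A else 0)" if "finite A" for A
  proof -
    have "pairing \<rho> f (basis \<rho> A) = (\<Sum>B\<in>Pow \<Lambda>. b B * of_bool (B = A))"
      unfolding f pairing_sum_left using that \<Lambda> \<rho>
      by (intro sum.cong refl arg_cong2[where f = "(*)"] pairing_basis) (auto dest: finite_subset)
    then show ?thesis using \<Lambda> by auto
  qed
  have inner: "integral {0..t} (correlation f) = \<Phi> t" if t: "0 \<le> t" for t
  proof -
    interpret p: bounded_linear "integrated_pairing f t" by (rule bounded_linear_integrated_pairing[OF t])
    have "integral {0..t} (correlation f) = integrated_pairing f t f"
      by (simp add: correlation_def[abs_def] integrated_pairing_def)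
    also have "\<dots> = integrated_pairing f t (\<Sum>A\<in>Pow \<Lambda>. b A *\<^sub>R basis \<rho> A)"
      by (simp add: f[symmetric])
    also have "\<dots> = \<Phi> t"
      by (simp add: p.sum p.scaleR \<Phi>_def W_def)
    finally show ?thesis .
  qed
  have W2: "(\<lambda>A. (W t A)\<^sup>2) summable_on ?J" if t: "0 \<le> t" for t
  proof (rule nonneg_bdd_above_summable_on)
    show "bdd_above (sum (\<lambda>A. (W t A)\<^sup>2) ` {F. F \<subseteq> ?J \<and> finite F})"
      by (rule bdd_aboveI2[of _ _ "t\<^sup>2 * Q"])
         (use sum_power2_integrated_pairing_le[OF _ _ t] finJ in \<open>auto simp: W_def Q_def\<close>)
  qed simp
  have eq: "exchange_operator (W t) A = u t A - (if A \<in> Pow \<Lambda> then b A else 0)"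
    if "A \<in> ?J" "0 \<le> t" for A t
    using exchange_operator_integrated_pairing[OF finJ that(2), of A f] that u0[OF finJ, of A]
    by (simp add: W_def[abs_def] u_def)
  have sm_h: "(\<lambda>A. W t A * u t A) summable_on ?J"
    and h_eq: "h t = \<Phi> t - dirichlet N (W t) / 2" if t: "0 \<le> t" for t
  proof -
    let ?b = "\<lambda>A. W t A * (if A \<in> Pow \<Lambda> then b A else 0)"
    have b_sum: "(?b has_sum \<Phi> t) ?J"
    proof (rule has_sum_finite_neutralI)
      show "\<Phi> t = sum ?b (Pow \<Lambda>)" by (simp add: \<Phi>_def mult.commute)
    qed (use \<Lambda> sub in auto)
    have ex: "((\<lambda>A. W t A * exchange_operator (W t) A) has_sum - dirichlet N (W t) / 2) ?J"
      using infsum_exchange_operator[OF W2[OF t]] by (simp add: has_sum_iff)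
    have "((\<lambda>A. W t A * exchange_operator (W t) A + ?b A) has_sum (- dirichlet N (W t) / 2 + \<Phi> t)) ?J"
      by (rule has_sum_add[OF ex b_sum])
    then have "((\<lambda>A. W t A * u t A) has_sum (- dirichlet N (W t) / 2 + \<Phi> t)) ?J"
      by (rule has_sum_cong[THEN iffD1, rotated]) (simp add: eq[OF _ t] algebra_simps)
    then show "(\<lambda>A. W t A * u t A) summable_on ?J" "h t = \<Phi> t - dirichlet N (W t) / 2"
      by (simp_all add: has_sum_iff h_def)
  qed
  obtain C where C: "0 \<le> C" "\<And>w. (\<lambda>A. (w A)\<^sup>2) summable_on ?J \<Longrightarrow>
      (\<Sum>A\<in>Pow \<Lambda>. b A * w A)\<^sup>2 \<le> C * dirichlet N w"
    using H unfolding H_minus_one_def by blast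
  have \<Phi>_le: "\<Phi> t \<le> 2 * C - h t" if t: "0 \<le> t" for t
  proof -
    let ?D = "dirichlet N (W t)"
    have D: "0 \<le> ?D" by (rule dirichlet_nonneg)
    have sq: "(\<Phi> t)\<^sup>2 \<le> C * ?D"
      unfolding \<Phi>_def by (rule C(2)[OF W2[OF t]])
    \<comment> \<open>The weights are chosen so that the energy cancels: \<open>h_eq\<close>
      expresses half the energy as \<open>\<Phi> t - h t\<close>, and inserting this into C + D / 4
      gives the bound 2 C - \<open>h t\<close>.\<close>
    have "\<Phi> t \<le> C + ?D / 4"
    proof (rule power2_le_imp_le)
      have "0 \<le> (C - ?D / 4)\<^sup>2" by simp
      then have "C * ?D \<le> (C + ?D / 4)\<^sup>2" by (simp add: power2_eq_square algebra_simps)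
      with sq show "(\<Phi> t)\<^sup>2 \<le> (C + ?D / 4)\<^sup>2" by linarith
    qed (use C D in simp)
    then show ?thesis using h_eq[OF t] by linarith
  qed
  have W_deriv: "((\<lambda>t. W t A) has_real_derivative u t A) (at t within {0..T})" if "t \<in> {0..T}" for t A T
    using integrated_pairing_derivative[OF that] by (simp add: W_def u_def)
  have W_cont: "continuous_on {0..T} (\<lambda>t. W t A)" for A T
    by (rule DERIV_continuous_on[OF W_deriv])
  have u_cont: "continuous_on {0..T} (\<lambda>t. u t A)" for A T
    unfolding u_def by (rule pairing_S_continuous)
  obtain F where F: "\<And>k. finite (F k)" "\<And>k. F k \<subseteq> ?J" "filterlim F (finite_subsets_at_top ?J) sequentially"
    using exhausting_finite_sets[of N] by blast
  \<comment> \<open>The function u_t is the time derivative of W_t and W_0 = 0, so a finite part of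
    \<open>h\<close> integrates to half a sum of squares. This sign passes to the limit by dominated
    convergence; the square sum bounds supply the dominating constant.\<close>
  have h_int: "h integrable_on {0..T} \<and> 0 \<le> integral {0..T} h" if T: "0 \<le> T" for T
  proof -
    let ?g = "\<lambda>k t. \<Sum>A\<in>F k. W t A * u t A"
    have int: "((\<lambda>t. ?g k t) has_integral (\<Sum>A\<in>F k. (W T A)\<^sup>2 / 2)) {0..T}" for k
    proof (rule has_integral_sum[OF F(1)])
      fix A
      have "((\<lambda>t. W t A * u t A) has_integral ((W T A)\<^sup>2 / 2 - (W 0 A)\<^sup>2 / 2)) {0..T}"
      proof (rule fundamental_theorem_of_calculus[OF T])
        fix t assume t: "t \<in> {0..T}"
        have "((\<lambda>t. (W t A)\<^sup>2 / 2) has_real_derivative W t A * u t A) (at t within {0..T})"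
          using W_deriv[OF t, of A] by (auto intro!: derivative_eq_intros)
        then show "((\<lambda>t. (W t A)\<^sup>2 / 2) has_vector_derivative W t A * u t A) (at t within {0..T})"
          by (simp add: has_real_derivative_iff_has_vector_derivative)
      qed
      then show "((\<lambda>t. W t A * u t A) has_integral (W T A)\<^sup>2 / 2) {0..T}"
        by (simp add: W_def[of 0] integrated_pairing_def)
    qed
    have lim: "(\<lambda>k. ?g k t) \<longlonglongrightarrow> h t" if "t \<in> {0..T}" for t
      using filterlim_compose[OF _ F(3), of "sum (\<lambda>A. W t A * u t A)" "nhds (h t)"]
        has_sum_infsum[OF sm_h, of t] that by (simp add: has_sum_def h_def)
    have bound: "norm (?g k t) \<le> (T\<^sup>2 + 1) * Q" if t: "t \<in> {0..T}" for k t
    proof -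
      have "\<bar>?g k t\<bar> \<le> (\<Sum>A\<in>F k. \<bar>W t A * u t A\<bar>)" by (rule sum_abs)
      also have "\<dots> \<le> (\<Sum>A\<in>F k. (W t A)\<^sup>2 + (u t A)\<^sup>2)"
      proof (rule sum_mono)
        fix A
        have "2 * \<bar>W t A\<bar> * \<bar>u t A\<bar> \<le> (W t A)\<^sup>2 + (u t A)\<^sup>2"
          using sum_squares_bound[of "\<bar>W t A\<bar>" "\<bar>u t A\<bar>"] by simp
        moreover have "0 \<le> \<bar>W t A\<bar> * \<bar>u t A\<bar>" by simp
        ultimately show "\<bar>W t A * u t A\<bar> \<le> (W t A)\<^sup>2 + (u t A)\<^sup>2"
          unfolding abs_mult by linarith
      qed
      also have "\<dots> = (\<Sum>A\<in>F k. (W t A)\<^sup>2) + (\<Sum>A\<in>F k. (u t A)\<^sup>2)" by (rule sum.distrib)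
      also have "\<dots> \<le> t\<^sup>2 * Q + Q"
        unfolding W_def u_def Q_def using t F finJ
        by (intro add_mono sum_power2_integrated_pairing_le sum_power2_pairing_le) auto
      also have "\<dots> \<le> T\<^sup>2 * Q + Q"
        using t by (intro add_right_mono mult_right_mono power_mono) (auto simp: Q_def pairing_def)
      finally show ?thesis by (simp add: algebra_simps)
    qed
    have gi: "(\<lambda>t. ?g k t) integrable_on {0..T}" for k
      using int[of k] by (auto simp: integrable_on_def)
    have "h integrable_on {0..T}" "(\<lambda>k. integral {0..T} (?g k)) \<longlonglongrightarrow> integral {0..T} h"
      by (rule dominated_convergence[OF gi integrable_const_ivl bound lim], assumption+)+
    moreover have "0 \<le> integral {0..T} (?g k)" for k
      using integral_unique[OF int[of k]] by (simp add: sum_nonneg)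
    ultimately show ?thesis
      by (auto intro: LIMSEQ_le_const)
  qed
  have "integral {0..t} (\<lambda>v. integral {0..v} (correlation f)) \<le> 2 * C * t" if t: "0 \<le> t" for t
  proof -
    have "integral {0..t} (\<lambda>v. integral {0..v} (correlation f)) = integral {0..t} \<Phi>"
      by (intro integral_cong) (simp add: inner)
    also have "\<dots> \<le> integral {0..t} (\<lambda>v. 2 * C - h v)"
    proof (rule integral_le)
      show "\<Phi> integrable_on {0..t}"
        unfolding \<Phi>_def[abs_def]
        by (intro integrable_continuous_real continuous_intros W_cont)
      show "(\<lambda>v. 2 * C - h v) integrable_on {0..t}"
        using h_int[OF t] by (intro integrable_diff integrable_const_ivl) auto
    qed (simp add: \<Phi>_le)
    also have "\<dots> = 2 * C * t - integral {0..t} h"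
      using h_int[OF t] t by (subst integral_diff) (auto intro: integrable_const_ivl)
    finally show ?thesis using h_int[OF t] by linarith
  qed
  then show thesis by (rule that)
qed

end

section \<open>Second moments of additive functionals\<close>

lemma integral_reverse:
  fixes g :: "real \<Rightarrow> real"
  assumes "0 \<le> u" and g: "continuous_on {0..u} g"
  shows "integral {0..u} (\<lambda>v. g (u - v)) = integral {0..u} g"
proof -
  let ?G = "\<lambda>v. integral {0..v} g"
  have "((\<lambda>v. g (u - v)) has_integral (- ?G (u - u)) - (- ?G (u - 0))) {0..u}"
  proof (rule fundamental_theorem_of_calculus[OF assms(1)])
    fix v assume v: "v \<in> {0..u}"
    have "(?G has_real_derivative g (u - v)) (at (u - v) within {0..u})"
      by (rule integral_has_real_derivative[OF g]) (use v in auto)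
    then have "(?G has_real_derivative g (u - v)) (at (u - v) within (\<lambda>v. u - v) ` {0..u})"
      by (rule DERIV_subset) auto
    moreover have "((\<lambda>v. u - v) has_real_derivative - 1) (at v within {0..u})"
      by (auto intro!: derivative_eq_intros)
    ultimately have "((?G \<circ> (\<lambda>v. u - v)) has_real_derivative g (u - v) * - 1) (at v within {0..u})"
      by (rule DERIV_image_chain)
    from DERIV_minus[OF this]
    show "((\<lambda>v. - ?G (u - v)) has_vector_derivative g (u - v)) (at v within {0..u})"
      by (simp add: has_real_derivative_iff_has_vector_derivative comp_def)
  qed
  then show ?thesis by (simp add: integral_unique)
qed

lemma integral_shift_origin:
  fixes g :: "real \<Rightarrow> real"
  assumes "u \<le> t" and g: "continuous_on {0..t - u} g"
  shows "integral {u..t} (\<lambda>v. g (v - u)) = integral {0..t - u} g"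
proof -
  let ?G = "\<lambda>v. integral {0..v} g"
  have "((\<lambda>v. g (v - u)) has_integral ?G (t - u) - ?G (u - u)) {u..t}"
  proof (rule fundamental_theorem_of_calculus[OF assms(1)])
    fix v assume v: "v \<in> {u..t}"
    have "(?G has_real_derivative g (v - u)) (at (v - u) within {0..t - u})"
      by (rule integral_has_real_derivative[OF g]) (use v in auto)
    then have "(?G has_real_derivative g (v - u)) (at (v - u) within (\<lambda>v. v - u) ` {u..t})"
      by (rule DERIV_subset) auto
    moreover have "((\<lambda>v. v - u) has_real_derivative 1) (at v within {u..t})"
      by (auto intro!: derivative_eq_intros)
    ultimately have "((?G \<circ> (\<lambda>v. v - u)) has_real_derivative g (v - u) * 1) (at v within {u..t})"
      by (rule DERIV_image_chain)
    then show "((\<lambda>v. ?G (v - u)) has_vector_derivative g (v - u)) (at v within {u..t})"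
      by (simp add: has_real_derivative_iff_has_vector_derivative comp_def)
  qed
  then show ?thesis by (simp add: integral_unique)
qed

text \<open>Splitting the inner integral at u gives G(u) + G(t - u), where G is the primitive of
  \<open>g\<close> vanishing at 0; by reflection both terms have the same outer integral.\<close>

lemma integral_abs_difference_kernel:
  fixes g :: "real \<Rightarrow> real"
  assumes t: "0 \<le> t" and g: "\<And>T. continuous_on {0..T} g"
  shows "integral {0..t} (\<lambda>u. integral {0..t} (\<lambda>v. g \<bar>u - v\<bar>))
    = 2 * integral {0..t} (\<lambda>v. integral {0..v} g)"
proof -
  let ?G = "\<lambda>v. integral {0..v} g"
  have cont_G: "continuous_on {0..t} ?G"
    by (rule DERIV_continuous_on[OF integral_has_real_derivative[OF g]])
  have inner: "integral {0..t} (\<lambda>v. g \<bar>u - v\<bar>) = ?G u + ?G (t - u)" if u: "u \<in> {0..t}" for u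
  proof -
    have int: "(\<lambda>v. g \<bar>u - v\<bar>) integrable_on {0..t}"
      by (intro integrable_continuous_real continuous_on_compose2[OF g[of t]] continuous_intros)
         (use u in auto)
    have "integral {0..t} (\<lambda>v. g \<bar>u - v\<bar>) = integral {0..u} (\<lambda>v. g \<bar>u - v\<bar>) + integral {u..t} (\<lambda>v. g \<bar>u - v\<bar>)"
      using Henstock_Kurzweil_Integration.integral_combine[OF _ _ int, of u] u by simp
    also have "integral {0..u} (\<lambda>v. g \<bar>u - v\<bar>) = integral {0..u} (\<lambda>v. g (u - v))"
      by (intro integral_cong) simp
    also have "\<dots> = ?G u"
      using u by (intro integral_reverse g) auto
    also have "integral {u..t} (\<lambda>v. g \<bar>u - v\<bar>) = integral {u..t} (\<lambda>v. g (v - u))"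
      by (intro integral_cong) simp
    also have "\<dots> = ?G (t - u)"
      using u by (intro integral_shift_origin g) auto
    finally show ?thesis .
  qed
  have "integral {0..t} (\<lambda>u. integral {0..t} (\<lambda>v. g \<bar>u - v\<bar>)) = integral {0..t} (\<lambda>u. ?G u + ?G (t - u))"
    by (intro integral_cong inner)
  also have "\<dots> = integral {0..t} ?G + integral {0..t} (\<lambda>u. ?G (t - u))"
  proof (rule integral_add)
    show "?G integrable_on {0..t}" by (rule integrable_continuous_real[OF cont_G])
    show "(\<lambda>u. ?G (t - u)) integrable_on {0..t}"
      by (intro integrable_continuous_real continuous_on_compose2[OF cont_G] continuous_intros) auto
  qed
  also have "integral {0..t} (\<lambda>u. ?G (t - u)) = integral {0..t} ?G"
    by (rule integral_reverse[OF t cont_G])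
  finally show ?thesis by simp
qed

text \<open>A finite combination of basis functions is continuous. The density 1/2 is an arbitrary
  choice, made only to have a basis.\<close>

lemma local_function_bcontfun:
  fixes f :: "'d::finite config \<Rightarrow> real"
  assumes "local_function f"
  obtains g where "f = apply_bcontfun g"
proof -
  obtain \<Lambda> b where "finite \<Lambda>" "f = apply_bcontfun (\<Sum>A\<in>Pow \<Lambda>. b A *\<^sub>R basis (1/2) A)"
    by (rule local_function_expansion[OF _ _ assms, of "1/2"]) auto
  then show thesis by (intro that)
qed

text \<open>
  Approximation of the time \<open>u\<close> from the right by points of a countable grid: this makes
  right-continuous processes jointly measurable.
\<close>
lemma right_continuous_jointly_measurable:
  fixes Y :: "real \<Rightarrow> 'w \<Rightarrow> real"
  assumes Y: "\<And>u. 0 \<le> u \<Longrightarrow> Y u \<in> borel_measurable M"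
    and rc: "\<And>u \<omega>. 0 \<le> u \<Longrightarrow> \<omega> \<in> space M \<Longrightarrow> continuous (at_right u) (\<lambda>u. Y u \<omega>)"
  shows "(\<lambda>(u, \<omega>). Y u \<omega>) \<in> borel_measurable (restrict_space lborel {0..t} \<Otimes>\<^sub>M M)"
proof -
  let ?L = "restrict_space lborel {0..t :: real}"
  \<comment> \<open>The next grid point to the right of \<open>u\<close>. Adding 1 to the floor
    makes it strictly larger than \<open>u\<close>, as convergence along \<open>at_right u\<close>
    demands.\<close>
  define p where "p j u = (real (nat \<lfloor>real (Suc j) * u\<rfloor>) + 1) / real (Suc j)" for j u
  have p_gt: "u < p j u" and p_le: "p j u \<le> u + 1 / real (Suc j)" if "0 \<le> u" for j u
  proof -
    have "real (nat \<lfloor>real (Suc j) * u\<rfloor>) = of_int \<lfloor>real (Suc j) * u\<rfloor>"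
      using that by (simp add: of_nat_nat)
    moreover have "real (Suc j) * u < of_int \<lfloor>real (Suc j) * u\<rfloor> + 1" "of_int \<lfloor>real (Suc j) * u\<rfloor> \<le> real (Suc j) * u"
      by linarith+
    ultimately show "u < p j u" "p j u \<le> u + 1 / real (Suc j)"
      unfolding p_def by (simp_all add: field_simps del: of_nat_Suc)
  qed
  have p_lim: "filterlim (\<lambda>j. p j u) (at_right u) sequentially" if u: "0 \<le> u" for u
  proof -
    have "(\<lambda>j. u + 1 / real (Suc j)) \<longlonglongrightarrow> u + 0"
      by (intro tendsto_intros LIMSEQ_Suc[OF lim_1_over_n])
    then have "(\<lambda>j. p j u) \<longlonglongrightarrow> u"
      by (intro tendsto_sandwich[of "\<lambda>_. u" "\<lambda>j. p j u" _ "\<lambda>j. u + 1 / real (Suc j)"])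
         (use p_gt[OF u] p_le[OF u] in \<open>auto intro!: always_eventually less_imp_le\<close>)
    then show ?thesis
      using p_gt[OF u] by (auto simp: filterlim_at less_imp_neq[THEN not_sym])
  qed
  show ?thesis
  proof (rule borel_measurable_LIMSEQ_real[where u = "\<lambda>j x. Y (p j (fst x)) (snd x)"])
    fix j
    have "(\<lambda>x. (\<lambda>k x. Y ((real k + 1) / real (Suc j)) (snd x)) (nat \<lfloor>real (Suc j) * fst x\<rfloor>) x)
        \<in> borel_measurable (?L \<Otimes>\<^sub>M M)"
    proof (rule measurable_compose_countable[where g = "\<lambda>x. nat \<lfloor>real (Suc j) * fst x\<rfloor>"
          and f = "\<lambda>k x. Y ((real k + 1) / real (Suc j)) (snd x)"])
      show "(\<lambda>x. Y ((real k + 1) / real (Suc j)) (snd x)) \<in> borel_measurable (?L \<Otimes>\<^sub>M M)" for k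
        by (rule measurable_compose[OF measurable_snd Y]) simp
      have "(\<lambda>u. nat \<lfloor>real (Suc j) * u\<rfloor>) \<in> measurable ?L (count_space UNIV)"
        by (intro measurable_restrict_space1) measurable
      then show "(\<lambda>x. nat \<lfloor>real (Suc j) * fst x\<rfloor>) \<in> measurable (?L \<Otimes>\<^sub>M M) (count_space UNIV)"
        by (rule measurable_compose[OF measurable_fst])
    qed
    then show "(\<lambda>x. Y (p j (fst x)) (snd x)) \<in> borel_measurable (?L \<Otimes>\<^sub>M M)"
      by (simp add: p_def)
  next
    fix x assume "x \<in> space (?L \<Otimes>\<^sub>M M)"
    then have x: "0 \<le> fst x" "snd x \<in> space M"
      by (auto simp: space_pair_measure space_restrict_space)
    have "((\<lambda>u. Y u (snd x)) \<longlongrightarrow> Y (fst x) (snd x)) (at_right (fst x))"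
      using rc[OF x] by (simp add: continuous_within)
    from filterlim_compose[OF this p_lim[OF x(1)]]
    show "(\<lambda>j. Y (p j (fst x)) (snd x)) \<longlonglongrightarrow> (case x of (u, \<omega>) \<Rightarrow> Y u \<omega>)"
      by (simp add: split_def)
  qed
qed

text \<open>Fubini is applied twice. One copy of the time integral is kept as the bounded random
  factor \<Gamma> while the other is exchanged with the expectation; then \<Gamma> is expanded in
  the same way.\<close>

lemma second_moment_time_integral:
  fixes Y :: "real \<Rightarrow> 'w \<Rightarrow> real"
  assumes "prob_space M"
    and Y: "\<And>u. 0 \<le> u \<Longrightarrow> Y u \<in> borel_measurable M"
    and rc: "\<And>u \<omega>. 0 \<le> u \<Longrightarrow> \<omega> \<in> space M \<Longrightarrow> continuous (at_right u) (\<lambda>u. Y u \<omega>)"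
    and B: "\<And>u \<omega>. \<bar>Y u \<omega>\<bar> \<le> B"
  shows "(LINT \<omega>|M. (LINT u:{0..t}|lborel. Y u \<omega>)\<^sup>2)
    = (LINT u:{0..t}|lborel. (LINT v:{0..t}|lborel. (LINT \<omega>|M. Y u \<omega> * Y v \<omega>)))"
proof -
  interpret M: prob_space M by fact
  let ?L = "restrict_space lborel {0..t :: real}"
  have fin: "finite_measure ?L"
    by (intro finite_measureI) (simp add: emeasure_restrict_space space_restrict_space emeasure_lborel_Icc_eq)
  interpret L: finite_measure ?L by fact
  interpret P: pair_sigma_finite ?L M ..
  interpret P': finite_measure "?L \<Otimes>\<^sub>M M"
    by (rule finite_measure_pair_measure) unfold_locales
  have L: "(LINT u:{0..t}|lborel. g u) = (LINT u|?L. g u)" for g :: "real \<Rightarrow> real"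
    by (simp add: set_lebesgue_integral_def integral_restrict_space)
  have B0: "0 \<le> B" using B[of 0 undefined] by linarith
  have joint [measurable]: "(\<lambda>(u, \<omega>). Y u \<omega>) \<in> borel_measurable (?L \<Otimes>\<^sub>M M)"
    by (rule right_continuous_jointly_measurable[OF Y rc])
  define \<Gamma> where "\<Gamma> \<omega> = (LINT u|?L. Y u \<omega>)" for \<omega>
  have meas_swap: "(\<lambda>(\<omega>, u). Y u \<omega>) \<in> borel_measurable (M \<Otimes>\<^sub>M ?L)"
    using measurable_compose[OF measurable_pair_swap' joint] by (simp add: split_def)
  have \<Gamma>_meas [measurable]: "\<Gamma> \<in> borel_measurable M"
    unfolding \<Gamma>_def by (rule L.borel_measurable_lebesgue_integral[OF meas_swap])
  have sec: "(\<lambda>u. Y u \<omega>) \<in> borel_measurable ?L" if "\<omega> \<in> space M" for \<omega>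
    using measurable_compose[OF measurable_Pair2'[OF that] joint] by simp
  have \<Gamma>_bound: "\<bar>\<Gamma> \<omega>\<bar> \<le> B * measure ?L (space ?L)" if "\<omega> \<in> space M" for \<omega>
  proof -
    have [measurable]: "(\<lambda>u. Y u \<omega>) \<in> borel_measurable ?L"
      by (rule sec[OF that])
    have "\<bar>\<Gamma> \<omega>\<bar> \<le> (LINT u|?L. \<bar>Y u \<omega>\<bar>)" unfolding \<Gamma>_def by (rule integral_abs_bound)
    also have "\<dots> \<le> (LINT u|?L. B)"
      by (rule Bochner_Integration.integral_mono)
         (auto intro!: L.integrable_const_bound[of _ B] B)
    finally show ?thesis by (simp add: mult.commute)
  qed
  have int1: "integrable (?L \<Otimes>\<^sub>M M) (\<lambda>(u, \<omega>). Y u \<omega> * \<Gamma> \<omega>)"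
  proof (rule P'.integrable_const_bound[of _ "B * (B * measure ?L (space ?L))"])
    show "AE x in ?L \<Otimes>\<^sub>M M. norm (case x of (u, \<omega>) \<Rightarrow> Y u \<omega> * \<Gamma> \<omega>) \<le> B * (B * measure ?L (space ?L))"
      using B B0 \<Gamma>_bound by (intro AE_I2) (auto simp: abs_mult space_pair_measure intro!: mult_mono)
  qed measurable
  have "(LINT \<omega>|M. (\<Gamma> \<omega>)\<^sup>2) = (LINT \<omega>|M. (LINT u|?L. Y u \<omega> * \<Gamma> \<omega>))"
    by (simp add: \<Gamma>_def power2_eq_square)
  also have "\<dots> = (LINT u|?L. (LINT \<omega>|M. Y u \<omega> * \<Gamma> \<omega>))"
    by (rule P.Fubini_integral[OF int1])
  also have "\<dots> = (LINT u|?L. (LINT v|?L. (LINT \<omega>|M. Y u \<omega> * Y v \<omega>)))"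
  proof (rule Bochner_Integration.integral_cong[OF refl])
    fix u assume "u \<in> space ?L"
    then have u: "0 \<le> u" by (auto simp: space_restrict_space)
    have [measurable]: "Y u \<in> borel_measurable M" by (rule Y[OF u])
    have "integrable (?L \<Otimes>\<^sub>M M) (\<lambda>(v, \<omega>). Y u \<omega> * Y v \<omega>)"
    proof (rule P'.integrable_const_bound[of _ "B * B"])
      show "AE x in ?L \<Otimes>\<^sub>M M. norm (case x of (v, \<omega>) \<Rightarrow> Y u \<omega> * Y v \<omega>) \<le> B * B"
        using B B0 by (intro AE_I2) (auto simp: abs_mult intro!: mult_mono)
    qed measurable
    from P.Fubini_integral[OF this]
    show "(LINT \<omega>|M. Y u \<omega> * \<Gamma> \<omega>) = (LINT v|?L. (LINT \<omega>|M. Y u \<omega> * Y v \<omega>))"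
      by (simp add: \<Gamma>_def)
  qed
  finally show ?thesis by (simp add: L \<Gamma>_def)
qed

section \<open>Markov property and stationarity\<close>

lemma subalgebra_past:
  assumes "\<And>u. 0 \<le> u \<Longrightarrow> X u \<in> measurable M config_space"
  shows "subalgebra M (past M X t)"
proof -
  have gen: "{X u -` A \<inter> space M | u A. 0 \<le> u \<and> u \<le> t \<and> A \<in> sets config_space} \<subseteq> sets M"
    using assms by (auto intro: measurable_sets)
  then have "sigma_sets (space M) {X u -` A \<inter> space M | u A. 0 \<le> u \<and> u \<le> t \<and> A \<in> sets config_space} \<subseteq> sets M"
    by (rule sets.sigma_sets_subset)
  moreover have "{X u -` A \<inter> space M | u A. 0 \<le> u \<and> u \<le> t \<and> A \<in> sets config_space} \<subseteq> Pow (space M)"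
    by auto
  ultimately show ?thesis
    unfolding subalgebra_def past_def by (simp add: space_measure_of sets_measure_of)
qed

lemma measurable_past:
  assumes "0 \<le> t"
  shows "X t \<in> measurable (past M X t) (config_space :: 'd::finite config measure)"
proof (rule measurableI)
  fix A :: "'d config set" assume A: "A \<in> sets config_space"
  have "X t -` A \<inter> space M \<in> sets (past M X t)"
    unfolding past_def using assms A
    by (subst sets_measure_of) (auto intro!: sigma_sets.Basic)
  then show "X t -` A \<inter> space (past M X t) \<in> sets (past M X t)"
    by (simp add: past_def space_measure_of_conv)
qed simp

context exclusion_markov_semigroup
begin

text \<open>The factor at time \<open>t\<close> is measurable with respect to the past, so the
  factor at time \<open>t + u\<close> may be replaced by its conditional expectation.\<close>

lemma markov_two_times:
  assumes "prob_space M" and mk: "markov_with M X S" and t: "0 \<le> t" and u: "0 \<le> u"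
  shows "(LINT \<omega>|M. apply_bcontfun f (X t \<omega>) * apply_bcontfun g (X (t + u) \<omega>))
    = (LINT \<omega>|M. apply_bcontfun f (X t \<omega>) * apply_bcontfun (S u g) (X t \<omega>))"
proof -
  interpret M: prob_space M by fact
  have X: "X r \<in> measurable M config_space" if "0 \<le> r" for r
    using mk that by (simp add: markov_with_def)
  have [measurable]: "X t \<in> measurable M config_space" "X (t + u) \<in> measurable M config_space"
    using X t u by auto
  interpret F: finite_measure_subalgebra M "past M X t"
    by unfold_locales (rule subalgebra_past[OF X])
  have fm: "(\<lambda>\<omega>. apply_bcontfun f (X t \<omega>)) \<in> borel_measurable (past M X t)"
    by (rule measurable_compose[OF measurable_past[OF t] bcontfun_measurable_config])
  have int: "integrable M (\<lambda>\<omega>. apply_bcontfun f (X t \<omega>) * apply_bcontfun g (X (t + u) \<omega>))"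
    by (rule integrable_bounded_measurable[OF assms(1), of _ "norm f * norm g"])
       (auto simp: abs_mult intro!: mult_mono abs_bcontfun_le_norm)
  have "(LINT \<omega>|M. apply_bcontfun f (X t \<omega>) * apply_bcontfun g (X (t + u) \<omega>))
     = (LINT \<omega>|M. apply_bcontfun f (X t \<omega>) *
          real_cond_exp M (past M X t) (\<lambda>\<omega>. apply_bcontfun g (X (t + u) \<omega>)) \<omega>)"
    by (rule F.real_cond_exp_intg(2)[OF int fm, symmetric]) measurable
  also have "\<dots> = (LINT \<omega>|M. apply_bcontfun f (X t \<omega>) * apply_bcontfun (S u g) (X t \<omega>))"
  proof (rule integral_cong_AE)
    have "AE \<omega> in M. real_cond_exp M (past M X t) (\<lambda>\<omega>. apply_bcontfun g (X (t + u) \<omega>)) \<omega>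
        = apply_bcontfun (S u g) (X t \<omega>)"
      using mk t u unfolding markov_with_def by blast
    then show "AE \<omega> in M. apply_bcontfun f (X t \<omega>) *
          real_cond_exp M (past M X t) (\<lambda>\<omega>. apply_bcontfun g (X (t + u) \<omega>)) \<omega>
        = apply_bcontfun f (X t \<omega>) * apply_bcontfun (S u g) (X t \<omega>)"
      by eventually_elim simp
  qed measurable
  finally show ?thesis .
qed

text \<open>A law on configurations is determined by cylinder sets. Their indicators are local,
  hence continuous, so invariance of the means of local functions is enough.\<close>

lemma stationary_law:
  assumes M: "prob_space M" and mk: "markov_with M X S"
    and init: "distr M config_space (X 0) = bernoulli_product \<rho>" and t: "0 \<le> t"
  shows "distr M config_space (X t) = bernoulli_product \<rho>"
proof -
  interpret M: prob_space M by fact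
  interpret B: prob_space "bernoulli_product \<rho> :: 'd config measure" by (rule prob_space_bernoulli_product)
  have X: "X r \<in> measurable M config_space" if "0 \<le> r" for r
    using mk that by (simp add: markov_with_def)
  interpret D: prob_space "distr M config_space (X t)"
    by (rule M.prob_space_distr[OF X[OF t]])
  have mean: "(LINT \<eta>|distr M config_space (X t). apply_bcontfun g \<eta>)
      = (LINT \<eta>|bernoulli_product \<rho>. apply_bcontfun g \<eta>)" if "local_function (apply_bcontfun g)" for g
  proof -
    have "(LINT \<eta>|distr M config_space (X t). apply_bcontfun g \<eta>) = (LINT \<omega>|M. apply_bcontfun g (X t \<omega>))"
      by (rule integral_distr[OF X[OF t] bcontfun_measurable_config])
    also have "\<dots> = (LINT \<omega>|M. apply_bcontfun (S t g) (X 0 \<omega>))"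
      using markov_two_times[OF M mk, of 0 t "const_bcontfun 1" g] t by simp
    also have "\<dots> = (LINT \<eta>|distr M config_space (X 0). apply_bcontfun (S t g) \<eta>)"
      by (rule integral_distr[OF X bcontfun_measurable_config, symmetric]) simp
    also have "\<dots> = (LINT \<eta>|bernoulli_product \<rho>. apply_bcontfun g \<eta>)"
      unfolding init by (rule mean_S_local[OF that t])
    finally show ?thesis .
  qed
  show ?thesis
  proof (rule measure_eqI_PiM_infinite[where I = UNIV and M = "\<lambda>_. count_space UNIV"])
    show "sets (distr M config_space (X t)) = sets (PiM UNIV (\<lambda>_. count_space UNIV))"
      by (simp add: config_space_def)
    show "sets (bernoulli_product \<rho>) = sets (PiM UNIV (\<lambda>_. count_space UNIV))"
      by (simp add: sets_bernoulli_product config_space_def)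
    show "finite_measure (distr M config_space (X t))" by (rule D.finite_measure_axioms)
    fix A :: "'d site \<Rightarrow> bool set" and J :: "'d site set"
    assume J: "finite J"
    let ?C = "prod_emb UNIV (\<lambda>_. count_space UNIV) J (Pi\<^sub>E J A) :: 'd config set"
    have C: "?C = {\<eta>. \<forall>x\<in>J. \<eta> x \<in> A x}"
      by (auto simp: prod_emb_def space_PiM PiE_iff)
    have "local_function (indicator ?C :: 'd config \<Rightarrow> real)"
      unfolding local_function_def C using J by (intro exI[of _ J]) (auto simp: indicator_def)
    then obtain g where g: "(indicator ?C :: 'd config \<Rightarrow> real) = apply_bcontfun g"
      by (rule local_function_bcontfun)
    have "?C \<in> sets (PiM UNIV (\<lambda>_. count_space UNIV))"
      using J by (intro sets_PiM_I) auto
    then have sets: "?C \<in> sets config_space" by (simp add: config_space_def)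
    have "local_function (apply_bcontfun g)"
      using \<open>local_function (indicator ?C)\<close> by (simp only: g)
    from mean[OF this] have "measure (distr M config_space (X t)) ?C = measure (bernoulli_product \<rho>) ?C"
      using sets by (simp add: g[symmetric] sets_bernoulli_product)
    then show "emeasure (distr M config_space (X t)) ?C = emeasure (bernoulli_product \<rho>) ?C"
      by (simp add: D.emeasure_eq_measure B.emeasure_eq_measure)
  qed
qed

lemma stationary_correlation:
  assumes M: "prob_space M" and mk: "markov_with M X S"
    and init: "distr M config_space (X 0) = bernoulli_product \<rho>" and t: "0 \<le> t" and u: "0 \<le> u"
  shows "(LINT \<omega>|M. apply_bcontfun f (X t \<omega>) * apply_bcontfun f (X (t + u) \<omega>)) = pairing \<rho> f (S u f)"
proof -
  have X: "X t \<in> measurable M config_space"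
    using mk t by (simp add: markov_with_def)
  have "(LINT \<omega>|M. apply_bcontfun f (X t \<omega>) * apply_bcontfun f (X (t + u) \<omega>))
     = (LINT \<eta>|distr M config_space (X t). apply_bcontfun f \<eta> * apply_bcontfun (S u f) \<eta>)"
    unfolding markov_two_times[OF M mk t u]
    by (rule integral_distr[OF X, symmetric]) measurable
  then show ?thesis
    unfolding stationary_law[OF M mk init t] by (simp add: pairing_def mult.commute)
qed

text \<open>Stationarity makes the covariance a function of the time lag. Its continuity permits the
  passage from the Lebesgue integrals defining the variance to the gauge integrals of the calculus
  above.\<close>

lemma functional_variance_eq:
  assumes M: "prob_space M" and mk: "markov_with M X S"
    and init: "distr M config_space (X 0) = bernoulli_product \<rho>" and t: "0 \<le> t"
  shows "functional_variance M X (apply_bcontfun f) t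
    = 2 * integral {0..t} (\<lambda>v. integral {0..v} (\<lambda>r. pairing \<rho> f (S r f)))"
proof -
  let ?c = "\<lambda>r. pairing \<rho> f (S r f)"
  have cont: "continuous_on {0..T} ?c" for T
    by (rule continuous_on_subset[OF S_functional_continuous[OF bounded_linear_pairing]]) auto
  have cov: "(LINT \<omega>|M. apply_bcontfun f (X u \<omega>) * apply_bcontfun f (X v \<omega>)) = ?c \<bar>u - v\<bar>"
    if "0 \<le> u" "0 \<le> v" for u v
  proof (cases "u \<le> v")
    case True
    then show ?thesis using stationary_correlation[OF M mk init \<open>0 \<le> u\<close>, of "v - u" f] by simp
  next
    case False
    then show ?thesis
      using stationary_correlation[OF M mk init \<open>0 \<le> v\<close>, of "u - v" f] by (simp add: mult.commute)
  qed
  have cont_inner: "continuous_on {0..t} (\<lambda>v. ?c \<bar>u - v\<bar>)" if "u \<in> {0..t}" for u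
    by (intro continuous_on_compose2[OF cont[of t]] continuous_intros) (use that in auto)
  have set_int: "(LINT v:{0..t}|lborel. g v) = integral {0..t} g" if "continuous_on {0..t} g" for g :: "real \<Rightarrow> real"
    by (rule set_borel_integral_eq_integral(2)[OF borel_integrable_atLeastAtMost'[OF that]])
  let ?k = "\<lambda>u. integral {0..t} (\<lambda>v. ?c \<bar>u - v\<bar>)"
  have cont_outer: "continuous_on {0..t} ?k"
  proof -
    have "continuous_on ({0..t} \<times> cbox 0 t) (\<lambda>(u, v). ?c \<bar>u - v\<bar>)"
      unfolding split_def
      by (intro continuous_on_compose2[OF cont[of t]] continuous_intros) auto
    from integral_continuous_on_param[OF this] show ?thesis by simp
  qed
  have "functional_variance M X (apply_bcontfun f) t
     = (LINT u:{0..t}|lborel. (LINT v:{0..t}|lborel. (LINT \<omega>|M. apply_bcontfun f (X u \<omega>) * apply_bcontfun f (X v \<omega>))))"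
    unfolding functional_variance_def additive_functional_def
  proof (rule second_moment_time_integral[OF M])
    show "(\<lambda>\<omega>. apply_bcontfun f (X u \<omega>)) \<in> borel_measurable M" if "0 \<le> u" for u
      using mk that by (intro measurable_compose[OF _ bcontfun_measurable_config]) (simp add: markov_with_def)
    show "continuous (at_right u) (\<lambda>u. apply_bcontfun f (X u \<omega>))" if "0 \<le> u" "\<omega> \<in> space M" for u \<omega>
    proof -
      have "continuous (at_right u) (\<lambda>u. X u \<omega>)"
        using mk that by (simp add: markov_with_def cadlag_path_def)
      then show ?thesis
        unfolding continuous_within
        by (intro continuous_on_tendsto_compose[OF continuous_on_apply_bcontfun[of UNIV f]]) auto
    qed
  qed (rule abs_bcontfun_le_norm)
  also have "\<dots> = (LINT u:{0..t}|lborel. ?k u)"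
  proof (rule set_lebesgue_integral_cong)
    show "\<forall>u. u \<in> {0..t} \<longrightarrow> (LINT v:{0..t}|lborel. (LINT \<omega>|M. apply_bcontfun f (X u \<omega>) * apply_bcontfun f (X v \<omega>))) = ?k u"
    proof (intro allI impI)
      fix u assume u: "u \<in> {0..t}"
      have "(LINT v:{0..t}|lborel. (LINT \<omega>|M. apply_bcontfun f (X u \<omega>) * apply_bcontfun f (X v \<omega>)))
          = (LINT v:{0..t}|lborel. ?c \<bar>u - v\<bar>)"
        by (rule set_lebesgue_integral_cong) (use u in \<open>auto simp: cov\<close>)
      also have "\<dots> = ?k u"
        by (rule set_int[OF cont_inner[OF u]])
      finally show "(LINT v:{0..t}|lborel. (LINT \<omega>|M. apply_bcontfun f (X u \<omega>) * apply_bcontfun f (X v \<omega>))) = ?k u" .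
    qed
  qed simp
  also have "\<dots> = integral {0..t} ?k"
    by (rule set_int[OF cont_outer])
  also have "\<dots> = 2 * integral {0..t} (\<lambda>v. integral {0..v} ?c)"
    by (rule integral_abs_difference_kernel[OF t cont])
  finally show ?thesis .
qed

end

section \<open>From energy bounds to admissibility\<close>

lemma (in exclusion_markov_semigroup) admissible_if_H_minus_one:
  assumes \<Lambda>: "finite \<Lambda>" and N: "card \<Lambda> \<le> N"
    and H: "H_minus_one N (\<lambda>w. \<Sum>A\<in>Pow \<Lambda>. b A * w A)"
    and M: "prob_space M" and mk: "markov_with M X S"
    and init: "distr M config_space (X 0) = bernoulli_product \<rho>"
  shows "admissible M X (apply_bcontfun (\<Sum>A\<in>Pow \<Lambda>. b A *\<^sub>R basis \<rho> A))"
proof -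
  let ?f = "\<Sum>A\<in>Pow \<Lambda>. b A *\<^sub>R basis \<rho> A"
  obtain C where C: "\<And>t. 0 \<le> t \<Longrightarrow> integral {0..t} (\<lambda>v. integral {0..v} (correlation ?f)) \<le> C * t"
    using integrated_correlation_linear_bound[OF \<Lambda> refl N H] by blast
  have "functional_variance M X (apply_bcontfun ?f) t / t \<le> 2 * C" if "0 < t" for t
    using functional_variance_eq[OF M mk init, of t ?f] C[of t] that
    by (simp add: correlation_def[abs_def] field_simps)
  then have "\<forall>\<^sub>F t in at_top. ereal (functional_variance M X (apply_bcontfun ?f) t / t) \<le> ereal (2 * C)"
    by (intro eventually_mono[OF eventually_gt_at_top[of "0::real"]]) simp
  then have "Limsup at_top (\<lambda>t. ereal (functional_variance M X (apply_bcontfun ?f) t / t)) \<le> ereal (2 * C)"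
    by (rule Limsup_bounded)
  then show ?thesis
    unfolding admissible_def by (rule le_less_trans) simp
qed

text \<open>On each positive cardinality either the coefficients cancel or single evaluations are
  bounded. The empty set has no moves and its value does not enter the Dirichlet form, so its
  coefficient has to vanish separately.\<close>

lemma (in long_range_kernel) H_minus_one_by_degree:
  fixes b :: "'d site set \<Rightarrow> real"
  assumes \<Lambda>: "finite \<Lambda>" and b0: "b {} = 0"
    and deg: "\<And>n. 1 \<le> n \<Longrightarrow> (\<Sum>A\<in>{A\<in>Pow \<Lambda>. card A = n}. b A) = 0 \<or> 2 < n * CARD('d) \<or>
      \<gamma> - 1 < real (n * CARD('d)) \<or> n = 1 \<and> \<gamma> < 2 * real CARD('d)"
  shows "H_minus_one (card \<Lambda>) (\<lambda>w. \<Sum>A\<in>Pow \<Lambda>. b A * w A)"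
proof -
  define N where "N = card \<Lambda>"
  let ?P = "\<lambda>n. {A\<in>Pow \<Lambda>. card A = n}"
  have fin: "finite (?P n)" for n using \<Lambda> by simp
  have small: "A \<in> small_sets N" if "A \<in> Pow \<Lambda>" for A
    using that \<Lambda> card_mono[OF \<Lambda>] by (auto simp: small_sets_def N_def dest: finite_subset)
  have level: "H_minus_one N (\<lambda>w. \<Sum>A\<in>?P n. b A * w A)" for n
  proof (cases "n = 0")
    case True
    have "A = {}" if "A \<in> ?P n" for A
      using that True \<Lambda> by (auto dest: finite_subset)
    then have "(\<Sum>A\<in>?P n. b A * w A) = 0" for w :: "'d site set \<Rightarrow> real"
      using b0 by (intro sum.neutral) auto
    then show ?thesis by (simp add: H_minus_one_zero)
  next
    case False
    show ?thesis
    proof (cases "(\<Sum>A\<in>?P n. b A) = 0")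
      case True
      then show ?thesis
        by (intro H_minus_one_zero_sum[of _ _ n]) (use fin small in auto)
    next
      case nz: False
      show ?thesis
      proof (intro H_minus_one_sum H_minus_one_cmult H_minus_one_point)
        fix A assume A: "A \<in> ?P n"
        then show "A \<in> small_sets N" "A \<noteq> {}" using small False by auto
        show "2 < card A * CARD('d) \<or> \<gamma> - 1 < real (card A * CARD('d)) \<or>
            card A = 1 \<and> \<gamma> < 2 * real CARD('d)"
          using deg[of n] nz False A by auto
      qed
    qed
  qed
  have "(\<Sum>A\<in>Pow \<Lambda>. b A * w A) = (\<Sum>n\<le>N. \<Sum>A\<in>?P n. b A * w A)" for w :: "'d site set \<Rightarrow> real"
    using \<Lambda> by (intro sum.group[symmetric]) (auto simp: N_def card_mono)
  then show ?thesis
    unfolding N_def[symmetric] by (simp only:) (intro H_minus_one_sum level)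
qed

theorem theorem2p6:
  fixes bp bm :: "'d::finite \<Rightarrow> real"
    and \<alpha> \<rho> :: real
    and M :: "'w measure"
    and X :: "real \<Rightarrow> 'w \<Rightarrow> 'd config"
    and f :: "'d config \<Rightarrow> real"
  assumes "\<And>i. 0 < bp i" and "\<And>i. 0 < bm i"
    and "0 < \<alpha>" and "0 < \<rho>" and "\<rho> < 1"
    and "exclusion_process (jump_kernel bp bm \<alpha>) \<rho> M X"
    and "local_function f"
  shows "(CARD('d) = 1 \<longrightarrow>
            function_degree \<rho> f \<ge> 3 \<or>
            (function_degree \<rho> f = 2 \<and> \<alpha> < 2) \<or>
            (function_degree \<rho> f = 1 \<and> \<alpha> < 1) \<longrightarrow> admissible M X f) \<and>
         (CARD('d) = 2 \<longrightarrow>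
            function_degree \<rho> f \<ge> 2 \<or>
            (function_degree \<rho> f = 1 \<and> \<alpha> < 2) \<longrightarrow> admissible M X f) \<and>
         (CARD('d) \<ge> 3 \<longrightarrow>
            function_degree \<rho> f \<ge> 1 \<longrightarrow> admissible M X f)"
proof -
  let ?d = "CARD('d)" and ?s = "jump_kernel bp bm \<alpha>"
  obtain c where "long_range_kernel ?s (real ?d + \<alpha>) c"
    by (rule long_range_kernel_jump_kernel[OF assms(1-3)])
  then interpret long_range_kernel ?s "real ?d + \<alpha>" c .
  obtain S where S: "exclusion_semigroup ?s S" "markov_with M X S"
    and M: "prob_space M" and init: "distr M config_space (X 0) = bernoulli_product \<rho>"
    using assms(6) unfolding exclusion_process_def by blast
  interpret exclusion_markov_semigroup ?s "real ?d + \<alpha>" c S \<rho>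
    by unfold_locales (fact S(1) assms(4,5))+
  obtain \<Lambda> b where \<Lambda>: "finite \<Lambda>" and f: "f = apply_bcontfun (\<Sum>A\<in>Pow \<Lambda>. b A *\<^sub>R basis \<rho> A)"
    by (rule local_function_expansion[OF assms(4,5,7)])
  note coeff = function_degree_coefficients[OF assms(4,5) \<Lambda> f]
  \<comment> \<open>One alternative is asked for each cardinality n: below the degree the
    coefficients cancel, from the degree on n particles have to be transient. A positive degree
    means mean 0 at density \<rho>, which removes the empty set.\<close>
  have adm: "admissible M X f"
    if deg1: "1 \<le> function_degree \<rho> f"
      and deg: "\<And>n. 1 \<le> n \<Longrightarrow> enat n < function_degree \<rho> f \<or> 2 < n * ?d \<or>
        real ?d + \<alpha> - 1 < real (n * ?d) \<or> n = 1 \<and> real ?d + \<alpha> < 2 * real ?d"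
  proof -
    have "enat 0 < function_degree \<rho> f"
      using deg1 by (metis less_le_trans one_enat_def enat_ord_simps(2) zero_less_one)
    from coeff[OF this] have "(\<Sum>A\<in>{A\<in>Pow \<Lambda>. card A = 0}. b A) = 0" .
    moreover have "{A\<in>Pow \<Lambda>. card A = 0} = {{}}"
      using \<Lambda> by (auto dest: finite_subset)
    ultimately have "b {} = 0" by simp
    from H_minus_one_by_degree[of \<Lambda> b, OF \<Lambda> this] have "H_minus_one (card \<Lambda>) (\<lambda>w. \<Sum>A\<in>Pow \<Lambda>. b A * w A)"
      using deg coeff by blast
    then show ?thesis
      unfolding f by (rule admissible_if_H_minus_one[OF \<Lambda> order_refl _ M S(2) init])
  qed
  have small: "n = 1 \<or> n = 2 \<or> 3 \<le> n" if "1 \<le> n" for n :: nat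
    using that by linarith
  have lt: "enat n < e" if "enat m \<le> e" "n < m" for n m and e :: enat
    using that by (meson enat_ord_simps(2) less_le_trans)
  show ?thesis
  proof (intro conjI impI)
    \<comment> \<open>In dimension 1 the long jump condition reads \<alpha> < n, and unit steps
      cover n \<ge> 3. Only the cardinalities 1 and 2 depend on the degree or on \<alpha>.\<close>
    assume d: "?d = 1" and c: "function_degree \<rho> f \<ge> 3 \<or> (function_degree \<rho> f = 2 \<and> \<alpha> < 2) \<or>
      (function_degree \<rho> f = 1 \<and> \<alpha> < 1)"
    have e: "(3::enat) = enat 3" "(2::enat) = enat 2" "(1::enat) = enat 1"
      by (simp_all add: numeral_eq_enat one_enat_def)
    show "admissible M X f"
    proof (rule adm)
      show "1 \<le> function_degree \<rho> f"
        using c by (auto simp: e elim: order_trans[rotated])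
      fix n :: nat assume "1 \<le> n"
      then show "enat n < function_degree \<rho> f \<or> 2 < n * ?d \<or>
        real ?d + \<alpha> - 1 < real (n * ?d) \<or> n = 1 \<and> real ?d + \<alpha> < 2 * real ?d"
        using small[of n] c lt[of 3 "function_degree \<rho> f" n] by (auto simp: d e)
    qed
  next
    \<comment> \<open>In dimension 2 unit steps cover n \<ge> 2. For n = 1 the jumps in all
      directions give \<alpha> < 2, where jumps along an axis would stop at \<alpha> < 1.\<close>
    assume d: "?d = 2" and c: "function_degree \<rho> f \<ge> 2 \<or> (function_degree \<rho> f = 1 \<and> \<alpha> < 2)"
    have e: "(2::enat) = enat 2" "(1::enat) = enat 1"
      by (simp_all add: numeral_eq_enat one_enat_def)
    show "admissible M X f"
    proof (rule adm)
      show "1 \<le> function_degree \<rho> f"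
        using c by (auto simp: e elim: order_trans[rotated])
      fix n :: nat assume "1 \<le> n"
      then show "enat n < function_degree \<rho> f \<or> 2 < n * ?d \<or>
        real ?d + \<alpha> - 1 < real (n * ?d) \<or> n = 1 \<and> real ?d + \<alpha> < 2 * real ?d"
        using small[of n] c lt[of 2 "function_degree \<rho> f" n] by (auto simp: d e)
    qed
  next
    \<comment> \<open>From dimension 3 on, a single particle is already transient by unit
      steps.\<close>
    assume d: "3 \<le> ?d" and c: "1 \<le> function_degree \<rho> f"
    show "admissible M X f"
    proof (rule adm[OF c])
      fix n :: nat assume "1 \<le> n"
      then have "?d \<le> n * ?d" by simp
      then show "enat n < function_degree \<rho> f \<or> 2 < n * ?d \<or>
        real ?d + \<alpha> - 1 < real (n * ?d) \<or> n = 1 \<and> real ?d + \<alpha> < 2 * real ?d"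
        using d by linarith
    qed
  qed
qed

end
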